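(* Let $D=D_1\times\cdots\times D_n\subset\mathbb{C}^n$ be a bounded product domain, where each $D_k\subset\mathbb{C}$ is a domain with piecewise $C^1$ boundary. For a given $p\in[1,\infty]$, choose $r>\max\{2p/(p+2),1\}$ (with $2p/(p+2)$ read as $2$ when $p=\infty$). Let $f$ be a $\bar\partial$-closed $(0,1)$-form on $D$. For each nonempty $I=\{i_1,\dots,i_l\}\subset\{1,\dots,n\}$ with complement $I^c=\{j_1,\dots,j_{n-l}\}$, let $D'=D_{i_1}\times\cdots\times D_{i_l}$ and $D''=D_{j_1}\times\cdots\times D_{j_{n-l}}$, and assume $$\left(\int_{D'}\left|f_I(z',z'')\right|^r\,dV(z')\right)^{1/r}\in L^p(D'')$$ as a function of $z''\in D''$ (when $I=\{1,\dots,n\}$ this assumption means $\|f_I\|_{L^r(D)}<\infty$). Then $\bar\partial(Tf)=f$ weakly, and there is a constant $C>0$ independent of $f$ such that, for $p<\infty$, $$\|Tf\|^p_{L^p(D)}\le C\sum_{\emptyset\neq I\subset\{1,\dots,n\}}\int_{D''}\left(\int_{D'}\left|f_I(z',z'')\right|^r\,dV(z')\right)^{p/r}dV(z''),$$ where the term for $I=\{1,\dots,n\}$ is understood as $\|f_I\|_{L^r(D)}^p$; and for $p=\infty$, $$\|Tf\|_{L^\infty(D)}\le C\sum_{\emptyset\neq I\subset\{1,\dots,n\}}\ \operatorname*{ess\,sup}_{z''\in D''}\left(\int_{D'}\left|f_I(z',z'')\right|^r\,dV(z')\right)^{1/r},$$ where the term for $I=\{1,\dots,n\}$ is $\|f_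I\|_{L^r(D)}$.
   Context: For a $(0,1)$-form $f=\sum_{j=1}^n f_j\,d\bar z_j$ on $D$ and nonempty $I=\{i_1,\dots,i_l\}\subset\{1,\dots,n\}$, set $f_I=f_j$ if $I=\{j\}$ and $f_I=\frac{\partial^{l-1}f_{i_1}}{\partial\bar\zeta_{i_2}\cdots\partial\bar\zeta_{i_l}}$ if $l>1$, with derivatives in the sense of distributions. When $\bar\partial f=0$ weakly, $f_I$ depends only on the set $I$. Closedness of $f$ is understood weakly. For nonempty $I=\{i_1,\dots,i_l\}\subset\{1,\dots,n\}$ with complement $I^c=\{1,\dots,n\}\setminus I=\{j_1,\dots,j_{n-l}\}$, $z'=(z_{i_1},\dots,z_{i_l})$ and $z''=(z_{j_1},\dots,z_{j_{n-l}})$; $h(z',z'')$ denotes $h(z_1,\dots,z_n)$ with the variables placed in their proper slots; $dV$ denotes Lebesgue measure in the indicated variables (up to a constant factor). The operator $T$ is $$T(f)=-\sum_{\emptyset\neq I\subset\{1,\dots,n\}}\boldsymbol{C}^{I}\left(f_I^{I^c}\right),$$ where for $I=\{i_1,\dots,i_l\}$ $$\boldsymbol{C}^I\left(f_I^{I^c}\right)(z)=\frac{1}{(2\pi i)^l}\int_{D_{i_1}\times\cdots\times D_{i_l}}\frac{f_I(w)\,d\bar\zeta_{i_1}\wedge d\zeta_{i_1}\wedge\cdots\wedge d\bar\zeta_{i_l}\wedge d\zeta_{i_l}}{(\zeta_{i_1}-z_{i_1})\cdots(\zeta_{i_l}-z_{i_l})},$$ with $w_i=\zeta_i$ for $i\in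 I$ and $w_j=z_j$ for $j\in I^c$ (defined for a.e. $z\in D$). *)

theory Defs
  imports "HOL-Analysis.Analysis" "HOL-Probability.Essential_Supremum"
begin

text \<open>The index set \<open>{1,\<dots>,n}\<close> is the finite type \<^typ>\<open>'n\<close>; a \<open>(0,1)\<close>-form
  \<open>\<Sum>\<^sub>j f\<^sub>j d\<zeta>\<^sub>j\<close> (conjugate differentials) is the family of its coefficients
  \<open>f :: 'n \<Rightarrow> complex ^ 'n \<Rightarrow> complex\<close>. Only values on the domain matter.\<close>

section \<open>Domains\<close>

text \<open>The boundary consists of finitely many piecewise \<open>C\<^sup>1\<close> Jordan curves. The curves may
  touch and \<^const>\<open>valid_path\<close> does not ask for nonvanishing speed.\<close>

definition piecewise_C1_boundary :: "complex set \<Rightarrow> bool" where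
  "piecewise_C1_boundary U \<longleftrightarrow>
     (\<exists>\<Gamma> :: (real \<Rightarrow> complex) set. finite \<Gamma> \<and>
        (\<forall>\<gamma>\<in>\<Gamma>. valid_path \<gamma> \<and> simple_path \<gamma> \<and> pathfinish \<gamma> = pathstart \<gamma>) \<and>
        frontier U = (\<Union>\<gamma>\<in>\<Gamma>. path_image \<gamma>))"

definition product_domain :: "('n::finite \<Rightarrow> complex set) \<Rightarrow> (complex ^ 'n) set" where
  "product_domain D = {z. \<forall>k. z $ k \<in> D k}"

text \<open>Lebesgue measure on the partial product of the \<open>D i\<close>, \<open>i \<in> I\<close>. For \<open>I = {}\<close> this is the
  one-point probability space, so integrals and essential suprema over it are evaluations.\<close>

definition vol :: "('n \<Rightarrow> complex set) \<Rightarrow> 'n set \<Rightarrow> ('n \<Rightarrow> complex) measure" where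
  "vol D I = restrict_space (completion (Pi\<^sub>M I (\<lambda>_. lborel))) (Pi\<^sub>E I D)"

definition glue :: "'n set \<Rightarrow> ('n \<Rightarrow> complex) \<Rightarrow> ('n \<Rightarrow> complex) \<Rightarrow> complex ^ 'n::finite" where
  "glue I z' z'' = (\<chi> i. if i \<in> I then z' i else z'' i)"

section \<open>Weak derivatives\<close>

primrec Ck :: "nat \<Rightarrow> ('a::euclidean_space \<Rightarrow> 'b::real_normed_vector) \<Rightarrow> bool" where
  "Ck 0 f = continuous_on UNIV f"
| "Ck (Suc m) f = ((\<forall>x. f differentiable (at x)) \<and>
                   (\<forall>v. Ck m (\<lambda>x. frechet_derivative f (at x) v)))"

definition test_function :: "('a::euclidean_space) set \<Rightarrow> ('a \<Rightarrow> complex) \<Rightarrow> bool" where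
  "test_function U \<phi> \<longleftrightarrow>
     (\<forall>m. Ck m \<phi>) \<and> compact (closure {x. \<phi> x \<noteq> 0}) \<and> closure {x. \<phi> x \<noteq> 0} \<subseteq> U"

text \<open>The Wirtinger derivative \<open>(\<partial>/\<partial>x\<^sub>k + \<i> \<partial>/\<partial>y\<^sub>k) / 2\<close>.\<close>

definition dbar :: "'n \<Rightarrow> (complex ^ 'n::finite \<Rightarrow> complex) \<Rightarrow> complex ^ 'n \<Rightarrow> complex" where
  "dbar k \<phi> z = (frechet_derivative \<phi> (at z) (axis k 1)
               + \<i> * frechet_derivative \<phi> (at z) (axis k \<i>)) / 2"

definition locally_integrable_on ::
    "('a::euclidean_space \<Rightarrow> complex) \<Rightarrow> 'a set \<Rightarrow> bool" (infix \<open>locally'_integrable'_on\<close> 46) where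
  "u locally_integrable_on U \<longleftrightarrow> (\<forall>K. compact K \<and> K \<subseteq> U \<longrightarrow> u absolutely_integrable_on K)"

text \<open>\<open>g\<close> is the distributional derivative of \<open>u\<close> with respect to the conjugate variables listed
  in \<open>ks\<close>. For \<open>ks = []\<close> this says that \<open>u = g\<close> almost everywhere.\<close>

definition weak_dbar ::
    "(complex ^ 'n::finite) set \<Rightarrow> 'n list \<Rightarrow> (complex ^ 'n \<Rightarrow> complex) \<Rightarrow> (complex ^ 'n \<Rightarrow> complex) \<Rightarrow> bool" where
  "weak_dbar U ks u g \<longleftrightarrow> u locally_integrable_on U \<and> g locally_integrable_on U \<and>
     (\<forall>\<phi>. test_function U \<phi> \<longrightarrow>
        (LINT z:U|lebesgue. g z * \<phi> z) =
          (- 1) ^ length ks * (LINT z:U|lebesgue. u z * foldr dbar ks \<phi> z))"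

text \<open>The coefficient of the \<open>(0,2)\<close>-form \<open>\<partial>\<close>-bar of \<open>f\<close> at \<open>j, k\<close> is
  \<open>dbar j (f k) - dbar k (f j)\<close>, taken as a distribution.\<close>

definition weakly_dbar_closed ::
    "(complex ^ 'n::finite) set \<Rightarrow> ('n \<Rightarrow> complex ^ 'n \<Rightarrow> complex) \<Rightarrow> bool" where
  "weakly_dbar_closed U f \<longleftrightarrow>
     (\<forall>j k \<phi>. test_function U \<phi> \<longrightarrow>
        (LINT z:U|lebesgue. f k z * dbar j \<phi> z) = (LINT z:U|lebesgue. f j z * dbar k \<phi> z))"

definition weakly_solves_dbar ::
    "(complex ^ 'n::finite) set \<Rightarrow> (complex ^ 'n \<Rightarrow> complex) \<Rightarrow> ('n \<Rightarrow> complex ^ 'n \<Rightarrow> complex) \<Rightarrow> bool" where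
  "weakly_solves_dbar U u f \<longleftrightarrow> (\<forall>k. weak_dbar U [k] u (f k))"

section \<open>The functions \<open>f\<^sub>I\<close> and the solution operator\<close>

text \<open>For closed \<open>f\<close> the distributional derivative depends only on the set \<open>I\<close>, so any enumeration
  \<open>i\<^sub>1 # [i\<^sub>2, \<dots>, i\<^sub>l]\<close> of \<open>I\<close> may be used.\<close>

definition represents_f_I ::
    "(complex ^ 'n::finite) set \<Rightarrow> ('n \<Rightarrow> complex ^ 'n \<Rightarrow> complex) \<Rightarrow> 'n set \<Rightarrow> (complex ^ 'n \<Rightarrow> complex) \<Rightarrow> bool" where
  "represents_f_I U f I g \<longleftrightarrow>
     (\<exists>i is. distinct (i # is) \<and> set (i # is) = I \<and> weak_dbar U is (f i) g)"

text \<open>For \<open>I\<close> with more than one element, \<open>f\<^sub>I\<close> is determined almost everywhere if it is a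
  function at all; one representative is selected.\<close>

definition f_I ::
    "(complex ^ 'n::finite) set \<Rightarrow> ('n \<Rightarrow> complex ^ 'n \<Rightarrow> complex) \<Rightarrow> 'n set \<Rightarrow> complex ^ 'n \<Rightarrow> complex" where
  "f_I U f I = (if is_singleton I then f (the_elem I) else (SOME g. represents_f_I U f I g))"

text \<open>Each \<open>d\<zeta>\<close>-conjugate \<open>\<and> d\<zeta>\<close> equals \<open>2 \<i> dV\<close>, which gives the factor \<open>(2 \<i>)\<^sup>l\<close>.\<close>

definition C_integrand ::
    "'n set \<Rightarrow> (complex ^ 'n::finite \<Rightarrow> complex) \<Rightarrow> complex ^ 'n \<Rightarrow> ('n \<Rightarrow> complex) \<Rightarrow> complex" where
  "C_integrand I g z \<zeta> = g (glue I \<zeta> (\<lambda>j. z $ j)) * (2 * \<i>) ^ card I / (\<Prod>i\<in>I. \<zeta> i - z $ i)"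

definition C_op ::
    "('n \<Rightarrow> complex set) \<Rightarrow> 'n set \<Rightarrow> (complex ^ 'n::finite \<Rightarrow> complex) \<Rightarrow> complex ^ 'n \<Rightarrow> complex" where
  "C_op D I g z = 1 / (2 * of_real pi * \<i>) ^ card I * (LINT \<zeta>|vol D I. C_integrand I g z \<zeta>)"

definition T_op ::
    "('n::finite \<Rightarrow> complex set) \<Rightarrow> ('n \<Rightarrow> complex ^ 'n \<Rightarrow> complex) \<Rightarrow> complex ^ 'n \<Rightarrow> complex" where
  "T_op D f z = - (\<Sum>I\<in>{I. I \<noteq> {}}. C_op D I (f_I (product_domain D) f I) z)"

section \<open>Norms\<close>

text \<open>Powers with exponent \<open>a > 0\<close>.\<close>

definition epow :: "ennreal \<Rightarrow> real \<Rightarrow> ennreal" where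
  "epow x a = (if x = \<infinity> then \<infinity> else ennreal (enn2real x powr a))"

definition Lp_norm :: "ennreal \<Rightarrow> 'a measure \<Rightarrow> ('a \<Rightarrow> ennreal) \<Rightarrow> ennreal" where
  "Lp_norm p M h =
     (if p = \<infinity> then esssup M h
      else epow (\<integral>\<^sup>+ x. epow (h x) (enn2real p) \<partial>M) (1 / enn2real p))"

definition in_Lp :: "ennreal \<Rightarrow> 'a measure \<Rightarrow> ('a \<Rightarrow> ennreal) \<Rightarrow> bool" where
  "in_Lp p M h \<longleftrightarrow> h \<in> borel_measurable M \<and> Lp_norm p M h < \<infinity>"

definition slice_integral ::
    "real \<Rightarrow> ('n \<Rightarrow> complex set) \<Rightarrow> 'n set \<Rightarrow> (complex ^ 'n::finite \<Rightarrow> complex) \<Rightarrow> ('n \<Rightarrow> complex) \<Rightarrow> ennreal" where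
  "slice_integral r D I g z'' = (\<integral>\<^sup>+ z'. ennreal (norm (g (glue I z' z'')) powr r) \<partial>vol D I)"

end

theory Submission
  imports Defs "HOL-Real_Asymp.Real_Asymp"
begin

text \<open>Up to a constant, \<open>C\<^sup>I\<close> is convolution in the variables \<open>z\<^sub>i\<close>, \<open>i \<in> I\<close>, with
  \<open>\<Prod>\<^sub>i 1 / z\<^sub>i\<close>. As all \<open>D\<^sub>i\<close> lie in the disc of radius \<open>R\<close>, the kernel may be cut off at
  \<open>2R\<close>, and it then lies in \<open>L\<^sup>s\<close> for every \<open>s < 2\<close>. The condition on \<open>r\<close> says precisely that
  Young's inequality on \<open>D'\<close> applies with such an \<open>s\<close>, and the norm estimate follows by integrating
  over \<open>z''\<close>.

  For the equation, Fubini moves \<open>C\<^sup>I\<close> to the test function \<open>\<phi>\<close> as the adjoint operator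
  \<open>S\<^sub>I\<close> (\<open>cauchy_adjoint\<close>). If \<open>k \<in> I\<close>, the Cauchy--Pompeiu formula gives
  \<open>S\<^sub>I \<partial>\<^sub>k \<phi> = S\<^bsub>I - {k}\<^esub> \<phi>\<close> on \<open>D\<close>, where \<open>\<partial>\<^sub>k\<close> is the derivative in the conjugate of \<open>z\<^sub>k\<close>. If
  \<open>k \<notin> I\<close>, then \<open>\<partial>\<^sub>k\<close> commutes with \<open>S\<^sub>I\<close>, and
  \<open>\<integral> f\<^sub>I \<partial>\<^sub>k S\<^sub>I \<phi> = - \<integral> f\<^bsub>I \<union> {k}\<^esub> S\<^sub>I \<phi>\<close> because \<open>S\<^sub>I \<phi>\<close> can be cut off by a function of the
  variables in \<open>I\<close>. In the sum over \<open>I\<close> everything cancels except \<open>\<integral> f\<^sub>k \<phi>\<close>.\<close>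

section \<open>Smooth functions\<close>

text \<open>The coefficients \<open>f_I\<close> are only Lebesgue measurable and are fixed only up
  to null sets, while their integrals run over completed product measures. The analysis is therefore
  done with Borel representatives that vanish off the domain, integrated against
  \<open>lborel\<close> and \<open>PL I\<close>; almost-everywhere comparison connects them with the
  original objects. Working on whole spaces also makes \<open>C_op\<close> a genuine convolution, so
  that translations may be applied freely.

  Fubini needs \<open>f_I\<close> to be integrable on the domain. This is not assumed but extracted
  from the slice condition, using that the domain is bounded and that \<open>p\<close> and
  \<open>r\<close> are at least 1.

  Young's inequality wants an exponent that is at most \<open>p\<close>. If \<open>r\<close> exceeds
  \<open>p\<close>, then \<open>min r p\<close> takes its place, at the price of the finite volume
  of the slices.

  Derivatives under the integral always fall on the test function, so the singular kernel enters
  only through its integrability; the Cauchy--Pompeiu formula is obtained from smooth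
  regularisations of that kernel.\<close>

lemma Ck_Suc_imp: "Ck (Suc m) f \<Longrightarrow> Ck m f"
proof (induction m arbitrary: f)
  case 0
  then show ?case
    by (simp add: continuous_on_eq_continuous_at differentiable_imp_continuous_within)
next
  case (Suc m)
  then show ?case by (metis Ck.simps(2))
qed

text \<open>By uniqueness of derivatives an explicit candidate may stand in for
  \<open>frechet_derivative\<close>; the inductions for sums, products and compositions run through
  this rule.\<close>

lemma Ck_SucI:
  assumes "\<And>x. (f has_derivative f' x) (at x)" and "\<And>v. Ck m (\<lambda>x. f' x v)"
  shows "Ck (Suc m) f"
proof -
  have "frechet_derivative f (at x) = f' x" for x
    using frechet_derivative_at[OF assms(1)] by simp
  with assms show ?thesis by (auto simp: differentiable_def)
qed

section \<open>Closure properties of the classes \<open>Ck\<close>\<close>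

lemma Ck_const [simp]: "Ck m (\<lambda>x. c)"
proof (induction m arbitrary: c)
  case (Suc m)
  show ?case by (rule Ck_SucI[where f' = "\<lambda>_ _. 0"]) (auto simp: Suc)
qed simp

lemma Ck_bounded_linear: "bounded_linear f \<Longrightarrow> Ck m f"
proof (cases m)
  case (Suc k)
  assume "bounded_linear f"
  with Suc show ?thesis
    by (auto intro!: Ck_SucI[where f' = "\<lambda>_. f"] bounded_linear_imp_has_derivative simp del:
        Ck.simps)
qed (auto intro: linear_continuous_on)

lemma Ck_bounded_linear_compose:
  assumes L: "bounded_linear L" shows "Ck m f \<Longrightarrow> Ck m (\<lambda>x. L (f x))"
proof (induction m arbitrary: f)
  case 0
  then show ?case using L by (auto intro: bounded_linear.continuous_on)
next
  case (Suc m)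
  then show ?case
    by (intro Ck_SucI[where f' = "\<lambda>x v. L (frechet_derivative f (at x) v)"]
        bounded_linear.has_derivative[OF L]) (auto simp: frechet_derivative_works)
qed

lemma Ck_add: "Ck m f \<Longrightarrow> Ck m g \<Longrightarrow> Ck m (\<lambda>x. f x + g x)"
proof (induction m arbitrary: f g)
  case 0
  then show ?case by (auto intro: continuous_intros)
next
  case (Suc m)
  then show ?case
    by (intro Ck_SucI[where f' = "\<lambda>x v. frechet_derivative f (at x) v
        + frechet_derivative g (at x) v"]
        has_derivative_add) (auto simp: frechet_derivative_works)
qed

lemma Ck_mult:
  fixes f g :: "'a::euclidean_space \<Rightarrow> 'b::real_normed_algebra"
  shows "Ck m f \<Longrightarrow> Ck m g \<Longrightarrow> Ck m (\<lambda>x. f x * g x)"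
proof (induction m arbitrary: f g)
  case 0
  then show ?case by (auto intro: continuous_intros)
next
  case (Suc m)
  have "Ck m f" "Ck m g" using Suc.prems Ck_Suc_imp by blast+
  with Suc show ?case
    by (intro Ck_SucI[where f' = "\<lambda>x v. f x * frechet_derivative g (at x) v
        + frechet_derivative f (at x) v * g x"]
        has_derivative_mult Ck_add) (auto simp: frechet_derivative_works)
qed

lemma Ck_diff: "Ck m f \<Longrightarrow> Ck m g \<Longrightarrow> Ck m (\<lambda>x. f x - g x)"
  using Ck_add[of m f "\<lambda>x. - g x"] Ck_bounded_linear_compose[OF bounded_linear_minus[OF
      bounded_linear_ident], of m g]
  by simp

lemma Ck_prod:
  fixes f :: "'i \<Rightarrow> 'a::euclidean_space \<Rightarrow> 'b::{real_normed_algebra_1,comm_ring_1}"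
  shows "(\<And>i. i \<in> A \<Longrightarrow> Ck m (f i)) \<Longrightarrow> Ck m (\<lambda>x. \<Prod>i\<in>A. f i x)"
  by (induction A rule: infinite_finite_induct) (auto intro: Ck_mult)

lemma Ck_power:
  fixes f :: "'a::euclidean_space \<Rightarrow> 'b::{real_normed_algebra_1,comm_ring_1}"
  shows "Ck m f \<Longrightarrow> Ck m (\<lambda>x. f x ^ n)"
  using Ck_prod[of "{..<n}" m "\<lambda>_. f"] by simp

lemma smooth_differentiable: "\<forall>m. Ck m f \<Longrightarrow> f differentiable (at x)"
  by (metis Ck.simps(2))

lemma smooth_frechet_derivative: "\<forall>m. Ck m f \<Longrightarrow> \<forall>m. Ck m (\<lambda>x. frechet_derivative f (at x) v)"
  by (metis Ck.simps(2))

lemma smooth_has_derivative: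
  "\<forall>m. Ck m f \<Longrightarrow> (f has_derivative frechet_derivative f (at x)) (at x)"
  by (metis smooth_differentiable frechet_derivative_works)

lemma smooth_continuous: "\<forall>m. Ck m f \<Longrightarrow> continuous_on A f"
  by (metis Ck.simps(1) continuous_on_subset top_greatest)

text \<open>The derivatives of \<open>exp (-1/t)\<close> are linear combinations of these functions.\<close>

definition flat :: "nat \<Rightarrow> real \<Rightarrow> real" where
  "flat j t = (if t > 0 then exp (- inverse t) * inverse t ^ j else 0)"

lemma flat_tendsto_0: "((\<lambda>t. exp (- inverse t) * inverse t ^ j) \<longlongrightarrow> 0) (at_right (0::real))"
proof -
  have "((\<lambda>x::real. x ^ j / exp x) \<longlongrightarrow> 0) at_top" by (rule tendsto_power_div_exp_0)
  from filterlim_compose[OF this filterlim_inverse_at_top_right]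
  show ?thesis by (simp add: exp_minus divide_inverse mult.commute)
qed

text \<open>At 0 the difference quotient of \<open>flat j\<close> is \<open>flat (j + 1)\<close> on
  the right and 0 on the left, so the derivative is 0, which is also what the formula gives
  there.\<close>

lemma flat_has_derivative:
  "(flat j has_real_derivative flat (j + 2) t - real j * flat (j + 1) t) (at t)"
proof -
  consider "t > 0" | "t < 0" | "t = 0" by linarith
  then show ?thesis
  proof cases
    case 1
    have "((\<lambda>t. exp (- inverse t) * inverse t ^ j) has_real_derivative
      flat (j + 2) t - real j * flat (j + 1) t) (at t)"
    proof (rule DERIV_cong)
      show "((\<lambda>t. exp (- inverse t) * inverse t ^ j) has_real_derivative
        exp (- inverse t) * inverse t ^ 2 * inverse t ^ j
        + exp (- inverse t) * (real j * inverse t ^ (j - 1) * (- (inverse t ^ 2)))) (at t)"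
        using 1 by (auto intro!: derivative_eq_intros simp: power2_eq_square)
      show "exp (- inverse t) * inverse t ^ 2 * inverse t ^ j
        + exp (- inverse t) * (real j * inverse t ^ (j - 1) * (- (inverse t ^ 2)))
            = flat (j + 2) t - real j * flat (j + 1) t"
        using 1 by (cases j) (auto simp: flat_def power2_eq_square algebra_simps)
    qed
    then show ?thesis
    proof (rule has_field_derivative_transform_within_open[where S = "{0<..}"])
    qed (use 1 in \<open>auto simp: flat_def\<close>)
  next
    case 2
    have "((\<lambda>t. 0) has_real_derivative flat (j + 2) t - real j * flat (j + 1) t) (at t)"
      using 2 by (auto simp: flat_def)
    then show ?thesis
    proof (rule has_field_derivative_transform_within_open[where S = "{..<0}"])
    qed (use 2 in \<open>auto simp: flat_def\<close>)
  next
    case 3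
    have r: "((\<lambda>t. flat j t / t) \<longlongrightarrow> 0) (at_right 0)"
      using flat_tendsto_0[of "Suc j"]
      by (rule Lim_transform_eventually)
        (auto simp: eventually_at_filter flat_def field_simps)
    have l: "((\<lambda>t. flat j t / t) \<longlongrightarrow> 0) (at_left 0)"
      by (rule Lim_transform_eventually[OF tendsto_const])
        (auto simp: eventually_at_filter flat_def field_simps)
    have "((\<lambda>t. flat j t / t) \<longlongrightarrow> 0) (at 0)"
      using filterlim_split_at[OF l r] .
    then show ?thesis using 3 by (simp add: has_field_derivative_iff flat_def)
  qed
qed

text \<open>The induction keeps \<open>j\<close> arbitrary because one derivative of
  \<open>flat j\<close> brings in \<open>flat (j + 1)\<close> and
  \<open>flat (j + 2)\<close>.\<close>

lemma Ck_flat_compose: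
  fixes q :: "'a::euclidean_space \<Rightarrow> real"
  assumes q: "\<And>m. Ck m q"
  shows "Ck m (\<lambda>x. flat j (q x))"
proof (induction m arbitrary: j)
  case 0
  have "continuous_on UNIV (flat j)"
    by (intro continuous_at_imp_continuous_on ballI) (rule DERIV_isCont[OF flat_has_derivative])
  with q[of 0] show ?case by (auto intro: continuous_on_compose2)
next
  case (Suc m)
  have qd: "(q has_derivative frechet_derivative q (at x)) (at x)" for x
    using q smooth_has_derivative by blast
  show ?case
  proof (rule Ck_SucI)
    fix x show "((\<lambda>x. flat j (q x)) has_derivative
      (\<lambda>v. (flat (j + 2) (q x) - real j * flat (j + 1) (q x)) * frechet_derivative q (at x) v))
          (at x)"
      using has_derivative_compose[OF qd flat_has_derivative[of j "q x",
          unfolded has_field_derivative_def]] by simp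
  next
    fix v
    have "Ck m (\<lambda>x. frechet_derivative q (at x) v)" using q smooth_frechet_derivative by blast
    then show "Ck m (\<lambda>x. (flat (j + 2) (q x) - real j * flat (j
        + 1) (q x)) * frechet_derivative q (at x) v)"
      by (intro Ck_mult Ck_diff Suc Ck_const)
  qed
qed


section \<open>Symmetry of mixed second derivatives\<close>

lemma real_second_difference:
  fixes f :: "'a::euclidean_space \<Rightarrow> real"
  assumes df: "\<And>x. f differentiable (at x)"
    and d2f: "\<And>x. (\<lambda>x. frechet_derivative f (at x) v) differentiable (at x)"
    and h: "h > 0"
  shows "\<exists>y. norm (y - x) \<le> h * (norm v + norm w) \<and>
    f (x + h *\<^sub>R v + h *\<^sub>R w) - f (x + h *\<^sub>R v) - f (x + h *\<^sub>R w) + f x =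
    h * h * frechet_derivative (\<lambda>x. frechet_derivative f (at x) v) (at y) w"
proof -
  let ?f' = "\<lambda>x. frechet_derivative f (at x) v"
  have d: "((\<lambda>s. g (a + s *\<^sub>R b)) has_real_derivative frechet_derivative g (at (a
      + s *\<^sub>R b)) b) (at s)"
    if g: "\<And>x. g differentiable (at x)" for g :: "'a \<Rightarrow> real" and a b s
  proof -
    have "((\<lambda>s. a + s *\<^sub>R b) has_derivative (\<lambda>h. h *\<^sub>R b)) (at s)"
      by (auto intro!: derivative_eq_intros)
    moreover have "(g has_derivative frechet_derivative g (at (a + s *\<^sub>R b))) (at (a + s *\<^sub>R b))"
      using g frechet_derivative_works by blast
    ultimately have "((\<lambda>s. g (a + s *\<^sub>R b)) has_derivative (\<lambda>h. frechet_derivative g (at (a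
        + s *\<^sub>R b)) (h *\<^sub>R b))) (at s)"
      using has_derivative_compose[where f = "\<lambda>s. a + s *\<^sub>R b" and g = g] by blast
    then show ?thesis
      using linear_frechet_derivative[OF g] by (simp add: has_field_derivative_def linear_scale
          mult_commute_abs)
  qed
  \<comment> \<open>The first mean value theorem runs along \<open>v\<close>, applied to the
    difference of \<open>f\<close> between the base points \<open>x + h *\<^sub>R w\<close> and
    \<open>x\<close>. The second one runs along \<open>w\<close>, applied to the derivative of
    \<open>f\<close> in direction \<open>v\<close>.\<close>
  have "\<exists>s. 0 < s \<and> s < h \<and> (f (x + h *\<^sub>R w + h *\<^sub>R v) - f (x + h *\<^sub>R v)) - (f (x + h *\<^sub>R w
      + 0 *\<^sub>R v) - f (x + 0 *\<^sub>R v))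
    = (h - 0) * (?f' (x + h *\<^sub>R w + s *\<^sub>R v) - ?f' (x + s *\<^sub>R v))"
    using h by (intro MVT2) (auto intro!: DERIV_diff d df)
  then obtain s where s: "0 < s" "s < h" "f (x + h *\<^sub>R w + h *\<^sub>R v) - f (x + h *\<^sub>R v) - f (x
      + h *\<^sub>R w) + f x
    = h * (?f' (x + h *\<^sub>R w + s *\<^sub>R v) - ?f' (x + s *\<^sub>R v))" by (auto simp: algebra_simps)
  let ?g = "\<lambda>t. ?f' (x + s *\<^sub>R v + t *\<^sub>R w)"
  have "\<exists>t. 0 < t \<and> t < h \<and> ?g h - ?g 0 = (h - 0) * frechet_derivative ?f' (at (x + s *\<^sub>R v
      + t *\<^sub>R w)) w"
    using h by (intro MVT2) (auto intro!: d d2f)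
  then obtain t where t: "0 < t" "t < h" "?g h - ?g 0 = h * frechet_derivative ?f' (at (x
      + s *\<^sub>R v + t *\<^sub>R w)) w"
    by auto
  have e: "x + h *\<^sub>R w + s *\<^sub>R v = x + s *\<^sub>R v + h *\<^sub>R w" "x + h *\<^sub>R w + h *\<^sub>R v
      = x + h *\<^sub>R v + h *\<^sub>R w" by (simp_all add: algebra_simps)
  have "norm (x + s *\<^sub>R v + t *\<^sub>R w - x) \<le> h * (norm v + norm w)"
    using s(1,2) t(1,2) norm_triangle_ineq[of "s *\<^sub>R v" "t *\<^sub>R w"]
      mult_right_mono[of s h "norm v"] mult_right_mono[of t h "norm w"] by (simp add: algebra_simps)
  then show ?thesis using s(3)[unfolded e] t(3) by (intro exI[of _ "x + s *\<^sub>R v + t *\<^sub>R w"]) simp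
qed

text \<open>The second difference is symmetric in \<open>v\<close> and \<open>w\<close>, so the two
  mixed derivatives take equal values at points near \<open>x\<close>. With h = 1/(n+1) these points
  tend to \<open>x\<close>, and continuity carries the equality over.\<close>

lemma smooth_real_mixed_commute:
  fixes f :: "'a::euclidean_space \<Rightarrow> real"
  assumes f: "\<forall>m. Ck m f"
  shows "frechet_derivative (\<lambda>x. frechet_derivative f (at x) v) (at x) w
       = frechet_derivative (\<lambda>x. frechet_derivative f (at x) w) (at x) v"
proof -
  let ?D = "\<lambda>v w x. frechet_derivative (\<lambda>x. frechet_derivative f (at x) v) (at x) w"
  have sm: "\<forall>m. Ck m (\<lambda>x. frechet_derivative f (at x) v)" for v
    using f by (rule smooth_frechet_derivative)
  let ?e = "\<lambda>n. inverse (real (Suc n)) * (norm v + norm w)"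
  have "\<exists>y y'. norm (y - x) \<le> ?e n \<and> norm (y' - x) \<le> ?e n \<and> ?D v w y = ?D w v y'" for n
  proof -
    define h where "h = inverse (real (Suc n))"
    have h: "h > 0" by (simp add: h_def)
    note sd = real_second_difference[OF smooth_differentiable[OF f] smooth_differentiable[OF sm] h]
    obtain y y' where y: "norm (y - x) \<le> h * (norm v + norm w)" "norm (y' - x)
        \<le> h * (norm w + norm v)"
      "f (x + h *\<^sub>R v + h *\<^sub>R w) - f (x + h *\<^sub>R v) - f (x + h *\<^sub>R w) + f x = h * h * ?D v w y"
      "f (x + h *\<^sub>R w + h *\<^sub>R v) - f (x + h *\<^sub>R w) - f (x + h *\<^sub>R v) + f x = h * h * ?D w v y'"
      using sd[of x v w] sd[of x w v] by blast
    have "x + h *\<^sub>R w + h *\<^sub>R v = x + h *\<^sub>R v + h *\<^sub>R w" by (simp add: algebra_simps)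
    from y(3) y(4)[unfolded this] have "h * h * ?D v w y = h * h * ?D w v y'" by linarith
    with h y(1,2) show ?thesis unfolding h_def[symmetric]
        by (intro exI[of _ y] exI[of _ y']) (simp add: add.commute)
  qed
  then obtain y y' where y: "\<And>n. norm (y n - x) \<le> ?e n" "\<And>n. norm (y' n - x) \<le> ?e n"
    "\<And>n. ?D v w (y n) = ?D w v (y' n)" by metis
  have e: "?e \<longlonglongrightarrow> 0" by (intro tendsto_mult_left_zero LIMSEQ_inverse_real_of_nat)
  have lim: "z \<longlonglongrightarrow> x" if "\<And>n. norm (z n - x) \<le> ?e n" for z
    by (rule LIM_zero_cancel, rule Lim_null_comparison[OF _ e], intro always_eventually allI that)
  have cont: "continuous_on UNIV (?D v w)" for v w
    by (rule smooth_continuous) (rule smooth_frechet_derivative[OF sm])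
  have "(\<lambda>n. ?D v w (y n)) \<longlonglongrightarrow> ?D v w x" "(\<lambda>n. ?D w v (y' n)) \<longlonglongrightarrow> ?D w v x"
    by (rule continuous_on_tendsto_compose[OF cont lim]; simp add: y(1,2) del: of_nat_Suc)+
  then show ?thesis unfolding y(3) by (rule LIMSEQ_unique)
qed

lemma frechet_derivative_bounded_linear_compose:
  assumes "bounded_linear L" "f differentiable (at x)"
  shows "frechet_derivative (\<lambda>x. L (f x)) (at x) v = L (frechet_derivative f (at x) v)"
  using frechet_derivative_at[OF bounded_linear.has_derivative[OF assms(1),
      of f "frechet_derivative f (at x)"]]
    assms(2) frechet_derivative_works by (metis (no_types, lifting))

text \<open>The mean value theorem behind the real case fails for complex values; \<open>Re\<close>
  and \<open>Im\<close> are linear, commute with derivatives and reduce the claim to that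
  case.\<close>

lemma smooth_mixed_commute:
  fixes f :: "'a::euclidean_space \<Rightarrow> complex"
  assumes f: "\<forall>m. Ck m f"
  shows "frechet_derivative (\<lambda>x. frechet_derivative f (at x) v) (at x) w
       = frechet_derivative (\<lambda>x. frechet_derivative f (at x) w) (at x) v"
proof -
  have *: "L (frechet_derivative (\<lambda>x. frechet_derivative f (at x) v) (at x) w)
       = L (frechet_derivative (\<lambda>x. frechet_derivative f (at x) w) (at x) v)"
    if L: "bounded_linear L" for L :: "complex \<Rightarrow> real"
  proof -
    have "\<forall>m. Ck m (\<lambda>x. L (f x))" using Ck_bounded_linear_compose[OF L] f by blast
    from smooth_real_mixed_commute[OF this, of v x w] show ?thesis
      using f by (simp add: frechet_derivative_bounded_linear_compose[OF L] smooth_differentiable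
          smooth_frechet_derivative)
  qed
  show ?thesis
    by (rule complex_eqI) (intro * bounded_linear_Re bounded_linear_Im)+
qed

text \<open>Common form of \<open>dbar k\<close> in several variables and of \<open>cbar\<close> in
  one; \<open>a\<close> and \<open>b\<close> are the directions of the real and the imaginary axis
  of the variable concerned.\<close>

definition wirtinger :: "'a \<Rightarrow> 'a \<Rightarrow> ('a::euclidean_space \<Rightarrow> complex) \<Rightarrow> 'a \<Rightarrow> complex" where
  "wirtinger a b \<phi> z = (frechet_derivative \<phi> (at z) a + \<i> * frechet_derivative \<phi> (at z) b) / 2"

lemma dbar_wirtinger: "dbar k = wirtinger (axis k 1) (axis k \<i>)"
  by (simp add: fun_eq_iff dbar_def wirtinger_def)

lemma smooth_wirtinger: "\<forall>m. Ck m \<phi> \<Longrightarrow> \<forall>m. Ck m (wirtinger a b \<phi>)"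
  unfolding wirtinger_def[abs_def]
  by (intro allI Ck_bounded_linear_compose[OF bounded_linear_divide] Ck_add Ck_mult Ck_const)
    (auto simp: smooth_frechet_derivative)

lemma wirtinger_mult:
  assumes "\<forall>m. Ck m K" "\<forall>m. Ck m g"
  shows "wirtinger a b (\<lambda>w. K w * g w) w = K w * wirtinger a b g w + wirtinger a b K w * g w"
proof -
  have "frechet_derivative (\<lambda>w. K w * g w) (at w) v =
      K w * frechet_derivative g (at w) v + frechet_derivative K (at w) v * g w" for v
    using fun_cong[OF frechet_derivative_at[OF has_derivative_mult[OF smooth_has_derivative[OF
        assms(1)]
      smooth_has_derivative[OF assms(2)]]]] by metis
  then show ?thesis by (simp add: wirtinger_def field_simps)
qed

lemma dbar_commute:
  assumes f: "\<forall>m. Ck m f"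
  shows "dbar j (dbar k f) = dbar k (dbar j f)"
proof
  fix z
  have *: "dbar j (dbar k f) z =
     (frechet_derivative (\<lambda>x. frechet_derivative f (at x) (axis k 1)) (at z) (axis j 1)
      + \<i> * frechet_derivative (\<lambda>x. frechet_derivative f (at x) (axis k \<i>)) (at z) (axis j 1)
      + \<i> * (frechet_derivative (\<lambda>x. frechet_derivative f (at x) (axis k 1)) (at z) (axis j \<i>)
      + \<i> * frechet_derivative (\<lambda>x. frechet_derivative f (at x) (axis k \<i>)) (at z) (axis j \<i>))) /
          4" for j k
  proof -
    let ?D = "\<lambda>v w. frechet_derivative (\<lambda>x. frechet_derivative f (at x) v) (at z) w"
    have d: "((\<lambda>x. frechet_derivative f (at x) v) has_derivative ?D v) (at z)" for v
      using f by (intro smooth_has_derivative smooth_frechet_derivative)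
    have "(dbar k f has_derivative (\<lambda>w. (?D (axis k 1) w + \<i> * ?D (axis k \<i>) w) / 2)) (at z)"
      unfolding dbar_def[abs_def]
      by (intro bounded_linear.has_derivative[OF bounded_linear_divide] has_derivative_add d
          has_derivative_mult_right)
    from frechet_derivative_at[OF this, symmetric] show ?thesis
      unfolding dbar_def[of j] by (simp add: field_simps)
  qed
  show "dbar j (dbar k f) z = dbar k (dbar j f) z"
    unfolding * using smooth_mixed_commute[OF f] by (simp add: algebra_simps)
qed

lemma frechet_derivative_eq_0:
  assumes "open S" "x \<in> S" "\<And>y. y \<in> S \<Longrightarrow> f y = 0"
  shows "frechet_derivative f (at x) v = 0"
proof -
  have "(f has_derivative (\<lambda>_. 0)) (at x)"
    by (rule has_derivative_transform_within_open[of "\<lambda>_. 0" _ x UNIV S]) (use assms in auto)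
  from frechet_derivative_at[OF this, symmetric] show ?thesis by simp
qed

section \<open>Test functions\<close>

lemma test_functionI:
  assumes "\<forall>m. Ck m \<phi>" "compact K" "K \<subseteq> U" "\<And>x. \<phi> x \<noteq> 0 \<Longrightarrow> x \<in> K"
  shows "test_function U \<phi>"
proof -
  have *: "closure {x. \<phi> x \<noteq> 0} \<subseteq> K"
    by (rule closure_minimal) (use assms compact_imp_closed in auto)
  have "compact (K \<inter> closure {x. \<phi> x \<noteq> 0})"
    by (rule compact_Int_closed) (use assms in auto)
  moreover have "K \<inter> closure {x. \<phi> x \<noteq> 0} = closure {x. \<phi> x \<noteq> 0}" using * by blast
  ultimately show ?thesis using assms(1,3) * unfolding test_function_def by auto
qed

lemma test_function_wirtinger:
  assumes "test_function U \<phi>" shows "test_function U (wirtinger a b \<phi>)"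
proof (rule test_functionI)
  let ?K = "closure {x. \<phi> x \<noteq> 0}"
  show "\<forall>m. Ck m (wirtinger a b \<phi>)" using assms smooth_wirtinger
      unfolding test_function_def by blast
  show "compact ?K" "?K \<subseteq> U" using assms unfolding test_function_def by auto
  have z: "frechet_derivative \<phi> (at x) v = 0" if "x \<notin> ?K" for x v
    using that closure_subset[of "{x. \<phi> x \<noteq> 0}"] by (intro frechet_derivative_eq_0[of "- ?K"]) auto
  show "x \<in> ?K" if "wirtinger a b \<phi> x \<noteq> 0" for x
  proof (rule ccontr)
    assume "x \<notin> ?K"
    with z[of x] that show False by (simp add: wirtinger_def)
  qed
qed

lemmas test_function_dbar = test_function_wirtinger[of _ _ "axis k 1" "axis k \<i>"
    for k, folded dbar_wirtinger]

section \<open>Convolution of test functions with integrable kernels\<close>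

lemma test_functionD:
  assumes "test_function U \<phi>"
  shows "\<forall>m. Ck m \<phi>" "continuous_on A \<phi>" "\<phi> differentiable (at x)" "\<phi> \<in> borel_measurable borel"
  using assms smooth_continuous[of \<phi>] smooth_differentiable[of \<phi>]
  by (auto simp: test_function_def intro!: borel_measurable_continuous_onI)

lemma test_function_bounded:
  assumes "test_function U \<phi>"
  obtains B where "\<And>x. norm (\<phi> x) \<le> B" "B \<ge> 0"
proof -
  have "compact (\<phi> ` closure {x. \<phi> x \<noteq> 0})"
    using assms by (intro compact_continuous_image test_functionD(2)[OF assms]) (auto
        simp: test_function_def)
  then have "bounded (\<phi> ` closure {x. \<phi> x \<noteq> 0})" by (rule compact_imp_bounded)
  then obtain B where B: "\<And>y. y \<in> \<phi> ` closure {x. \<phi> x \<noteq> 0} \<Longrightarrow> norm y \<le> B"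
    unfolding bounded_iff by auto
  have "norm (\<phi> x) \<le> max B 0" for x
    using B[of "\<phi> x"] closure_subset[of "{x. \<phi> x \<noteq> 0}"] by (cases "\<phi> x
        = 0") (auto simp: le_max_iff_disj)
  with that[of "max B 0"] show thesis by simp
qed

lemma test_function_frechet_derivative:
  assumes "test_function U \<phi>" shows "test_function U (\<lambda>x. frechet_derivative \<phi> (at x) v)"
proof (rule test_functionI)
  let ?K = "closure {x. \<phi> x \<noteq> 0}"
  show "\<forall>m. Ck m (\<lambda>x. frechet_derivative \<phi> (at x) v)"
    using assms by (intro smooth_frechet_derivative test_functionD(1))
  show "compact ?K" "?K \<subseteq> U" using assms unfolding test_function_def by auto
  show "x \<in> ?K" if x: "frechet_derivative \<phi> (at x) v \<noteq> 0" for x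
  proof (rule ccontr)
    assume "x \<notin> ?K"
    then have "frechet_derivative \<phi> (at x) v = 0"
      using closure_subset[of "{x. \<phi> x \<noteq> 0}"]
      by (intro frechet_derivative_eq_0[of "- ?K"]) auto
    with x show False by simp
  qed
qed

lemma test_function_derivative_bounded:
  assumes "test_function U \<phi>"
  obtains B where "\<And>x v. norm (frechet_derivative \<phi> (at x) v) \<le> B * norm v" "B \<ge> 0"
proof -
  have "\<forall>b. \<exists>B. (\<forall>x. norm (frechet_derivative \<phi> (at x) b) \<le> B) \<and> B \<ge> 0"
    using test_function_bounded[OF test_function_frechet_derivative[OF assms]] by metis
  then obtain B where B: "\<And>b x. norm (frechet_derivative \<phi> (at x) b) \<le> B b" "\<And>b. B b \<ge> 0" by metis
  have "norm (frechet_derivative \<phi> (at x) v) \<le> (\<Sum>b\<in>Basis. B b) * norm v" for x v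
  proof -
    have lin: "linear (frechet_derivative \<phi> (at x))"
      by (rule linear_frechet_derivative) (rule test_functionD(3)[OF assms])
    have "frechet_derivative \<phi> (at x) v = frechet_derivative \<phi> (at x) (\<Sum>b\<in>Basis. (v \<bullet> b) *\<^sub>R b)"
      by (simp add: euclidean_representation)
    also have "\<dots> = (\<Sum>b\<in>Basis. (v \<bullet> b) *\<^sub>R frechet_derivative \<phi> (at x) b)"
      using lin by (simp add: linear_sum linear_scale)
    also have "norm \<dots> \<le> (\<Sum>b\<in>Basis. norm v * B b)"
      by (rule sum_norm_le) (auto intro!: mult_mono B Basis_le_norm)
    finally show ?thesis by (simp add: sum_distrib_left mult.commute)
  qed
  with that[of "\<Sum>b\<in>Basis. B b"] show thesis by (simp add: sum_nonneg B)
qed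

text \<open>The kernel lives on its own measure space and \<open>L\<close> maps that space into the
  argument space. So the adjoint operator can integrate over the variables in \<open>I\<close> alone
  while \<open>\<phi>\<close> depends on all of them.\<close>

definition conv :: "'b measure \<Rightarrow> ('b \<Rightarrow> complex) \<Rightarrow> ('b \<Rightarrow> 'a) \<Rightarrow> ('a::euclidean_space \<Rightarrow> complex) \<Rightarrow> 'a
    \<Rightarrow> complex" where
  "conv M \<kappa> L \<phi> x = (LINT w|M. \<kappa> w * \<phi> (x - L w))"

lemma conv_integrable:
  assumes k: "integrable M \<kappa>" and L: "L \<in> borel_measurable M" and t: "test_function U \<phi>"
  shows "integrable M (\<lambda>w. \<kappa> w * \<phi> (x - L w))"
proof -
  obtain B where B: "\<And>x. norm (\<phi> x) \<le> B" "B \<ge> 0" using test_function_bounded[OF t] by blast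
  have [measurable]: "\<phi> \<in> borel_measurable borel" "L \<in> borel_measurable M" "\<kappa> \<in> borel_measurable M"
    using t k L by (auto intro: test_functionD)
  show ?thesis
    by (rule Bochner_Integration.integrable_bound[of _ "\<lambda>w. norm (\<kappa> w) * B"])
      (use k B in \<open>auto simp: norm_mult intro!: mult_left_mono AE_I2\<close>)
qed

text \<open>All differentiation falls on \<open>\<phi>\<close>, so integrability of
  \<open>\<kappa>\<close> suffices. Dominated convergence is applied to the normalised first-order
  remainder of \<open>\<phi>\<close>, which is bounded by twice a Lipschitz constant of
  \<open>\<phi>\<close>.\<close>

lemma conv_has_derivative:
  assumes k: "integrable M \<kappa>" and L: "L \<in> borel_measurable M" and t: "test_function U \<phi>"
  shows "(conv M \<kappa> L \<phi> has_derivative (\<lambda>v. conv M \<kappa> L (\<lambda>x. frechet_derivative \<phi> (at x) v) x)) (at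
      x)"
proof -
  let ?D = "\<lambda>x v. frechet_derivative \<phi> (at x) v"
  obtain B where B: "\<And>x v. norm (?D x v) \<le> B * norm v" "B \<ge> 0"
    using test_function_derivative_bounded[OF t] by blast
  have lin: "linear (?D x)" for x
    by (rule linear_frechet_derivative) (rule test_functionD(3)[OF t])
  have hd: "(\<phi> has_derivative ?D x) (at x)" for x
    using smooth_has_derivative test_functionD(1)[OF t] by blast
  have lip: "norm (\<phi> y - \<phi> x) \<le> B * norm (y - x)" for x y
    by (rule differentiable_bound[of UNIV \<phi> ?D])
      (auto intro!: onorm_bound B simp: hd)
  note int = conv_integrable[OF k L t] conv_integrable[OF k L test_function_frechet_derivative[OF
      t]]
  have [measurable]: "\<phi> \<in> borel_measurable borel" "L \<in> borel_measurable M" "\<kappa> \<in> borel_measurable M"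
    "\<And>v. (\<lambda>x. ?D x v) \<in> borel_measurable borel"
    using t k L test_functionD(4)[OF test_function_frechet_derivative[OF t]]
        by (auto intro: test_functionD)
  have bl: "bounded_linear (\<lambda>v. conv M \<kappa> L (\<lambda>x. ?D x v) x)"
  proof (rule bounded_linear_intro[where K = "B * (LINT w|M. norm (\<kappa> w))"])
    fix v w show "conv M \<kappa> L (\<lambda>x. ?D x (v + w)) x = conv M \<kappa> L (\<lambda>x. ?D x v) x
        + conv M \<kappa> L (\<lambda>x. ?D x w) x"
      unfolding conv_def using int by (simp add: linear_add[OF lin] algebra_simps)
  next
    fix r v show "conv M \<kappa> L (\<lambda>x. ?D x (r *\<^sub>R v)) x = r *\<^sub>R conv M \<kappa> L (\<lambda>x. ?D x v) x"
      unfolding conv_def using int by (simp add: linear_scale[OF lin])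
  next
    fix v
    have "norm (conv M \<kappa> L (\<lambda>x. ?D x v) x) \<le> (LINT w|M. norm (\<kappa> w) * (B * norm v))"
      unfolding conv_def
      by (rule order_trans[OF integral_norm_bound integral_mono])
        (use int[THEN integrable_norm] k in \<open>auto simp: norm_mult intro!: mult_left_mono B\<close>)
    then show "norm (conv M \<kappa> L (\<lambda>x. ?D x v) x) \<le> norm v * (B * (LINT w|M. norm (\<kappa> w)))"
      by (simp add: mult_ac)
  qed
  let ?R = "\<lambda>y w. (\<phi> (y - L w) - \<phi> (x - L w) - ?D (x - L w) (y - x)) /\<^sub>R norm (y - x)"
  have R: "(conv M \<kappa> L \<phi> y - conv M \<kappa> L \<phi> x - conv M \<kappa> L (\<lambda>z. ?D z (y - x)) x) /\<^sub>R norm (y - x)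
      = (LINT w|M. \<kappa> w * ?R y w)" for y
  proof -
    have "conv M \<kappa> L \<phi> y - conv M \<kappa> L \<phi> x - conv M \<kappa> L (\<lambda>z. ?D z (y - x)) x
      = (LINT w|M. \<kappa> w * \<phi> (y - L w) - \<kappa> w * \<phi> (x - L w) - \<kappa> w * ?D (x - L w) (y - x))"
      unfolding conv_def using int by simp
    then show ?thesis
      by (simp only: mult_scaleR_right right_diff_distrib integral_scaleR_right)
  qed
  have ptw: "((\<lambda>y. ?R y w) \<longlongrightarrow> 0) (at x)" for w
  proof -
    have "((\<lambda>y. \<phi> (y - L w)) has_derivative (\<lambda>v. ?D (x - L w) v)) (at x)"
    proof -
      have "((\<lambda>y. y - L w) has_derivative (\<lambda>v. v)) (at x)"
        by (auto intro!: derivative_eq_intros)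
      from has_derivative_compose[OF this, of \<phi> "?D (x - L w)"] hd show ?thesis by simp
    qed
    then show ?thesis by (simp add: has_derivative_at_within)
  qed
  have "((\<lambda>y. LINT w|M. \<kappa> w * ?R y w) \<longlongrightarrow> 0) (at x)"
    unfolding tendsto_at_iff_sequentially
  proof (intro allI impI)
    fix X :: "nat \<Rightarrow> 'b" assume X: "\<forall>i. X i \<in> UNIV - {x}" "X \<longlonglongrightarrow> x"
    have bd: "norm (?R y w) \<le> 2 * B" if "y \<noteq> x" for y w
    proof -
      have "norm (\<phi> (y - L w) - \<phi> (x - L w) - ?D (x - L w) (y - x))
          \<le> B * norm (y - x) + B * norm (y - x)"
        using lip[of "y - L w" "x - L w"] B(1)[of "x - L w" "y - x"]
          norm_triangle_ineq4[of "\<phi> (y - L w) - \<phi> (x - L w)" "?D (x - L w) (y - x)"] by simp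
      moreover have "norm (?R y w) = norm (\<phi> (y - L w) - \<phi> (x - L w) - ?D (x - L w) (y
          - x)) / norm (y - x)"
        by (simp add: divide_inverse mult.commute)
      ultimately show ?thesis using that by (simp add: pos_divide_le_eq mult_ac)
    qed
    have "(\<lambda>i. LINT w|M. \<kappa> w * ?R (X i) w) \<longlonglongrightarrow> (LINT w|M. 0)"
    proof (rule integral_dominated_convergence[where w = "\<lambda>w. norm (\<kappa> w) * (2 * B)"])
      show "AE w in M. (\<lambda>i. \<kappa> w * ?R (X i) w) \<longlonglongrightarrow> 0"
      proof (rule AE_I2)
        fix w
        have "(\<lambda>i. ?R (X i) w) \<longlonglongrightarrow> 0"
          using ptw[of w] X unfolding tendsto_at_iff_sequentially by (auto simp: comp_def)
        then show "(\<lambda>i. \<kappa> w * ?R (X i) w) \<longlonglongrightarrow> 0" by (rule tendsto_mult_right_zero)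
      qed
      show "AE w in M. norm (\<kappa> w * ?R (X i) w) \<le> norm (\<kappa> w) * (2 * B)" for i
        unfolding norm_mult using X bd by (auto intro!: mult_left_mono)
      show "integrable M (\<lambda>w. norm (\<kappa> w) * (2 * B))" using k by simp
    qed measurable
    then show "((\<lambda>y. LINT w|M. \<kappa> w * ?R y w) \<circ> X) \<longlonglongrightarrow> 0" by (simp add: comp_def)
  qed
  with bl show ?thesis unfolding has_derivative_at_within R[symmetric] by simp
qed

lemma conv_smooth:
  assumes k: "integrable M \<kappa>" and L: "L \<in> borel_measurable M"
  shows "test_function U \<phi> \<Longrightarrow> Ck m (conv M \<kappa> L \<phi>)"
proof (induction m arbitrary: \<phi>)
  case 0
  from conv_has_derivative[OF k L 0] show ?case
    by (auto intro!: continuous_at_imp_continuous_on has_derivative_continuous)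
next
  case (Suc m)
  show ?case
    by (rule Ck_SucI[OF conv_has_derivative[OF k L Suc.prems]])
      (rule Suc.IH[OF test_function_frechet_derivative[OF Suc.prems]])
qed

lemma dbar_conv:
  assumes k: "integrable M \<kappa>" and L: "L \<in> borel_measurable M" and t: "test_function U \<phi>"
  shows "dbar j (conv M \<kappa> L \<phi>) = conv M \<kappa> L (dbar j \<phi>)"
proof
  fix x
  note int = conv_integrable[OF k L test_function_frechet_derivative[OF t]]
  have "frechet_derivative (conv M \<kappa> L \<phi>) (at x) v = conv M \<kappa> L (\<lambda>x. frechet_derivative \<phi> (at x)
      v) x" for v
    by (rule fun_cong[OF frechet_derivative_at[OF conv_has_derivative[OF k L t], symmetric]])
  then have "dbar j (conv M \<kappa> L \<phi>) x =
    ((LINT w|M. \<kappa> w * frechet_derivative \<phi> (at (x - L w)) (axis j 1))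
     + \<i> * (LINT w|M. \<kappa> w * frechet_derivative \<phi> (at (x - L w)) (axis j \<i>))) / 2"
    unfolding dbar_def conv_def by simp
  also have "\<dots> = (LINT w|M. (\<kappa> w * frechet_derivative \<phi> (at (x - L w)) (axis j 1)
     + \<i> * (\<kappa> w * frechet_derivative \<phi> (at (x - L w)) (axis j \<i>))) / 2)"
    using int by simp
  also have "\<dots> = conv M \<kappa> L (dbar j \<phi>) x"
    unfolding conv_def dbar_def by (simp add: algebra_simps add_divide_distrib)
  finally show "dbar j (conv M \<kappa> L \<phi>) x = conv M \<kappa> L (dbar j \<phi>) x" .
qed

lemma test_function_integrable:
  assumes "test_function U \<phi>" shows "integrable lborel \<phi>"
proof -
  let ?K = "closure {x. \<phi> x \<noteq> 0}"
  have "set_integrable lborel ?K \<phi>"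
    unfolding set_integrable_def
    using assms by (intro borel_integrable_compact test_functionD) (auto simp: test_function_def)
  moreover have "indicator ?K x *\<^sub>R \<phi> x = \<phi> x" for x
    using closure_subset[of "{x. \<phi> x \<noteq> 0}"] by (cases "\<phi> x = 0") auto
  ultimately show ?thesis by (simp add: set_integrable_def)
qed

text \<open>The convolution of a test function with a constant is constant, so its derivative vanishes.\<close>

lemma integral_derivative_eq_0:
  fixes \<phi> :: "'a::euclidean_space \<Rightarrow> complex"
  assumes t: "test_function U \<phi>"
  shows "(LINT x|lborel. frechet_derivative \<phi> (at x) v) = 0"
proof -
  have "bounded (closure {x. \<phi> x \<noteq> 0})"
    using t by (intro compact_imp_bounded) (simp add: test_function_def)
  then obtain R where R: "\<And>x. x \<in> closure {x. \<phi> x \<noteq> 0} \<Longrightarrow> norm x \<le> R" "R > 0"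
    unfolding bounded_pos by auto
  have z: "\<phi> x = 0" if "norm x > R" for x
    using that R(1)[of x] closure_subset[of "{x. \<phi> x \<noteq> 0}"] by force
  \<comment> \<open>For \<open>norm x < 1\<close> the point \<open>x - w\<close> lies in the ball of
    radius \<open>R\<close> only if \<open>w\<close> lies in the ball of radius
    \<open>R + 1\<close>. Near 0 the convolution is therefore the full integral, independent of
    \<open>x\<close>.\<close>
  let ?\<kappa> = "\<lambda>w :: 'a. complex_of_real (indicator (cball 0 (R + 1)) w)"
  have k: "integrable lborel ?\<kappa>" using emeasure_lborel_cball_finite[of "0::'a" "R + 1"]
      by (intro integrable_of_real integrable_real_indicator) auto
  have L: "(\<lambda>w. w) \<in> borel_measurable lborel" by simp
  have refl: "(LINT w|lborel. f (x - w)) = (LINT w|lborel. f w)"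
      if [measurable]: "f \<in> borel_measurable borel"
    for f :: "'a \<Rightarrow> complex" and x
  proof -
    have "(LINT w|lborel. f w) = (LINT w|distr lborel borel (\<lambda>w. x + w). f w)"
      by (simp add: lborel_distr_plus)
    also have "\<dots> = (LINT w|lborel. f (x + w))" by (rule integral_distr) auto
    also have "\<dots> = (LINT w|distr lborel borel uminus. f (x + w))"
      using lborel_affine[of "-1" "0::'a"] by (simp add: density_1)
    also have "\<dots> = (LINT w|lborel. f (x - w))" by (subst integral_distr) auto
    finally show ?thesis by simp
  qed
  have *: "conv lborel ?\<kappa> (\<lambda>w. w) \<psi> x = (LINT w|lborel. \<psi> w)"
    if "\<And>x. norm x > R \<Longrightarrow> \<psi> x = 0" "\<psi> \<in> borel_measurable borel" "norm x < 1" for x \<psi>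
  proof -
    have "?\<kappa> w * \<psi> (x - w) = \<psi> (x - w)" for w
      using that norm_triangle_ineq2[of w x] by (auto simp: indicator_def norm_minus_commute)
    then show ?thesis by (simp only: conv_def refl[OF that(2)])
  qed
  have "(conv lborel ?\<kappa> (\<lambda>w. w) \<phi> has_derivative (\<lambda>_. 0)) (at 0)"
    by (rule has_derivative_transform_within_open[of "\<lambda>_. LINT w|lborel. \<phi> w" _ 0 UNIV "ball 0 1"])
      (auto simp: * z test_functionD[OF t])
  then have "conv lborel ?\<kappa> (\<lambda>w. w) (\<lambda>x. frechet_derivative \<phi> (at x) v) 0 = 0"
    using conv_has_derivative[OF k L t, of 0] has_derivative_unique by metis
  moreover have "frechet_derivative \<phi> (at x) v = 0" if "norm x > R" for x
    by (rule frechet_derivative_eq_0[of "- cball 0 R"]) (use z that in auto)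
  ultimately show ?thesis
    using *[of "\<lambda>x. frechet_derivative \<phi> (at x) v" 0] test_functionD(4)[OF
        test_function_frechet_derivative[OF t]] by simp
qed

section \<open>The Cauchy--Pompeiu formula\<close>

lemma nn_integral_radial:
  fixes h :: "real \<Rightarrow> real"
  assumes [measurable]: "h \<in> borel_measurable borel" and h: "\<And>t. t > 0 \<Longrightarrow> h t \<ge> 0"
  shows "(\<integral>\<^sup>+(u::complex). (\<integral>\<^sup>+t. (if norm u < t then ennreal (h t) else 0) \<partial>lborel) \<partial>lborel)
    = (\<integral>\<^sup>+t. (if 0 < t then ennreal (h t * (pi * t\<^sup>2)) else 0) \<partial>lborel)"
proof -
  \<comment> \<open>Tonelli in place of polar coordinates: integrating over \<open>u\<close> first
    leaves the area pi t^2 of the disc of radius \<open>t\<close>.\<close>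
  have "(\<integral>\<^sup>+(u::complex). (\<integral>\<^sup>+t. (if norm u < t then ennreal (h t) else 0) \<partial>lborel) \<partial>lborel)
    = (\<integral>\<^sup>+t. (\<integral>\<^sup>+(u::complex). (if norm u < t then ennreal (h t) else 0) \<partial>lborel) \<partial>lborel)"
    by (rule lborel_pair.Fubini') measurable
  also have "\<dots> = (\<integral>\<^sup>+t. (if 0 < t then ennreal (h t * (pi * t\<^sup>2)) else 0) \<partial>lborel)"
  proof (rule nn_integral_cong)
    fix t :: real
    have "(\<integral>\<^sup>+(u::complex). (if norm u < t then ennreal (h t) else 0) \<partial>lborel)
      = (\<integral>\<^sup>+u. ennreal (h t) * indicator (ball (0::complex) t) u \<partial>lborel)"
      by (intro nn_integral_cong) (auto simp: indicator_def)
    also have "\<dots> = ennreal (h t) * emeasure lborel (ball (0::complex) t)"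
      by (simp add: nn_integral_cmult_indicator)
    also have "\<dots> = (if 0 < t then ennreal (h t * (pi * t\<^sup>2)) else 0)"
    proof (cases "t > 0")
      case True
      have "unit_ball_vol 2 = pi" by (simp add: eval_unit_ball_vol)
      then show ?thesis using True h by (simp add: emeasure_ball ennreal_mult)
    qed (simp add: ball_empty)
    finally show "(\<integral>\<^sup>+(u::complex). (if norm u < t then ennreal (h t) else 0) \<partial>lborel)
      = (if 0 < t then ennreal (h t * (pi * t\<^sup>2)) else 0)" .
  qed
  finally show ?thesis .
qed

text \<open>Write |u|^(-s) as \<rho>^(-s) plus the integral of s t^(-s-1) from |u| to \<rho>. The
  radial formula turns the second part into the integral of s pi t^(1-s) over [0, \<rho>], which is
  finite because s < 2.\<close>

lemma nn_integral_norm_powr_finite: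
  fixes s \<rho> :: real
  assumes s: "0 < s" "s < 2"
  shows "(\<integral>\<^sup>+(u::complex). (if norm u < \<rho> then ennreal (norm u powr - s) else 0) \<partial>lborel) < \<infinity>"
proof (cases "\<rho> > 0")
  case True
  let ?h = "\<lambda>t. if t \<le> \<rho> then s * t powr (- s - 1) else 0"
  let ?G = "\<lambda>u::complex. \<integral>\<^sup>+t. (if norm u < t then ennreal (?h t) else 0) \<partial>lborel"
  have le: "(if norm u < \<rho> then ennreal (norm u powr - s) else 0) \<le>
      ennreal (\<rho> powr - s) * indicator (ball 0 \<rho>) u + ?G u" for u :: complex
  proof (cases "norm u < \<rho> \<and> u \<noteq> 0")
    case u: True
    have pos: "0 < t" if "norm u \<le> t" for t
      using u that zero_less_norm_iff[of u] by linarith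
    have "(\<integral>\<^sup>+t. ennreal (s * t powr (- s - 1)) * indicator {norm u .. \<rho>} t \<partial>lborel)
        = ennreal (- (\<rho> powr - s) - - (norm u powr - s))"
      using s u
      by (intro nn_integral_FTC_Icc)
        (auto intro!: derivative_eq_intros simp: pos powr_diff field_simps)
    also have "(\<integral>\<^sup>+t. ennreal (s * t powr (- s - 1)) * indicator {norm u .. \<rho>} t \<partial>lborel) = ?G u"
      using AE_lborel_singleton[of "norm u"]
      by (intro nn_integral_cong_AE) (elim eventually_mono, auto simp: indicator_def)
    finally have "?G u = ennreal (norm u powr - s - \<rho> powr - s)" by simp
    moreover have "\<rho> powr - s \<le> norm u powr - s"
      using u s by (intro powr_mono2') auto
    ultimately show ?thesis using u by (simp flip: ennreal_plus)
  next
    \<comment> \<open>This includes \<open>u = 0\<close>: since \<open>0 powr - s\<close> is 0, the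
      left side vanishes there too.\<close>
    case False
    then show ?thesis by auto
  qed
  have "(\<integral>\<^sup>+(u::complex). (if norm u < \<rho> then ennreal (norm u powr - s) else 0) \<partial>lborel) \<le>
      (\<integral>\<^sup>+u. (ennreal (\<rho> powr - s) * indicator (ball 0 \<rho>) u + ?G u) \<partial>lborel)"
    by (intro nn_integral_mono le)
  also have "\<dots> = (\<integral>\<^sup>+u. ennreal (\<rho> powr - s) * indicator (ball (0::complex) \<rho>) u \<partial>lborel)
      + (\<integral>\<^sup>+u. ?G u \<partial>lborel)"
  proof (rule nn_integral_add)
    define h where "h = ?h"
    have [measurable]: "h \<in> borel_measurable borel" unfolding h_def by measurable
    have "(\<lambda>u::complex. \<integral>\<^sup>+t. (if norm u < t then ennreal (h t) else 0) \<partial>lborel)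
        \<in> borel_measurable lborel"
      by measurable
    then show "?G \<in> borel_measurable lborel" unfolding h_def .
    show "(\<lambda>u. ennreal (\<rho> powr - s) * indicator (ball (0::complex) \<rho>) u) \<in> borel_measurable lborel"
      by (intro borel_measurable_times_ennreal borel_measurable_indicator borel_measurable_const)
          simp
  qed
  also have "(\<integral>\<^sup>+u. ennreal (\<rho> powr - s) * indicator (ball (0::complex) \<rho>) u \<partial>lborel)
      = ennreal (\<rho> powr - s) * emeasure lborel (ball (0::complex) \<rho>)"
    by (rule nn_integral_cmult_indicator) simp
  also have "(\<integral>\<^sup>+u. ?G u \<partial>lborel) = (\<integral>\<^sup>+t. (if 0 < t then ennreal (?h t * (pi * t\<^sup>2)) else 0)
      \<partial>lborel)"
    using s by (intro nn_integral_radial) auto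
  also have "\<dots> = (\<integral>\<^sup>+t. ennreal (s * pi) * (ennreal (t powr (1 - s)) * indicator {0..\<rho>} t) \<partial>lborel)"
  proof (intro nn_integral_cong)
    fix t :: real
    have "t powr (- s - 1) * t\<^sup>2 = t powr (1 - s)" if "t > 0"
      using that by (simp flip: powr_numeral powr_add)
    then show "(if 0 < t then ennreal (?h t * (pi * t\<^sup>2)) else 0)
       = ennreal (s * pi) * (ennreal (t powr (1 - s)) * indicator {0..\<rho>} t)"
      using s by (auto simp: indicator_def ennreal_mult'[symmetric] mult_ac)
  qed
  also have "\<dots> = ennreal (s * pi) * ennreal (\<rho> powr (1 - s + 1) / (1 - s + 1))"
  proof -
    have "((\<lambda>x. x powr (1 - s)) has_integral \<rho> powr (1 - s + 1) / (1 - s + 1)) {0..\<rho>}"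
      using s True by (intro has_integral_powr_from_0) auto
    from nn_integral_has_integral_lebesgue'[OF _ this]
    have "(\<integral>\<^sup>+t. ennreal (t powr (1 - s)) * indicator {0..\<rho>} t \<partial>lborel)
        = ennreal (\<rho> powr (1 - s + 1) / (1 - s + 1))"
      by simp
    then show ?thesis by (subst nn_integral_cmult) simp_all
  qed
  also have "ennreal (\<rho> powr - s) * emeasure lborel (ball (0::complex) \<rho>)
      + ennreal (s * pi) * ennreal (\<rho> powr (1 - s + 1) / (1 - s + 1)) < \<infinity>"
    using emeasure_lborel_ball_finite[of "0::complex" \<rho>] by (simp add: ennreal_mult_less_top)
  finally show ?thesis .
next
  case False
  have "(if norm u < \<rho> then ennreal (norm u powr - s) else 0) = 0" for u :: complex
    using False norm_ge_zero[of u] by (auto simp del: norm_ge_zero)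
  then show ?thesis by simp
qed

text \<open>The integrand at \<open>u\<close> is the integral of 4t/(1 + t^2)^3 over t > |u|. The
  radial formula then leads to the antiderivative pi t^4/(1 + t^2)^2, which grows from 0 to pi. This
  mass is the normalising constant in \<open>cauchy_kernel\<close>.\<close>

lemma nn_integral_poisson:
  "(\<integral>\<^sup>+(u::complex). ennreal (1 / (1 + (norm u)\<^sup>2)\<^sup>2) \<partial>lborel) = ennreal pi"
proof -
  let ?h = "\<lambda>t::real. 4 * t / (1 + t\<^sup>2) ^ 3"
  have pos: "1 + t\<^sup>2 > 0" for t :: real by (simp add: add_pos_nonneg)
  have "(\<integral>\<^sup>+t. (if norm u < t then ennreal (?h t) else 0) \<partial>lborel)
      = ennreal (1 / (1 + (norm u)\<^sup>2)\<^sup>2)" for u :: complex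
  proof -
    have "((\<lambda>t::real. - 1 / (1 + t\<^sup>2)\<^sup>2) \<longlongrightarrow> 0) at_top" by real_asymp
    then have "(\<integral>\<^sup>+t. ennreal (?h t) * indicator {norm u ..} t \<partial>lborel)
        = ennreal (0 - - 1 / (1 + (norm u)\<^sup>2)\<^sup>2)"
      using pos
      by (intro nn_integral_FTC_atLeast)
        (auto intro!: derivative_eq_intros divide_nonneg_nonneg order_trans[OF norm_ge_zero[of u]]
            simp: power2_eq_square power3_eq_cube divide_simps add_pos_nonneg
                less_imp_neq[symmetric])
    also have "(\<integral>\<^sup>+t. ennreal (?h t) * indicator {norm u ..} t \<partial>lborel) =
      (\<integral>\<^sup>+t. (if norm u < t then ennreal (?h t) else 0) \<partial>lborel)"
      using AE_lborel_singleton[of "norm u"]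
      by (intro nn_integral_cong_AE) (elim eventually_mono, auto simp: indicator_def)
    finally show ?thesis by simp
  qed
  then have "(\<integral>\<^sup>+(u::complex). ennreal (1 / (1 + (norm u)\<^sup>2)\<^sup>2) \<partial>lborel)
     = (\<integral>\<^sup>+(u::complex). (\<integral>\<^sup>+t. (if norm u < t then ennreal (?h t) else 0) \<partial>lborel) \<partial>lborel)"
         by simp
  also have "\<dots> = (\<integral>\<^sup>+t. (if 0 < t then ennreal (?h t * (pi * t\<^sup>2)) else 0) \<partial>lborel)"
    by (rule nn_integral_radial) auto
  also have "\<dots> = (\<integral>\<^sup>+t. ennreal (pi * (4 * t ^ 3 / (1 + t\<^sup>2) ^ 3)) * indicator {0..} t \<partial>lborel)"
  proof (intro nn_integral_cong)
    fix t :: real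
    have "4 * t / (1 + t\<^sup>2) ^ 3 * (pi * t\<^sup>2) = pi * (4 * t ^ 3 / (1 + t\<^sup>2) ^ 3)"
      by (simp add: power2_eq_square power3_eq_cube)
    then show "(if 0 < t then ennreal (?h t * (pi * t\<^sup>2)) else 0) =
      ennreal (pi * (4 * t ^ 3 / (1 + t\<^sup>2) ^ 3)) * indicator {0..} t"
      by (cases "t = 0") (auto simp: indicator_def)
  qed
  also have "\<dots> = ennreal (pi - pi * (0 ^ 4 / (1 + 0\<^sup>2)\<^sup>2))"
  proof (rule nn_integral_FTC_atLeast)
    show "((\<lambda>t::real. pi * (t ^ 4 / (1 + t\<^sup>2)\<^sup>2)) \<longlongrightarrow> pi) at_top" by real_asymp
    fix t :: real assume "0 \<le> t"
    show "((\<lambda>t. pi * (t ^ 4 / (1 + t\<^sup>2)\<^sup>2)) has_real_derivative pi * (4 * t ^ 3 / (1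
        + t\<^sup>2) ^ 3)) (at t)"
    proof -
      have "((\<lambda>t. pi * (t ^ 4 / (1 + t\<^sup>2)\<^sup>2)) has_real_derivative
        pi * ((4 * t ^ 3 * (1 + t\<^sup>2)\<^sup>2 - t ^ 4 * (2 * (1 + t\<^sup>2) * (2 * t))) / ((1 + t\<^sup>2)\<^sup>2 * (1
            + t\<^sup>2)\<^sup>2))) (at t)"
        using pos[of t] by (auto intro!: derivative_eq_intros simp: algebra_simps)
      moreover have "(4 * t ^ 3 * (1 + t\<^sup>2)\<^sup>2 - t ^ 4 * (2 * (1 + t\<^sup>2) * (2 * t)))
          = (4 * t ^ 3) * (1 + t\<^sup>2)"
        by (simp add: algebra_simps power2_eq_square power3_eq_cube power4_eq_xxxx)
      moreover have "(1 + t\<^sup>2)\<^sup>2 * (1 + t\<^sup>2)\<^sup>2 = (1 + t\<^sup>2) ^ 3 * (1 + t\<^sup>2)"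
        by (simp add: power2_eq_square power3_eq_cube)
      ultimately show ?thesis using pos[of t] by simp
    qed
    show "0 \<le> pi * (4 * t ^ 3 / (1 + t\<^sup>2) ^ 3)" using \<open>0 \<le> t\<close> by simp
  qed auto
  finally show ?thesis by simp
qed

lemma integrable_poisson:
  "integrable lborel (\<lambda>u::complex. 1 / (1 + (norm u)\<^sup>2)\<^sup>2)"
  "(LINT (u::complex)|lborel. 1 / (1 + (norm u)\<^sup>2)\<^sup>2) = pi"
  using nn_integral_poisson nn_integral_eq_integrable[of "\<lambda>u::complex. 1 / (1
      + (norm u)\<^sup>2)\<^sup>2" lborel pi]
  by auto

lemma Ck_inverse:
  fixes f :: "'a::euclidean_space \<Rightarrow> 'b::real_normed_field"
  shows "Ck m f \<Longrightarrow> (\<And>x. f x \<noteq> 0) \<Longrightarrow> Ck m (\<lambda>x. inverse (f x))"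
proof (induction m arbitrary: f)
  case 0
  then show ?case by (auto intro!: continuous_intros)
next
  case (Suc m)
  show ?case
  proof (rule Ck_SucI)
    fix x
    have "(f has_derivative frechet_derivative f (at x)) (at x)"
      using Suc.prems(1) by (simp add: frechet_derivative_works)
    then show "((\<lambda>x. inverse (f x)) has_derivative
       (\<lambda>v. - 1 * (inverse (f x) * frechet_derivative f (at x) v * inverse (f x)))) (at x)"
      using Deriv.has_derivative_inverse[of f x _ UNIV, OF Suc.prems(2)] by fastforce
  next
    fix v
    have "Ck m f" using Suc.prems(1) by (rule Ck_Suc_imp)
    then show "Ck m (\<lambda>x. - 1 * (inverse (f x) * frechet_derivative f (at x) v * inverse (f x)))"
      using Suc by (intro Ck_mult Suc.IH Ck_const) auto
  qed
qed

lemma Ck_affine_compose: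
  assumes A: "bounded_linear A"
  shows "Ck m f \<Longrightarrow> Ck m (\<lambda>x. f (a + A x))"
proof (induction m arbitrary: f)
  case 0
  have "continuous_on UNIV (\<lambda>x. a + A x)"
    by (intro continuous_intros linear_continuous_on A)
  then show ?case using 0 by (auto intro: continuous_on_compose2)
next
  case (Suc m)
  have fd: "(f has_derivative frechet_derivative f (at x)) (at x)" for x
    using Suc.prems by (simp add: frechet_derivative_works)
  have "((\<lambda>x. a + A x) has_derivative A) (at x)" for x
    by (auto intro!: derivative_eq_intros bounded_linear_imp_has_derivative A)
  from has_derivative_compose[OF this fd]
  show ?case by (rule Ck_SucI) (use Suc in auto)
qed

lemma test_function_mult:
  assumes "\<forall>m. Ck m K" "test_function U \<phi>" shows "test_function U (\<lambda>x. K x * \<phi> x)"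
  using assms closure_subset[of "{x. \<phi> x \<noteq> 0}"]
  by (intro test_functionI[of _ "closure {x. \<phi> x \<noteq> 0}"]) (auto
      simp: test_function_def intro: Ck_mult)

section \<open>Regularised Cauchy kernels and their limit\<close>

abbreviation cbar :: "(complex \<Rightarrow> complex) \<Rightarrow> complex \<Rightarrow> complex" where
  "cbar \<equiv> wirtinger 1 \<i>"

lemma integral_cbar_eq_0:
  assumes "test_function U g" shows "(LINT w|lborel. cbar g w) = 0"
  using test_function_integrable[OF test_function_frechet_derivative[OF assms]]
  by (simp add: wirtinger_def[abs_def] integral_derivative_eq_0[OF assms])


text \<open>\<open>cauchy_reg e\<close> regularises \<open>1/w\<close>; its \<open>cbar\<close>-derivative \<open>e\<^sup>2 / (e\<^sup>2 + |w|\<^sup>2)\<^sup>2\<close> is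
  \<open>\<pi>\<close> times an approximate identity.\<close>

definition cauchy_reg :: "real \<Rightarrow> complex \<Rightarrow> complex" where
  "cauchy_reg e w = cnj w * inverse (of_real (e\<^sup>2) + w * cnj w)"

lemma cauchy_reg_denominator:
  "of_real (e\<^sup>2) + w * cnj w = complex_of_real (e\<^sup>2 + (norm w)\<^sup>2)"
  by (simp only: of_real_add complex_norm_square)

lemma cauchy_reg_denominator_nonzero: "e \<noteq> 0 \<Longrightarrow> of_real (e\<^sup>2) + w * cnj w \<noteq> (0::complex)"
  unfolding cauchy_reg_denominator of_real_eq_0_iff
  by (metis add_pos_nonneg less_irrefl zero_le_power2 zero_less_power2)

lemma smooth_cauchy_reg: "e \<noteq> 0 \<Longrightarrow> \<forall>m. Ck m (cauchy_reg e)"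
  unfolding cauchy_reg_def[abs_def]
  by (intro allI Ck_mult Ck_inverse Ck_add Ck_const Ck_bounded_linear bounded_linear_cnj
      bounded_linear_ident cauchy_reg_denominator_nonzero)

lemma cbar_cauchy_reg:
  assumes e: "e \<noteq> 0"
  shows "cbar (cauchy_reg e) w = of_real (e\<^sup>2 / (e\<^sup>2 + (norm w)\<^sup>2)\<^sup>2)"
proof -
  let ?N = "of_real (e\<^sup>2) + w * cnj w"
  have N: "?N \<noteq> 0" using e by (rule cauchy_reg_denominator_nonzero)
  have 1: "((\<lambda>w. of_real (e\<^sup>2) + w * cnj w) has_derivative (\<lambda>v. w * cnj v + v * cnj w)) (at w)"
    by (auto intro!: derivative_eq_intros bounded_linear_imp_has_derivative bounded_linear_cnj)
  define M where "M = inverse ?N"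
  have "(cauchy_reg e has_derivative (\<lambda>v. cnj w * (- (M * (w * cnj v + v * cnj w) * M))
      + cnj v * M)) (at w)"
    unfolding cauchy_reg_def[abs_def] M_def
    by (intro has_derivative_mult Deriv.has_derivative_inverse N 1
        bounded_linear_imp_has_derivative bounded_linear_cnj)
  from fun_cong[OF frechet_derivative_at[OF this]]
  have fd: "frechet_derivative (cauchy_reg e) (at w) v = cnj w * (- (M * (w * cnj v
      + v * cnj w) * M)) + cnj v * M" for v
    by (simp only:)
  have NM: "?N * M = 1" using N by (simp add: M_def)
  have "cbar (cauchy_reg e) w =
      ((cnj w * (- (M * (w + cnj w) * M)) + M)
      + \<i> * (cnj w * (- (M * (- \<i> * w + \<i> * cnj w) * M)) - \<i> * M)) / 2"
    unfolding wirtinger_def fd by (simp add: mult.commute)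
  \<comment> \<open>The factor 1 is written out so that it can be expanded to \<open>?N * M\<close>
    next; the terms containing \<open>w * cnj w\<close> then cancel.\<close>
  also have "\<dots> = 1 * M - w * cnj w * M * M"
    by (simp add: field_simps)
  also have "\<dots> = of_real (e\<^sup>2) * M * M"
    unfolding NM[symmetric] by (simp add: algebra_simps)
  also have "\<dots> = of_real (e\<^sup>2) / ?N\<^sup>2" by (simp add: M_def divide_inverse power2_eq_square
      mult.assoc)
  finally show ?thesis unfolding cauchy_reg_denominator by simp
qed

text \<open>Being uniform in \<open>e\<close>, this bound provides the dominating function for the
  limit e -> 0. At \<open>w = 0\<close> both sides are 0, the right one by the convention for
  division by zero.\<close>

lemma norm_cauchy_reg_le: "norm (cauchy_reg e w) \<le> 1 / norm w"
proof (cases "w = 0")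
  case False
  have "norm (cauchy_reg e w) = norm w / (e\<^sup>2 + (norm w)\<^sup>2)"
    unfolding cauchy_reg_def cauchy_reg_denominator
    by (simp add: norm_mult norm_inverse divide_inverse del: of_real_add)
  also have "\<dots> \<le> norm w / (norm w)\<^sup>2"
    using False by (intro divide_left_mono) (auto simp: add_nonneg_pos)
  finally show ?thesis using False by (simp add: power2_eq_square)
qed (simp add: cauchy_reg_def)

lemma integral_scale_complex:
  fixes f :: "complex \<Rightarrow> complex"
  assumes [measurable]: "f \<in> borel_measurable borel" and e: "e > 0"
  shows "(LINT w|lborel. f w) = (LINT w|lborel. of_real (e\<^sup>2) * f (of_real e * w))"
proof -
  have "(LINT w|lborel. f w) = (LINT w|density (distr lborel borel (\<lambda>x. 0
      + e *\<^sub>R x)) (\<lambda>_. ennreal (\<bar>e\<bar> ^ DIM(complex))). f w)"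
    using lborel_affine[of e "0::complex"] e by simp
  also have "\<dots> = (LINT w|distr lborel borel (\<lambda>x::complex. 0
      + e *\<^sub>R x). (\<bar>e\<bar> ^ DIM(complex)) *\<^sub>R f w)"
    by (rule integral_density) auto
  also have "\<dots> = (LINT w|lborel. (\<bar>e\<bar> ^ DIM(complex)) *\<^sub>R f (0 + e *\<^sub>R w))"
    by (rule integral_distr) auto
  finally show ?thesis using e by (simp add: scaleR_conv_of_real)
qed

text \<open>1/(pi w) is the fundamental solution of \<open>cbar\<close>; the cut-off makes it
  integrable over the whole plane. The value at 0 is 0 by division by zero.\<close>

definition cauchy_kernel :: "real \<Rightarrow> complex \<Rightarrow> complex" where
  "cauchy_kernel \<rho> w = (if norm w < \<rho> then 1 / (of_real pi * w) else 0)"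

lemma cauchy_kernel_measurable [measurable]: "cauchy_kernel \<rho> \<in> borel_measurable borel"
  unfolding cauchy_kernel_def[abs_def] by measurable

lemma integrable_cauchy_kernel: "integrable lborel (cauchy_kernel \<rho>)"
proof (rule integrableI_bounded)
  have "(\<integral>\<^sup>+w. ennreal (norm (cauchy_kernel \<rho> w)) \<partial>lborel)
      = (\<integral>\<^sup>+(w::complex). ennreal (1 / pi) * (if norm w < \<rho> then ennreal (norm w powr
          - 1) else 0) \<partial>lborel)"
    by (intro nn_integral_cong)
      (auto simp: cauchy_kernel_def norm_divide norm_mult powr_minus divide_inverse norm_inverse
          mult_ac simp flip: ennreal_mult)
  also have "\<dots> = ennreal (1 / pi) * (\<integral>\<^sup>+(w::complex). (if norm w < \<rho> then ennreal (norm w powr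
      - 1) else 0) \<partial>lborel)"
    by (rule nn_integral_cmult) measurable
  also have "\<dots> < \<infinity>"
    using nn_integral_norm_powr_finite[of 1 \<rho>] by (simp add: ennreal_mult_less_top)
  finally show "(\<integral>\<^sup>+w. ennreal (norm (cauchy_kernel \<rho> w)) \<partial>lborel) < \<infinity>" .
qed measurable

text \<open>Integrate by parts against the regularised kernel and let e -> 0. The condition on
  \<open>\<rho>\<close> concerns \<open>cbar g\<close>, the factor that multiplies the kernel: where
  it vanishes, the cut-off goes unnoticed.\<close>

theorem cauchy_pompeiu:
  assumes g: "test_function UNIV g" and supp: "\<And>w. norm w \<ge> \<rho> \<Longrightarrow> cbar g w = 0"
  shows "(LINT w|lborel. cauchy_kernel \<rho> w * cbar g w) = - g 0"
proof -
  have tc: "test_function UNIV (cbar g)" using g by (rule test_function_wirtinger)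
  obtain B where B: "\<And>w. norm (g w) \<le> B" "B \<ge> 0" using test_function_bounded[OF g] by blast
  obtain B' where B': "\<And>w. norm (cbar g w) \<le> B'" "B' \<ge> 0"
      using test_function_bounded[OF tc] by blast
  note [measurable] = test_functionD(4)[OF g] test_functionD(4)[OF tc]
  define e where "e n = inverse (real (Suc n))" for n
  have e: "e n > 0" for n by (simp add: e_def)
  have elim: "e \<longlonglongrightarrow> 0" unfolding e_def[abs_def] by (rule LIMSEQ_inverse_real_of_nat)
  have [measurable]: "cauchy_reg (e n) \<in> borel_measurable borel" for n
    using smooth_cauchy_reg[of "e n"] e[of n] by (intro borel_measurable_continuous_onI
        smooth_continuous) auto
  have eq: "(LINT w|lborel. cauchy_reg (e n) w * cbar g w)
      = - (LINT v|lborel. g (of_real (e n) * v) * of_real (1 / (1 + (norm v)\<^sup>2)\<^sup>2))" for n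
  proof -
    have en: "e n \<noteq> 0" using e[of n] by simp
    note K = smooth_cauchy_reg[OF en]
    have Kc: "\<forall>m. Ck m (cbar (cauchy_reg (e n)))"
      by (rule smooth_wirtinger[OF K])
    \<comment> \<open>Integration by parts: the derivative of a compactly supported product
      integrates to 0.\<close>
    have "(LINT w|lborel. cbar (\<lambda>w. cauchy_reg (e n) w * g w) w) = 0"
      by (intro integral_cbar_eq_0[of UNIV] test_function_mult g K)
    then have "(LINT w|lborel. cauchy_reg (e n) w * cbar g w)
        + (LINT w|lborel. cbar (cauchy_reg (e n)) w * g w) = 0"
      using test_function_integrable[OF test_function_mult[OF K tc]] test_function_integrable[OF
          test_function_mult[OF Kc g]]
      by (simp add: wirtinger_mult[OF K test_functionD(1)[OF g]])
    moreover have "(LINT w|lborel. cbar (cauchy_reg (e n)) w * g w) =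
        (LINT w|lborel. of_real (e n ^ 2 / (e n ^ 2 + (norm w)\<^sup>2)\<^sup>2) * g w)"
      by (simp add: cbar_cauchy_reg[OF en])
    \<comment> \<open>Substitution w = e v. The Jacobian e^2 turns the weight into the fixed density
      1/(1 + |v|^2)^2, and \<open>n\<close> remains only in the argument of
      \<open>g\<close>.\<close>
    moreover have "\<dots> = (LINT v|lborel. of_real ((e n)\<^sup>2) * (of_real (e n ^ 2 / (e n ^ 2
        + (norm (of_real (e n) * v))\<^sup>2)\<^sup>2) * g (of_real (e n) * v)))"
      by (rule integral_scale_complex[OF _ e]) measurable
    moreover have "of_real ((e n)\<^sup>2) * (of_real (e n ^ 2 / (e n ^ 2
        + (norm (of_real (e n) * v))\<^sup>2)\<^sup>2) * g (of_real (e n) * v))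
      = g (of_real (e n) * v) * of_real (1 / (1 + (norm v)\<^sup>2)\<^sup>2)" for v
    proof -
      have "e n ^ 2 + (norm (of_real (e n) * v))\<^sup>2 = e n ^ 2 * (1 + (norm v)\<^sup>2)"
        by (simp add: norm_mult power_mult_distrib algebra_simps)
      then have "e n ^ 2 * (e n ^ 2 / (e n ^ 2 + (norm (of_real (e n) * v))\<^sup>2)\<^sup>2)
          = 1 / (1 + (norm v)\<^sup>2)\<^sup>2"
        using en by (simp add: power2_eq_square)
      then have "complex_of_real (e n ^ 2) * of_real (e n ^ 2 / (e n ^ 2
          + (norm (of_real (e n) * v))\<^sup>2)\<^sup>2)
        = of_real (1 / (1 + (norm v)\<^sup>2)\<^sup>2)"
        by (simp only: of_real_mult[symmetric])
      then show ?thesis by (simp only: mult.assoc[symmetric] mult.commute[of "g _"])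
    qed
    ultimately show ?thesis by (simp add: eq_neg_iff_add_eq_0)
  qed
  have "(\<lambda>n. LINT w|lborel. cauchy_reg (e n) w * cbar g w)
      \<longlonglongrightarrow> (LINT w|lborel. of_real pi * cauchy_kernel \<rho> w * cbar g w)"
  proof (rule integral_dominated_convergence[where w = "\<lambda>w. norm (of_real pi * cauchy_kernel \<rho> w)
      * B'"])
    show "integrable lborel (\<lambda>w. norm (of_real pi * cauchy_kernel \<rho> w) * B')"
      by (intro integrable_mult_left integrable_norm integrable_mult_right integrable_cauchy_kernel)
    show "AE w in lborel. (\<lambda>n. cauchy_reg (e n) w * cbar g w)
        \<longlonglongrightarrow> of_real pi * cauchy_kernel \<rho> w * cbar g w"
    proof (rule AE_I2, goal_cases)
      case (1 w)
      show ?case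
      proof (cases "norm w < \<rho> \<and> w \<noteq> 0")
        case True
        have "(\<lambda>n. cauchy_reg (e n) w) \<longlonglongrightarrow> cnj w * inverse (of_real (0\<^sup>2) + w * cnj w)"
          unfolding cauchy_reg_def by (intro tendsto_intros elim) (use True in auto)
        moreover have "cnj w * inverse (of_real (0\<^sup>2) + w * cnj w) = of_real pi * cauchy_kernel \<rho> w"
          using True by (simp add: cauchy_kernel_def field_simps)
        ultimately show ?thesis by (intro tendsto_mult tendsto_const) simp
      next
        case False
        then show ?thesis using supp[of w] by (cases "w = 0") (auto
            simp: cauchy_reg_def cauchy_kernel_def)
      qed
    qed
    show "AE w in lborel. norm (cauchy_reg (e n) w * cbar g w)
        \<le> norm (of_real pi * cauchy_kernel \<rho> w) * B'" for n
    proof (rule AE_I2, goal_cases)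
      case (1 w)
      show ?case
      proof (cases "norm w < \<rho>")
        case True
        then show ?thesis unfolding norm_mult
          using norm_cauchy_reg_le[of "e n" w] by (intro mult_mono B') (auto
              simp: cauchy_kernel_def norm_divide norm_mult)
      qed (use supp[of w] B'(2) in auto)
    qed
  qed measurable
  moreover have "(\<lambda>n. - (LINT v|lborel. g (of_real (e n) * v) * of_real (1 / (1 + (norm v)\<^sup>2)\<^sup>2)))
     \<longlonglongrightarrow> - (LINT v|lborel. g 0 * of_real (1 / (1 + (norm (v::complex))\<^sup>2)\<^sup>2))"
  proof (intro tendsto_minus integral_dominated_convergence[where w
      = "\<lambda>v. B * (1 / (1 + (norm (v::complex))\<^sup>2)\<^sup>2)"])
    show "integrable lborel (\<lambda>v::complex. B * (1 / (1 + (norm v)\<^sup>2)\<^sup>2))"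
      by (intro integrable_mult_right integrable_poisson)
    show "AE v in lborel. (\<lambda>n. g (of_real (e n) * v) * of_real (1 / (1 + (norm v)\<^sup>2)\<^sup>2))
        \<longlonglongrightarrow> g 0 * of_real (1 / (1 + (norm v)\<^sup>2)\<^sup>2)"
    proof (rule AE_I2, goal_cases)
      case (1 v)
      have "(\<lambda>n. of_real (e n) * v) \<longlonglongrightarrow> of_real 0 * v" by (intro tendsto_intros elim)
      from continuous_on_tendsto_compose[OF test_functionD(2)[OF g, of UNIV] this] show ?case
        by (intro tendsto_mult tendsto_const) auto
    qed
    show "AE v in lborel. norm (g (of_real (e n) * v) * of_real (1 / (1 + (norm v)\<^sup>2)\<^sup>2))
        \<le> B * (1 / (1 + (norm v)\<^sup>2)\<^sup>2)" for n
      unfolding norm_mult norm_of_real by (intro AE_I2 mult_mono B) auto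
  qed measurable
  ultimately have "(LINT w|lborel. of_real pi * cauchy_kernel \<rho> w * cbar g w)
      = - (LINT v|lborel. g 0 * of_real (1 / (1 + (norm (v::complex))\<^sup>2)\<^sup>2))"
    unfolding eq by (rule LIMSEQ_unique)
  also have "(LINT v|lborel. g 0 * complex_of_real (1 / (1 + (norm (v::complex))\<^sup>2)\<^sup>2))
      = g 0 * complex_of_real (LINT v|lborel. 1 / (1 + (norm (v::complex))\<^sup>2)\<^sup>2)"
    by (simp only: integral_mult_right_zero integral_complex_of_real)
  also have "(LINT w|lborel. of_real pi * cauchy_kernel \<rho> w * cbar g w)
      = of_real pi * (LINT w|lborel. cauchy_kernel \<rho> w * cbar g w)"
    by (simp only: mult.assoc integral_mult_right_zero)
  finally show ?thesis unfolding integrable_poisson(2)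
    using mult_left_cancel[of "complex_of_real pi" "LINT w|lborel. cauchy_kernel \<rho> w * cbar g w"
        "- g 0"]
    by (simp add: mult.commute)
qed

section \<open>Young's inequality\<close>

lemma epow_ennreal [simp]: "x \<ge> 0 \<Longrightarrow> epow (ennreal x) a = ennreal (x powr a)"
  by (simp add: epow_def)

lemma epow_top [simp]: "epow top a = top" by (simp add: epow_def)

lemma epow_0 [simp]: "epow 0 a = 0" by (simp add: epow_def)

lemma epow_mono: "x \<le> y \<Longrightarrow> a \<ge> 0 \<Longrightarrow> epow x a \<le> epow y a"
  by (cases x; cases y) (auto simp: powr_mono2 top_unique)

lemma epow_epow: "epow (epow x a) b = epow x (a * b)"
  by (cases x) (auto simp: powr_powr)

lemma epow_1 [simp]: "epow x 1 = x"
  by (cases x) auto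

lemma epow_less_top_iff [simp]: "epow x a < top \<longleftrightarrow> x < top"
  by (cases x) auto

lemma epow_cmult: "c > 0 \<Longrightarrow> epow (ennreal c * x) a = ennreal (c powr a) * epow x a"
  by (cases x) (auto simp: powr_mult ennreal_mult_top simp flip: ennreal_mult)

lemma epow_measurable [measurable]: "(\<lambda>x. epow x a) \<in> borel_measurable borel"
  unfolding epow_def by measurable

text \<open>Stands in for Hoelder's inequality with three exponents. With X = g^r and Y = k^s one
  has g k = (XY)^(1/p) X^a Y^b, where a = 1/r - 1/p and b = 1/s - 1/p = 1 - 1/r are nonnegative with
  sum 1 - 1/p. Hence g k is at most (XY)^(1/p) (X + Y)^(1 - 1/p). The parameter \<open>l\<close> is
  left free, to be chosen after integration.\<close>

lemma young_pointwise:
  fixes g k l p r s :: real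
  assumes "1 \<le> r" "r \<le> p" "0 < s" "1 / r + 1 / s = 1 + 1 / p" "g \<ge> 0" "k \<ge> 0" "l > 0"
  shows "g * k \<le> l powr (1 - p) * (g powr r * k powr s) + l * (g powr r + k powr s)"
proof (cases "g = 0 \<or> k = 0")
  case False
  then have pos: "g > 0" "k > 0" using assms by auto
  define X Y where "X = g powr r" and "Y = k powr s"
  have XY: "X > 0" "Y > 0" using pos by (auto simp: X_def Y_def)
  define a b where "a = 1 / r - 1 / p" and "b = 1 / s - 1 / p"
  have p: "p \<ge> 1" using assms by simp
  have ab: "a \<ge> 0" "b \<ge> 0" "a + b = 1 - 1 / p"
  proof -
    have "1 / p \<le> 1 / r" "1 / r \<le> 1" using assms(1,2) by (auto intro: frac_le)
    then show "a \<ge> 0" "b \<ge> 0" "a + b = 1 - 1 / p"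
      unfolding a_def b_def using assms(4) by linarith+
  qed
  have "g * k = X powr (1 / r) * Y powr (1 / s)"
    using assms pos by (simp add: X_def Y_def powr_powr)
  also have "\<dots> = (X * Y) powr (1 / p) * (X powr a * Y powr b)"
    using XY by (simp add: a_def b_def powr_mult powr_diff)
  also have "\<dots> \<le> (X * Y) powr (1 / p) * ((X + Y) powr a * (X + Y) powr b)"
    using XY ab by (intro mult_left_mono mult_mono powr_mono2) auto
  finally have *: "g * k \<le> (X * Y) powr (1 / p) * (X + Y) powr (1 - 1 / p)"
    by (simp add: powr_add[symmetric] ab(3))
  \<comment> \<open>The terms l^(1-p) XY and l (X + Y) balance at XY = l^p (X + Y); on either side
    of this threshold the larger one alone bounds g k.\<close>
  show ?thesis
  proof (cases "X * Y \<le> l powr p * (X + Y)")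
    case True
    have "(X * Y) powr (1 / p) \<le> (l powr p * (X + Y)) powr (1 / p)"
      using True XY p by (intro powr_mono2) auto
    also have "\<dots> = l * (X + Y) powr (1 / p)"
      using XY assms(7) p by (simp add: powr_mult powr_powr)
    finally have "g * k \<le> l * (X + Y) powr (1 / p) * (X + Y) powr (1 - 1 / p)"
      using * by (meson mult_right_mono order_trans powr_ge_zero)
    also have "\<dots> = l * (X + Y)"
      using XY by (simp add: mult.assoc powr_add[symmetric])
    finally show ?thesis using XY by (simp add: X_def Y_def add_increasing)
  next
    case False
    have "(X + Y) powr (1 - 1 / p) \<le> (l powr - p * (X * Y)) powr (1 - 1 / p)"
      using False XY p assms(7) by (intro powr_mono2) (auto simp: powr_minus field_simps)
    also have "\<dots> = l powr (1 - p) * (X * Y) powr (1 - 1 / p)"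
      using XY assms(7) p by (simp add: powr_mult powr_powr algebra_simps)
    finally have "g * k \<le> (X * Y) powr (1 / p) * (l powr (1 - p) * (X * Y) powr (1 - 1 / p))"
      using * by (meson mult_left_mono order_trans powr_ge_zero)
    also have "\<dots> = l powr (1 - p) * (X * Y)"
      using XY by (simp add: mult.left_commute powr_add[symmetric])
    finally show ?thesis using XY assms(7) by (simp add: X_def Y_def add_increasing2)
  qed
qed (use assms in auto)

lemma young_pointwise_infinity:
  fixes g k r s :: real
  assumes "0 < r" "0 < s" "1 / r + 1 / s = 1" "g \<ge> 0" "k \<ge> 0"
  shows "g * k \<le> g powr r + k powr s"
proof (cases "g = 0 \<or> k = 0")
  case False
  then have pos: "g > 0" "k > 0" using assms by auto
  define X Y where "X = g powr r" and "Y = k powr s"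
  have XY: "X > 0" "Y > 0" using pos by (auto simp: X_def Y_def)
  have "g * k = X powr (1 / r) * Y powr (1 / s)"
    using assms pos by (simp add: X_def Y_def powr_powr)
  also have "\<dots> \<le> (X + Y) powr (1 / r) * (X + Y) powr (1 / s)"
    using XY assms by (intro mult_mono powr_mono2) auto
  also have "\<dots> = X + Y" using XY by (simp add: powr_add[symmetric] assms(3))
  finally show ?thesis by (simp add: X_def Y_def)
qed (use assms in auto)

text \<open>Young's inequality is proved for kernels whose \<open>s\<close>-th powers have uniformly
  bounded integrals in each variable separately. For a convolution kernel both bounds come from
  translation invariance.\<close>

locale young_kernel = sigma_finite_measure M for M :: "'a measure" +
  fixes k :: "'a \<Rightarrow> 'a \<Rightarrow> real" and s A :: real
  assumes k_measurable [measurable]: "case_prod k \<in> borel_measurable (M \<Otimes>\<^sub>M M)"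
    and k_nonneg: "k x y \<ge> 0"
    and s_pos: "s > 0" and A_nonneg: "A \<ge> 0"
    and k_left: "x \<in> space M \<Longrightarrow> (\<integral>\<^sup>+y. ennreal (k x y powr s) \<partial>M) \<le> ennreal A"
    and k_right: "y \<in> space M \<Longrightarrow> (\<integral>\<^sup>+x. ennreal (k x y powr s) \<partial>M) \<le> ennreal A"
begin

lemma k_measurable_compose [measurable (raw)]:
  "f \<in> N \<rightarrow>\<^sub>M M \<Longrightarrow> h \<in> N \<rightarrow>\<^sub>M M \<Longrightarrow> (\<lambda>x. k (f x) (h x)) \<in> borel_measurable N"
  using measurable_compose[OF measurable_Pair k_measurable, of f N h] by simp

sublocale pair: pair_sigma_finite M M ..

definition transform :: "('a \<Rightarrow> real) \<Rightarrow> 'a \<Rightarrow> ennreal" where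
  "transform g x = (\<integral>\<^sup>+y. ennreal (g y * k x y) \<partial>M)"

lemma transform_measurable [measurable]:
  assumes [measurable]: "g \<in> borel_measurable M" shows "transform g \<in> borel_measurable M"
  unfolding transform_def[abs_def] by measurable

text \<open>For fixed \<open>x\<close> the pointwise inequality integrates to l^(1-p) \<Phi>(x) + l
  (A + B), where \<Phi>(x) is the integral of g^r k^s in \<open>y\<close>. Choosing l =
  \<Phi>(x)^(1/p) bounds the \<open>p\<close>-th power of the transform by a multiple of \<Phi>(x),
  and by Tonelli \<Phi> has integral at most AB.\<close>

lemma young_bounded:
  assumes g [measurable]: "g \<in> borel_measurable M" and g_nonneg: "\<And>x. g x \<ge> 0"
    and pr: "1 \<le> r" "r \<le> p" "1 / r + 1 / s = 1 + 1 / p"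
    and B: "B \<ge> 0" "(\<integral>\<^sup>+y. ennreal (g y powr r) \<partial>M) \<le> ennreal B"
  shows "(\<integral>\<^sup>+x. epow (transform g x) p \<partial>M) \<le> ennreal ((1 + A + B) powr p * (A * B))"
proof -
  define \<Phi> where "\<Phi> x = (\<integral>\<^sup>+y. ennreal (g y powr r * k x y powr s) \<partial>M)" for x
  have [measurable]: "\<Phi> \<in> borel_measurable M" unfolding \<Phi>_def[abs_def] by measurable
  have p: "p \<ge> 1" using pr by simp
  have bound: "epow (transform g x) p \<le> ennreal ((1 + A + B) powr p) * \<Phi> x" if x: "x \<in> space M"
      for x
  proof -
    have [measurable]: "(\<lambda>y. k x y) \<in> borel_measurable M" using x by measurable
    have split: "transform g x \<le> ennreal (l powr (1 - p)) * \<Phi> x + ennreal (l * (A + B))"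
        if l: "l > 0" for l
    proof -
      have "transform g x \<le> (\<integral>\<^sup>+y. ennreal (l powr (1 - p)) * ennreal (g y powr r * k x y powr s) +
          ennreal l * (ennreal (g y powr r) + ennreal (k x y powr s)) \<partial>M)"
        unfolding transform_def
        using young_pointwise[OF pr(1,2) s_pos pr(3) g_nonneg k_nonneg l]
        by (intro nn_integral_mono) (simp add: l less_imp_le flip: ennreal_plus ennreal_mult)
      also have "\<dots> = ennreal (l powr (1 - p)) * \<Phi> x +
          ennreal l * ((\<integral>\<^sup>+y. ennreal (g y powr r) \<partial>M) + (\<integral>\<^sup>+y. ennreal (k x y powr s) \<partial>M))"
        by (simp add: nn_integral_add nn_integral_cmult \<Phi>_def)
      also have "\<dots> \<le> ennreal (l powr (1 - p)) * \<Phi> x + ennreal l * (ennreal B + ennreal A)"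
        by (intro add_mono mult_left_mono B k_left x) auto
      finally show ?thesis using l A_nonneg B(1) by (simp add: add.commute flip: ennreal_plus
          ennreal_mult)
    qed
    \<comment> \<open>The choice l = \<Phi>(x)^(1/p) requires a finite positive value, which leaves
      two degenerate cases.\<close>
    consider "\<Phi> x = top" | "\<Phi> x = 0" | c where "c > 0" "\<Phi> x = ennreal c"
      by (cases "\<Phi> x") (auto simp: less_le)
    then show ?thesis
    proof cases
      case 1
      have "(1 + A + B) powr p > 0" using A_nonneg B(1) by simp
      with 1 show ?thesis by (simp add: ennreal_mult_top)
    next
      case 2
      then have "AE y in M. ennreal (g y powr r * k x y powr s) = 0"
        unfolding \<Phi>_def by (subst (asm) nn_integral_0_iff_AE) auto
      then have "AE y in M. ennreal (g y * k x y) = 0"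
      proof (rule eventually_mono)
        fix y assume "ennreal (g y powr r * k x y powr s) = 0"
        then have "g y powr r * k x y powr s = 0" by (intro antisym) (auto simp: ennreal_eq_0_iff)
        then show "ennreal (g y * k x y) = 0" by auto
      qed
      then have "transform g x = 0" unfolding transform_def by (subst nn_integral_0_iff_AE) auto
      then show ?thesis by simp
    next
      case 3
      have "transform g x \<le> ennreal ((c powr (1 / p)) powr (1 - p)) * \<Phi> x
          + ennreal ((c powr (1 / p)) * (A + B))"
        using 3 by (intro split) auto
      also have "\<dots> = ennreal ((c powr (1 / p)) powr (1 - p) * c + c powr (1 / p) * (A + B))"
        using 3 A_nonneg B(1) by (simp flip: ennreal_mult ennreal_plus)
      also have "(c powr (1 / p)) powr (1 - p) * c = c powr (1 / p)"
      proof -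
        have "(c powr (1 / p)) powr (1 - p) * c powr 1 = c powr ((1 / p) * (1 - p) + 1)"
          by (simp only: powr_powr powr_add)
        also have "(1 / p) * (1 - p) + 1 = 1 / p" using p by (simp add: field_simps)
        finally show ?thesis using 3 by simp
      qed
      finally have "transform g x \<le> ennreal ((1 + A + B) * c powr (1 / p))"
        by (simp add: algebra_simps)
      then have "epow (transform g x) p \<le> epow (ennreal ((1 + A + B) * c powr (1 / p))) p"
        using p by (intro epow_mono) auto
      also have "\<dots> = ennreal (((1 + A + B) * c powr (1 / p)) powr p)"
        using A_nonneg B(1) by (intro epow_ennreal) auto
      also have "((1 + A + B) * c powr (1 / p)) powr p = (1 + A + B) powr p * c"
        using 3 A_nonneg B(1) p by (simp add: powr_mult powr_powr)
      also have "ennreal ((1 + A + B) powr p * c) = ennreal ((1 + A + B) powr p) * \<Phi> x"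
        using 3 by (simp add: ennreal_mult)
      finally show ?thesis .
    qed
  qed
  have "(\<integral>\<^sup>+x. epow (transform g x) p \<partial>M) \<le> (\<integral>\<^sup>+x. ennreal ((1 + A + B) powr p) * \<Phi> x \<partial>M)"
    by (intro nn_integral_mono bound)
  also have "\<dots> = ennreal ((1 + A + B) powr p) * (\<integral>\<^sup>+x. \<Phi> x \<partial>M)"
    by (rule nn_integral_cmult) simp
  also have "(\<integral>\<^sup>+x. \<Phi> x \<partial>M) = (\<integral>\<^sup>+y. (\<integral>\<^sup>+x. ennreal (g y powr r * k x y powr s) \<partial>M) \<partial>M)"
    unfolding \<Phi>_def by (rule pair.Fubini'[symmetric]) measurable
  also have "\<dots> \<le> (\<integral>\<^sup>+y. ennreal (g y powr r) * ennreal A \<partial>M)"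
  proof (rule nn_integral_mono)
    fix y assume y: "y \<in> space M"
    have [measurable]: "(\<lambda>x. k x y) \<in> borel_measurable M" using y by measurable
    have "(\<integral>\<^sup>+x. ennreal (g y powr r * k x y powr s) \<partial>M)
        = ennreal (g y powr r) * (\<integral>\<^sup>+x. ennreal (k x y powr s) \<partial>M)"
      by (simp add: ennreal_mult nn_integral_cmult)
    also have "\<dots> \<le> ennreal (g y powr r) * ennreal A"
      by (intro mult_left_mono k_right y) auto
    finally show "(\<integral>\<^sup>+x. ennreal (g y powr r * k x y powr s) \<partial>M)
        \<le> ennreal (g y powr r) * ennreal A" .
  qed
  also have "\<dots> = (\<integral>\<^sup>+y. ennreal (g y powr r) \<partial>M) * ennreal A" by (rule nn_integral_multc) simp
  also have "\<dots> \<le> ennreal B * ennreal A" by (intro mult_right_mono B) auto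
  finally show ?thesis
    using A_nonneg B(1) by (simp add: mult_left_mono mult_right_mono ennreal_mult mult.commute)
qed

lemma young_bounded_infinity:
  assumes g [measurable]: "g \<in> borel_measurable M" and g_nonneg: "\<And>x. g x \<ge> 0"
    and pr: "0 < r" "1 / r + 1 / s = 1" and x: "x \<in> space M"
    and B: "(\<integral>\<^sup>+y. ennreal (g y powr r) \<partial>M) \<le> 1"
  shows "transform g x \<le> ennreal (1 + A)"
proof -
  have [measurable]: "(\<lambda>y. k x y) \<in> borel_measurable M" using x by measurable
  have "transform g x \<le> (\<integral>\<^sup>+y. ennreal (g y powr r) + ennreal (k x y powr s) \<partial>M)"
    unfolding transform_def
    using young_pointwise_infinity[OF pr(1) s_pos pr(2) g_nonneg k_nonneg]
    by (intro nn_integral_mono) (simp flip: ennreal_plus)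
  also have "\<dots> = (\<integral>\<^sup>+y. ennreal (g y powr r) \<partial>M) + (\<integral>\<^sup>+y. ennreal (k x y powr s) \<partial>M)"
    by (rule nn_integral_add) auto
  also have "\<dots> \<le> ennreal 1 + ennreal A"
    using B by (intro add_mono k_left x) auto
  finally show ?thesis using A_nonneg by (simp add: ennreal_plus)
qed

text \<open>The preceding bounds are not homogeneous in \<open>g\<close>; dividing by the
  \<open>r\<close>-norm N^(1/r) restores homogeneity.\<close>

lemma transform_normalize:
  assumes g [measurable]: "g \<in> borel_measurable M" and g_nonneg: "\<And>x. g x \<ge> 0" and r: "r > 0"
    and N: "N > 0" "(\<integral>\<^sup>+y. ennreal (g y powr r) \<partial>M) = ennreal N"
  shows "(\<integral>\<^sup>+y. ennreal ((g y / N powr (1 / r)) powr r) \<partial>M) = 1"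
    and "x \<in> space M \<Longrightarrow> transform g x = ennreal (N powr (1 / r)) * transform (\<lambda>y. g y / N powr (1 /
        r)) x"
proof -
  have "(\<integral>\<^sup>+y. ennreal ((g y / N powr (1 / r)) powr r) \<partial>M)
      = (\<integral>\<^sup>+y. ennreal (1 / N) * ennreal (g y powr r) \<partial>M)"
    using N r g_nonneg by (intro nn_integral_cong) (simp add: powr_divide powr_powr flip:
        ennreal_mult)
  also have "\<dots> = ennreal (1 / N) * ennreal N" by (simp add: nn_integral_cmult N)
  finally show "(\<integral>\<^sup>+y. ennreal ((g y / N powr (1 / r)) powr r) \<partial>M) = 1"
    using N(1) by (simp flip: ennreal_mult)
next
  assume x: "x \<in> space M"
  have [measurable]: "(\<lambda>y. k x y) \<in> borel_measurable M" using x by measurable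
  show "transform g x = ennreal (N powr (1 / r)) * transform (\<lambda>y. g y / N powr (1 / r)) x"
    unfolding transform_def using N(1) g_nonneg k_nonneg
    by (subst nn_integral_cmult[symmetric]) (auto simp flip: ennreal_mult intro!: nn_integral_cong)
qed

lemma transform_eq_0:
  assumes g [measurable]: "g \<in> borel_measurable M"
    and 0: "(\<integral>\<^sup>+y. ennreal (g y powr r) \<partial>M) = 0" and x: "x \<in> space M"
  shows "transform g x = 0"
proof -
  have [measurable]: "(\<lambda>y. k x y) \<in> borel_measurable M" using x by measurable
  have "AE y in M. ennreal (g y powr r) = 0"
    using 0 by (subst (asm) nn_integral_0_iff_AE) auto
  then have "AE y in M. ennreal (g y * k x y) = 0"
    by (rule eventually_mono) (auto simp: ennreal_eq_0_iff)
  then show ?thesis unfolding transform_def by (subst nn_integral_0_iff_AE) auto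
qed

theorem young_infinity:
  assumes g [measurable]: "g \<in> borel_measurable M" and g_nonneg: "\<And>x. g x \<ge> 0"
    and pr: "0 < r" "1 / r + 1 / s = 1" and x: "x \<in> space M"
  shows "transform g x \<le> ennreal (1 + A) * epow (\<integral>\<^sup>+y. ennreal (g y powr r) \<partial>M) (1 / r)"
proof -
  let ?I = "\<integral>\<^sup>+y. ennreal (g y powr r) \<partial>M"
  consider "?I = top" | "?I = 0" | N where "N > 0" "?I = ennreal N"
    by (cases ?I) (auto simp: less_le)
  then show ?thesis
  proof cases
    case 1
    have "1 + A > 0" using A_nonneg by simp
    with 1 show ?thesis by (simp add: ennreal_mult_top)
  next
    case 2 then show ?thesis using transform_eq_0[OF g 2 x] by simp
  next
    case 3
    note n = transform_normalize[OF g g_nonneg pr(1) 3]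
    have "transform (\<lambda>y. g y / N powr (1 / r)) x \<le> ennreal (1 + A)"
      by (rule young_bounded_infinity[OF _ _ pr x]) (use n(1) g_nonneg in auto)
    then have "transform g x \<le> ennreal (N powr (1 / r)) * ennreal (1 + A)"
      unfolding n(2)[OF x] by (intro mult_left_mono) auto
    then show ?thesis using 3 by (simp add: mult.commute)
  qed
qed

text \<open>If r > p, the relation becomes the one for the exponent \<open>p\<close> with s = 1, and
  the finite measure of \<open>S\<close> compensates: on \<open>S\<close>, g^p is at most 1 +
  g^r.\<close>

theorem young:
  assumes pr: "1 \<le> p" "1 \<le> r" "1 / min r p + 1 / s = 1 + 1 / p"
    and S [measurable]: "S \<in> sets M" "emeasure M S < \<infinity>"
  obtains C where "C \<ge> 0" "\<And>g. g \<in> borel_measurable M \<Longrightarrow> (\<And>x. g x \<ge> 0) \<Longrightarrow> (\<And>x. x \<in> space M - S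
      \<Longrightarrow> g x = 0) \<Longrightarrow>
     (\<integral>\<^sup>+x. epow (transform g x) p \<partial>M) \<le> ennreal C * epow (\<integral>\<^sup>+y. ennreal (g y powr r) \<partial>M) (p / r)"
proof -
  \<comment> \<open>For \<open>g\<close> of \<open>r\<close>-norm 1 this bounds the integral of
    \<open>g powr min r p\<close>: the measure of \<open>S\<close> comes from the summand 1 on
    \<open>S\<close>, the other 1 from g^r.\<close>
  define B where "B = 1 + measure M S"
  define C where "C = (1 + A + B) powr p * (A * B)"
  have C: "C \<ge> 0" by (simp add: C_def B_def A_nonneg)
  have B: "B \<ge> 0" by (simp add: B_def)
  have normalized: "(\<integral>\<^sup>+x. epow (transform g x) p \<partial>M) \<le> ennreal C"
    if g [measurable]: "g \<in> borel_measurable M" and g_nonneg: "\<And>x. g x \<ge> 0"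
      and gS: "\<And>x. x \<in> space M - S \<Longrightarrow> g x = 0" and 1: "(\<integral>\<^sup>+y. ennreal (g y powr r) \<partial>M) = 1" for g
    unfolding C_def
  proof (rule young_bounded[OF g g_nonneg _ _ pr(3) B])
    show "1 \<le> min r p" "min r p \<le> p" using pr by auto
    have "(\<integral>\<^sup>+y. ennreal (g y powr min r p) \<partial>M) \<le> (\<integral>\<^sup>+y. indicator S y + ennreal (g y powr r) \<partial>M)"
    proof (rule nn_integral_mono)
      fix y assume y: "y \<in> space M"
      show "ennreal (g y powr min r p) \<le> indicator S y + ennreal (g y powr r)"
      proof (cases "y \<in> S")
        case True
        have "g y powr min r p \<le> 1 + g y powr r"
        proof (cases "g y \<le> 1")
          case le: True
          then have "g y powr min r p \<le> 1" using g_nonneg pr by (intro powr_le1) auto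
          then show ?thesis by (simp add: add_increasing2)
        next
          case False
          then have "g y powr min r p \<le> g y powr r" by (intro powr_mono) auto
          then show ?thesis by simp
        qed
        then show ?thesis using True by (simp flip: ennreal_plus ennreal_1)
      qed (use gS y in simp)
    qed
    also have "\<dots> = emeasure M S + 1" using 1 by (subst nn_integral_add) auto
    also have "\<dots> = ennreal B"
      using S by (simp add: B_def emeasure_eq_ennreal_measure add.commute less_top)
    finally show "(\<integral>\<^sup>+y. ennreal (g y powr min r p) \<partial>M) \<le> ennreal B" .
  qed
  \<comment> \<open>\<open>C + 1\<close> instead of \<open>C\<close>: if \<open>C\<close> were 0,
    then \<open>0 * top = 0\<close> would give a useless bound in the case of an infinite
    integral.\<close>
  show thesis
  proof (rule that[of "C + 1"])
    fix g :: "'a \<Rightarrow> real" assume g [measurable]: "g \<in> borel_measurable M" and g_nonneg: "\<And>x. g x \<ge> 0"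
      and gS: "\<And>x. x \<in> space M - S \<Longrightarrow> g x = 0"
    let ?I = "\<integral>\<^sup>+y. ennreal (g y powr r) \<partial>M"
    consider "?I = top" | "?I = 0" | N where "N > 0" "?I = ennreal N"
      by (cases ?I) (auto simp: less_le)
    then show "(\<integral>\<^sup>+x. epow (transform g x) p \<partial>M) \<le> ennreal (C + 1) * epow ?I (p / r)"
    proof cases
      case 1
      have "C + 1 > 0" using C by simp
      with 1 show ?thesis by (simp add: ennreal_mult_top)
    next
      case 2
      have "(\<integral>\<^sup>+x. epow (transform g x) p \<partial>M) = (\<integral>\<^sup>+x. 0 \<partial>M)"
        by (intro nn_integral_cong) (simp add: transform_eq_0[OF g 2])
      then show ?thesis by simp
    next
      case 3
      have r: "r > 0" using pr by simp
      note n = transform_normalize[OF g g_nonneg r 3]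
      let ?g = "\<lambda>y. g y / N powr (1 / r)"
      have "(\<integral>\<^sup>+x. epow (transform g x) p \<partial>M) = (\<integral>\<^sup>+x. ennreal ((N powr (1 / r)) powr p) * epow
          (transform ?g x) p \<partial>M)"
        using 3(1) by (intro nn_integral_cong) (simp add: n(2) epow_cmult)
      also have "\<dots> = ennreal (N powr (p / r)) * (\<integral>\<^sup>+x. epow (transform ?g x) p \<partial>M)"
        by (simp add: nn_integral_cmult powr_powr)
      also have "\<dots> \<le> ennreal (N powr (p / r)) * ennreal C"
        by (intro mult_left_mono normalized) (use n(1) g_nonneg gS in auto)
      also have "\<dots> \<le> ennreal (N powr (p / r)) * ennreal (C + 1)"
        by (intro mult_left_mono) (auto intro: ennreal_leI)
      also have "\<dots> = ennreal (C + 1) * epow ?I (p / r)" using 3 by (simp add: mult.commute)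
      finally show ?thesis .
    qed
  qed (use C in simp)
qed

end

section \<open>Partial products of the plane\<close>

abbreviation PL :: "'n::finite set \<Rightarrow> ('n \<Rightarrow> complex) measure" where
  "PL I \<equiv> Pi\<^sub>M I (\<lambda>_. lborel)"

interpretation PL: product_sigma_finite "\<lambda>_::'n::finite. lborel :: complex measure" ..

lemma sigma_finite_PL: "sigma_finite_measure (PL I)"
  by (rule PL.sigma_finite) simp

lemma pair_sigma_finite_lborel_PL: "pair_sigma_finite (lborel :: 'a::euclidean_space measure) (PL
    I)"
  by (intro pair_sigma_finite.intro sigma_finite_PL sigma_finite_lborel)

lemma borel_measurable_vec:
  fixes f :: "'a \<Rightarrow> complex ^ 'n::finite"
  assumes "\<And>i. (\<lambda>x. f x $ i) \<in> borel_measurable M"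
  shows "f \<in> borel_measurable M"
  using assms
  by (subst borel_measurable_euclidean_space) (auto simp: Basis_vec_def inner_axis)

lemma borel_measurable_vec_nth [measurable]:
  "(\<lambda>z :: complex ^ 'n::finite. z $ i) \<in> borel_measurable borel"
  by (intro borel_measurable_continuous_onI continuous_intros)

lemma PL_component [measurable]: "i \<in> I \<Longrightarrow> (\<lambda>x. x i) \<in> borel_measurable (PL I)"
  using measurable_component_singleton[of i I "\<lambda>_. lborel"] by simp

lemma glue_nth [simp]: "glue I z' z'' $ i = (if i \<in> I then z' i else z'' i)"
  by (simp add: glue_def)

lemma glue_measurable [measurable (raw)]:
  assumes "\<And>i. i \<in> I \<Longrightarrow> (\<lambda>x. f x i) \<in> borel_measurable M" "\<And>i. i \<notin> I
      \<Longrightarrow> (\<lambda>x. g x i) \<in> borel_measurable M"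
  shows "(\<lambda>x. glue I (f x) (g x)) \<in> borel_measurable M"
proof (rule borel_measurable_vec)
  show "(\<lambda>x. glue I (f x) (g x) $ i) \<in> borel_measurable M" for i
    using assms(1)[of i] assms(2)[of i] by (cases "i \<in> I") (simp_all only: glue_nth if_True
        if_False simp_thms)
qed

text \<open>It suffices to compare volumes of boxes. The basis of \<open>complex ^ 'n\<close>
  consists of the vectors \<open>axis i b\<close>, so the product over it groups into planar
  boxes.\<close>

lemma lborel_vec_eq:
  "(lborel :: (complex ^ 'n::finite) measure) = distr (PL UNIV) borel (\<lambda>x. \<chi> i. x i)"
proof (rule lborel_eqI)
  fix l u :: "complex ^ 'n" assume le: "\<And>b. b \<in> Basis \<Longrightarrow> l \<bullet> b \<le> u \<bullet> b"
  have [measurable]: "(\<lambda>x. \<chi> i. x i) \<in> borel_measurable (PL (UNIV :: 'n set))"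
    by (rule borel_measurable_vec) simp
  have le': "l $ i \<bullet> b \<le> u $ i \<bullet> b" if "b \<in> Basis" for i b
    using le[of "axis i b"] that by (auto simp: Basis_vec_def inner_axis)
  have "emeasure (distr (PL UNIV) borel (\<lambda>x. \<chi> i. x i)) (box l u) =
     emeasure (PL UNIV) ((\<lambda>x. \<chi> i. x i) -` box l u \<inter> space (PL UNIV))"
    by (rule emeasure_distr) auto
  also have "(\<lambda>x. \<chi> i. x i) -` box l u \<inter> space (PL UNIV) = (\<Pi>\<^sub>E i\<in>UNIV. box (l $ i) (u $ i))"
    by (auto simp: space_PiM PiE_def Pi_iff mem_box Basis_vec_def inner_axis)
  also have "emeasure (PL UNIV) \<dots> = (\<Prod>i\<in>UNIV. emeasure lborel (box (l $ i) (u $ i)))"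
    by (rule PL.emeasure_PiM) auto
  also have "\<dots> = (\<Prod>i\<in>UNIV. ennreal (\<Prod>b\<in>Basis. (u $ i - l $ i) \<bullet> b))"
    by (intro prod.cong refl emeasure_lborel_box le')
  also have "\<dots> = ennreal (\<Prod>i\<in>UNIV. \<Prod>b\<in>Basis. (u $ i - l $ i) \<bullet> b)"
    using le' by (intro prod_ennreal prod_nonneg) (auto simp: inner_diff_left)
  also have "(\<Prod>i\<in>UNIV. \<Prod>b\<in>Basis. (u $ i - l $ i) \<bullet> b) = (\<Prod>b\<in>Basis. (u - l) \<bullet> b)"
  proof -
    have "(\<Prod>b\<in>Basis. (u - l) \<bullet> b) = (\<Prod>i\<in>UNIV. \<Prod>b\<in>(\<lambda>b. axis i b) ` Basis. (u - l) \<bullet> b)"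
      unfolding Basis_vec_def
      by (subst prod.UNION_disjoint[symmetric]) (auto simp: axis_eq_axis intro!: prod.cong)
    also have "\<dots> = (\<Prod>i\<in>UNIV. \<Prod>b\<in>Basis. (u - l) \<bullet> axis i b)"
      by (intro prod.cong refl, subst prod.reindex) (auto simp: inj_on_def axis_eq_axis)
    finally show ?thesis by (simp add: inner_axis)
  qed
  finally show "emeasure (distr (PL UNIV) borel (\<lambda>x. \<chi> i. x i)) (box l u)
      = ennreal (\<Prod>b\<in>Basis. (u - l) \<bullet> b)" .
qed simp

section \<open>Splitting the coordinates, and almost every slice\<close>

lemma nn_integral_glue:
  fixes h :: "complex ^ 'n::finite \<Rightarrow> ennreal"
  assumes [measurable]: "h \<in> borel_measurable borel"
  shows "(\<integral>\<^sup>+z. h z \<partial>lborel) = (\<integral>\<^sup>+z''. (\<integral>\<^sup>+z'. h (glue I z' z'') \<partial>PL I) \<partial>PL (- I))"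
proof -
  have [measurable]: "(\<lambda>x. \<chi> i. x i) \<in> borel_measurable (PL (UNIV :: 'n set))"
    by (rule borel_measurable_vec) simp
  have "(\<integral>\<^sup>+z. h z \<partial>lborel) = (\<integral>\<^sup>+x. h (\<chi> i. x i) \<partial>PL UNIV)"
    by (subst lborel_vec_eq, subst nn_integral_distr) auto
  also have "\<dots> = (\<integral>\<^sup>+x. h (\<chi> i. x i) \<partial>PL (- I \<union> I))" by (simp add: Un_commute)
  also have "\<dots> = (\<integral>\<^sup>+z''. (\<integral>\<^sup>+z'. h (\<chi> i. merge (- I) I (z'', z') i) \<partial>PL I) \<partial>PL (- I))"
    by (rule PL.product_nn_integral_fold) auto
  also have "(\<lambda>z'' z'. \<chi> i. merge (- I) I (z'', z') i) = (\<lambda>z'' z'. glue I z' z'')"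
    by (auto simp: fun_eq_iff vec_eq_iff merge_def)
  finally show ?thesis by (simp add: fun_eq_iff)
qed

text \<open>\<open>Q\<close> need not be measurable, so its exceptional set is first enclosed in a
  Borel null set, to which Tonelli applies.\<close>

lemma AE_glue:
  fixes Q :: "complex ^ 'n::finite \<Rightarrow> bool"
  assumes "AE z in lborel. Q z"
  shows "AE z'' in PL (- I). AE z' in PL I. Q (glue I z' z'')"
proof -
  from assms obtain N where N: "N \<in> null_sets lborel" "{z. \<not> Q z} \<subseteq> N"
    by (auto simp: eventually_ae_filter)
  then have [measurable]: "N \<in> sets borel" by auto
  have "(\<integral>\<^sup>+z''. (\<integral>\<^sup>+z'. indicator N (glue I z' z'') \<partial>PL I) \<partial>PL (- I)) = 0"
    using N(1) by (subst nn_integral_glue[symmetric]) (auto simp: null_sets_def)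
  moreover have "(\<lambda>z''. \<integral>\<^sup>+z'. indicator N (glue I z' z'') \<partial>PL I) \<in> borel_measurable (PL (- I))"
    by (rule sigma_finite_measure.borel_measurable_nn_integral[OF sigma_finite_PL])
      (simp add: case_prod_beta, measurable)
  ultimately have ae: "AE z'' in PL (- I). (\<integral>\<^sup>+z'. indicator N (glue I z' z'') \<partial>PL I) = 0"
    by (subst (asm) nn_integral_0_iff_AE) auto
  have slice: "AE z' in PL I. Q (glue I z' z'')"
    if z: "z'' \<in> space (PL (- I))" and 0: "(\<integral>\<^sup>+z'. indicator N (glue I z' z'') \<partial>PL I) = 0" for z''
  proof -
    have "(\<lambda>z'. indicator N (glue I z' z'') :: ennreal) \<in> borel_measurable (PL I)"
      using z by measurable
    with 0 have "AE z' in PL I. indicator N (glue I z' z'') = (0::ennreal)"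
      by (subst (asm) nn_integral_0_iff_AE) auto
    then show ?thesis using N(2) by (auto elim!: eventually_mono
        simp: indicator_def split: if_splits)
  qed
  from ae AE_space[of "PL (- I)"] show ?thesis
    by eventually_elim (rule slice)
qed

lemma AE_restrict_nth:
  assumes "AE z'' in PL (- I). Q z''"
  shows "AE z in (lborel :: (complex ^ 'n::finite) measure). Q (restrict (($) z) (- I))"
proof -
  from assms obtain N where N: "N \<in> null_sets (PL (- I))" "{z'' \<in> space (PL (- I)). \<not> Q z''} \<subseteq> N"
    by (auto simp: eventually_ae_filter)
  then have [measurable]: "N \<in> sets (PL (- I))" by auto
  have r [measurable]: "(\<lambda>z :: complex ^ 'n. restrict (($) z) (- I)) \<in> borel \<rightarrow>\<^sub>M PL (- I)"
    by (rule measurable_restrict) simp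
  have "(\<integral>\<^sup>+z. indicator N (restrict (($) z) (- I)) \<partial>lborel) =
    (\<integral>\<^sup>+z''. (\<integral>\<^sup>+z'. indicator N (restrict (($) (glue I z' z'')) (- I)) \<partial>PL I) \<partial>PL (- I))"
    by (rule nn_integral_glue) measurable
  also have "\<dots> = (\<integral>\<^sup>+z''. (\<integral>\<^sup>+z'. indicator N z'' \<partial>PL I) \<partial>PL (- I))"
  proof (intro nn_integral_cong)
    fix z'' z' :: "'n \<Rightarrow> complex" assume "z'' \<in> space (PL (- I))"
    then have "restrict (($) (glue I z' z'')) (- I) = z''"
      by (auto simp: space_PiM fun_eq_iff restrict_def PiE_def extensional_def)
    then show "indicator N (restrict (($) (glue I z' z'')) (- I)) = indicator N z''" by simp
  qed
  \<comment> \<open>The total mass of \<open>PL I\<close> may be infinite, but \<open>N\<close> is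
    null and \<open>top * 0 = 0\<close>: the cylinder over a null set is null.\<close>
  also have "\<dots> = (\<integral>\<^sup>+z''. emeasure (PL I) (space (PL I)) * indicator N z'' \<partial>PL (- I))"
    by (simp add: mult.commute)
  also have "\<dots> = 0" using N(1) by (subst nn_integral_cmult) (auto simp: null_sets_def)
  finally have "AE z in (lborel :: (complex ^ 'n) measure). indicator N (restrict (($) z) (- I))
      = (0::ennreal)"
    by (subst (asm) nn_integral_0_iff_AE) auto
  moreover have "restrict (($) z) (- I) \<in> space (PL (- I))" for z :: "complex ^ 'n"
    by (simp add: space_PiM)
  ultimately show ?thesis using N(2)
    by (auto elim!: eventually_mono simp: indicator_def split: if_splits)
qed

lemma glue_restrict: "glue I \<zeta> (restrict (($) z) (- I)) = glue I \<zeta> (($) z)"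
  by (auto simp: vec_eq_iff)

lemma AE_AE_glue:
  fixes Q :: "complex ^ 'n::finite \<Rightarrow> bool"
  assumes "AE z in lborel. Q z"
  shows "AE z in lborel. AE \<zeta> in PL I. Q (glue I \<zeta> (($) z))"
  using AE_restrict_nth[OF AE_glue[OF assms, of I]] unfolding glue_restrict .

section \<open>Translations and the shear\<close>

lemma distr_PL_translate:
  "distr (PL I) (PL I) (\<lambda>w. restrict (\<lambda>i. a i + w i) I) = PL I"
proof (rule PL.PiM_eqI)
  have T [measurable]: "(\<lambda>w. restrict (\<lambda>i. a i + w i) I) \<in> PL I \<rightarrow>\<^sub>M PL I"
    by (rule measurable_restrict) (auto intro!: borel_measurable_add)
  fix A :: "'a \<Rightarrow> complex set" assume A: "\<And>i. i \<in> I \<Longrightarrow> A i \<in> sets lborel"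
  have "emeasure (distr (PL I) (PL I) (\<lambda>w. restrict (\<lambda>i. a i + w i) I)) (Pi\<^sub>E I A)
     = emeasure (PL I) ((\<lambda>w. restrict (\<lambda>i. a i + w i) I) -` Pi\<^sub>E I A \<inter> space (PL I))"
    using A by (intro emeasure_distr T sets_PiM_I_finite) auto
  also have "(\<lambda>w. restrict (\<lambda>i. a i + w i) I) -` Pi\<^sub>E I A \<inter> space (PL I)
      = Pi\<^sub>E I (\<lambda>i. ((+) (a i)) -` A i)"
    by (auto simp: space_PiM PiE_def Pi_iff)
  also have "emeasure (PL I) \<dots> = (\<Prod>i\<in>I. emeasure lborel (((+) (a i)) -` A i))"
  proof (rule PL.emeasure_PiM)
    show "(+) (a i) -` A i \<in> sets lborel" if "i \<in> I" for i
      using measurable_sets[of "(+) (a i)" borel borel "A i"] A[OF that] by simp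
  qed simp
  also have "\<dots> = (\<Prod>i\<in>I. emeasure lborel (A i))"
  proof (intro prod.cong refl)
    fix i assume "i \<in> I"
    then have "emeasure (distr lborel borel ((+) (a i))) (A i)
        = emeasure lborel (((+) (a i)) -` A i)"
      using A by (subst emeasure_distr) auto
    then show "emeasure lborel (((+) (a i)) -` A i) = emeasure lborel (A i)"
        by (simp add: lborel_distr_plus)
  qed
  finally show "emeasure (distr (PL I) (PL I) (\<lambda>w. restrict (\<lambda>i. a i + w i) I)) (Pi\<^sub>E I A)
      = (\<Prod>i\<in>I. emeasure lborel (A i))" .
qed auto

text \<open>Extension by 0, so that \<open>y - zext I w\<close> moves only the variables in
  \<open>I\<close>.\<close>

definition zext :: "'n set \<Rightarrow> ('n \<Rightarrow> complex) \<Rightarrow> complex ^ 'n::finite" where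
  "zext I w = glue I w (\<lambda>_. 0)"

lemma zext_nth [simp]: "zext I w $ i = (if i \<in> I then w i else 0)"
  by (simp add: zext_def)

lemma zext_measurable [measurable]: "zext I \<in> borel_measurable (PL I)"
  unfolding zext_def[abs_def] by measurable

text \<open>The change of variables \<open>z = y - w\<close>, \<open>\<zeta> = y\<^sub>I\<close> exhibits the adjoint of \<open>C\<^sup>I\<close>.\<close>

lemma distr_shear:
  "distr (lborel \<Otimes>\<^sub>M PL I) (lborel \<Otimes>\<^sub>M PL I) (\<lambda>(y :: complex ^ 'n::finite, w). (y
      - zext I w, restrict (($) y) I))
    = lborel \<Otimes>\<^sub>M PL I" (is "distr ?M ?M ?T = ?M")
proof (rule measure_eqI)
  interpret pair_sigma_finite "lborel :: (complex ^ 'n) measure" "PL I"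
      by (rule pair_sigma_finite_lborel_PL)
  have e [measurable]: "zext I \<in> PL I \<rightarrow>\<^sub>M borel" by measurable
  have r [measurable]: "(\<lambda>z :: complex ^ 'n. restrict (($) z) I) \<in> borel \<rightarrow>\<^sub>M PL I"
    by (rule measurable_restrict) simp
  have T [measurable]: "?T \<in> ?M \<rightarrow>\<^sub>M ?M" by measurable
  fix A assume "A \<in> sets (distr ?M ?M ?T)"
  then have A [measurable]: "A \<in> sets (borel \<Otimes>\<^sub>M PL I)" by (simp cong: sets_pair_measure_cong)
  let ?F = "indicator A :: (complex ^ 'n) \<times> ('n \<Rightarrow> complex) \<Rightarrow> ennreal"
  have F: "?F \<in> borel_measurable ?M"
    using A by (intro borel_measurable_indicator) (simp cong: sets_pair_measure_cong)
  have "emeasure (distr ?M ?M ?T) A = (\<integral>\<^sup>+x. ?F x \<partial>distr ?M ?M ?T)"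
    using A by (intro nn_integral_indicator[symmetric]) (simp cong: sets_pair_measure_cong)
  also have "\<dots> = (\<integral>\<^sup>+x. ?F (?T x) \<partial>?M)" by (rule nn_integral_distr[OF T]) (use F in simp)
  also have "\<dots> = (\<integral>\<^sup>+w. (\<integral>\<^sup>+y. ?F (y - zext I w, restrict (($) y) I) \<partial>lborel) \<partial>PL I)"
    by (subst nn_integral_snd[symmetric]) auto
  \<comment> \<open>The shear is made of two translations, each with the other variable held fixed:
    here \<open>y\<close> moves by \<open>zext I w\<close>; after Fubini, \<open>w\<close> moves by
    the components of \<open>y\<close> in \<open>I\<close>.\<close>
  also have "\<dots> = (\<integral>\<^sup>+w. (\<integral>\<^sup>+y. ?F (y, restrict (($) (zext I w + y)) I) \<partial>lborel) \<partial>PL I)"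
  proof (rule nn_integral_cong)
    fix w assume [measurable]: "w \<in> space (PL I)"
    have "(\<integral>\<^sup>+y. ?F (y - zext I w, restrict (($) y) I) \<partial>lborel) =
       (\<integral>\<^sup>+y. ?F (y - zext I w, restrict (($) y) I) \<partial>distr lborel borel ((+) (zext I w)))"
      by (simp add: lborel_distr_plus)
    also have "\<dots> = (\<integral>\<^sup>+y. ?F (zext I w + y - zext I w, restrict (($) (zext I w + y)) I) \<partial>lborel)"
      by (rule nn_integral_distr) measurable
    finally show "(\<integral>\<^sup>+y. ?F (y - zext I w, restrict (($) y) I) \<partial>lborel) =
      (\<integral>\<^sup>+y. ?F (y, restrict (($) (zext I w + y)) I) \<partial>lborel)" by simp
  qed
  also have "\<dots> = (\<integral>\<^sup>+y. (\<integral>\<^sup>+w. ?F (y, restrict (($) (zext I w + y)) I) \<partial>PL I) \<partial>lborel)"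
    by (rule Fubini') measurable
  also have "\<dots> = (\<integral>\<^sup>+y. (\<integral>\<^sup>+w. ?F (y, w) \<partial>PL I) \<partial>lborel)"
  proof (rule nn_integral_cong)
    fix y :: "complex ^ 'n"
    have t: "(\<lambda>w. restrict (\<lambda>i. y $ i + w i) I) \<in> PL I \<rightarrow>\<^sub>M PL I"
      by (rule measurable_restrict) (auto intro!: borel_measurable_add)
    have "restrict (($) (zext I w + y)) I = restrict (\<lambda>i. y $ i + w i) I" for w :: "'n \<Rightarrow> complex"
      by (auto simp: fun_eq_iff restrict_def add.commute)
    then have "(\<integral>\<^sup>+w. ?F (y, restrict (($) (zext I w + y)) I) \<partial>PL I)
        = (\<integral>\<^sup>+w. ?F (y, restrict (\<lambda>i. y $ i + w i) I) \<partial>PL I)" by simp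
    also have "\<dots> = (\<integral>\<^sup>+w. ?F (y, w) \<partial>distr (PL I) (PL I) (\<lambda>w. restrict (\<lambda>i. y $ i + w i) I))"
      by (rule nn_integral_distr[symmetric, OF t]) measurable
    finally show "(\<integral>\<^sup>+w. ?F (y, restrict (($) (zext I w + y)) I) \<partial>PL I) = (\<integral>\<^sup>+w. ?F (y, w) \<partial>PL I)"
      by (simp add: distr_PL_translate)
  qed
  also have "\<dots> = emeasure ?M A"
    using A by (intro sigma_finite_measure.emeasure_pair_measure[OF sigma_finite_PL, symmetric])
      (simp cong: sets_pair_measure_cong)
  finally show "emeasure (distr ?M ?M ?T) A = emeasure ?M A" .
qed simp

section \<open>The Cauchy transform and its adjoint\<close>

definition kernel_prod :: "real \<Rightarrow> 'n::finite set \<Rightarrow> ('n \<Rightarrow> complex) \<Rightarrow> complex" where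
  "kernel_prod \<rho> I w = (\<Prod>i\<in>I. cauchy_kernel \<rho> (w i))"

lemma kernel_prod_measurable: "kernel_prod \<rho> I \<in> borel_measurable (PL I)"
  unfolding kernel_prod_def[abs_def]
  by (intro borel_measurable_prod measurable_compose[OF PL_component cauchy_kernel_measurable])

lemma integrable_kernel_prod: "integrable (PL I) (kernel_prod \<rho> I)"
  unfolding kernel_prod_def[abs_def] by (intro PL.product_integrable_prod
      integrable_cauchy_kernel) simp

text \<open>The Borel form of \<open>C_op\<close>. The constants (2 pi i)^(-l) and (2 i)^l combine
  to pi^(-l), which sits in \<open>cauchy_kernel\<close>; the integral may run over the whole space
  because \<open>G\<close> is meant to vanish off the domain.\<close>

definition cauchy_transform :: "real \<Rightarrow> 'n::finite set \<Rightarrow> (complex ^ 'n \<Rightarrow> complex) \<Rightarrow> complex ^ 'n \<Rightarrow>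
    complex" where
  "cauchy_transform \<rho> I G z = (LINT \<zeta>|PL I. G (glue I \<zeta> (($) z)) * kernel_prod \<rho> I (\<lambda>i. \<zeta> i
      - z $ i))"

text \<open>With w = \<zeta> - z the kernel keeps its sign and \<open>\<phi>\<close> is evaluated at
  \<open>y - zext I w\<close>. The pairing is bilinear, so the kernel is not conjugated.\<close>

abbreviation cauchy_adjoint :: "real \<Rightarrow> 'n::finite set \<Rightarrow> (complex ^ 'n \<Rightarrow> complex) \<Rightarrow> complex ^ 'n \<Rightarrow>
    complex" where
  "cauchy_adjoint \<rho> I \<equiv> conv (PL I) (kernel_prod \<rho> I) (zext I)"

text \<open>The shear turns the double integrand into one bounded by B |G(y)| times the absolute
  value of the kernel at \<open>w\<close>. This dominating function is a product of integrable
  functions of \<open>y\<close> and of \<open>w\<close>, so Fubini applies on both sides. The case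
  of the constant function 1 for \<open>\<phi>\<close> later supplies integrability of the transform
  itself.\<close>

lemma C_duality:
  fixes G \<phi> :: "complex ^ 'n::finite \<Rightarrow> complex"
  assumes G: "integrable lborel G" "G \<in> borel_measurable borel"
    and \<phi>: "\<phi> \<in> borel_measurable borel" "\<And>z. norm (\<phi> z) \<le> B"
  shows "AE z in lborel. integrable (PL I) (\<lambda>\<zeta>. G (glue I \<zeta> (($) z)) * kernel_prod \<rho> I (\<lambda>i. \<zeta> i
      - z $ i) * \<phi> z)"
    and "integrable lborel (\<lambda>z. cauchy_transform \<rho> I G z * \<phi> z)"
    and "(LINT z|lborel. cauchy_transform \<rho> I G z * \<phi> z)
        = (LINT y|lborel. G y * cauchy_adjoint \<rho> I \<phi> y)"
proof -
  interpret pair_sigma_finite "lborel :: (complex ^ 'n) measure" "PL I"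
      by (rule pair_sigma_finite_lborel_PL)
  let ?M = "(lborel :: (complex ^ 'n) measure) \<Otimes>\<^sub>M PL I"
  let ?T = "\<lambda>(y :: complex ^ 'n, w). (y - zext I w, restrict (($) y) I)"
  let ?F = "\<lambda>(z, \<zeta>). G (glue I \<zeta> (($) z)) * kernel_prod \<rho> I (\<lambda>i. \<zeta> i - z $ i) * \<phi> z"
  let ?H = "\<lambda>(y, w). G y * (kernel_prod \<rho> I w * \<phi> (y - zext I w))"
  note [measurable] = G(2) \<phi>(1) kernel_prod_measurable zext_measurable
  have [measurable]: "(\<lambda>x. snd x i) \<in> borel_measurable ?M" if "i \<in> I" for i
    using measurable_compose[OF measurable_snd PL_component[OF that],
        of "lborel :: (complex ^ 'n) measure"] .
  have Bpos: "B \<ge> 0" using \<phi>(2) norm_ge_zero order_trans by blast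
  have r [measurable]: "(\<lambda>z :: complex ^ 'n. restrict (($) z) I) \<in> borel \<rightarrow>\<^sub>M PL I"
    by (rule measurable_restrict) simp
  have T [measurable]: "?T \<in> ?M \<rightarrow>\<^sub>M ?M" by measurable
  have F [measurable]: "?F \<in> borel_measurable ?M"
  proof -
    have "(\<lambda>x. G (glue I (snd x) (($) (fst x)))) \<in> borel_measurable ?M"
      by (rule measurable_compose[OF glue_measurable G(2)]) auto
    moreover have "(\<lambda>x. kernel_prod \<rho> I (\<lambda>i. snd x i - fst x $ i)) \<in> borel_measurable ?M"
      unfolding kernel_prod_def
      by (intro borel_measurable_prod measurable_compose[OF _ cauchy_kernel_measurable]
          borel_measurable_diff) auto
    moreover have "(\<lambda>x. \<phi> (fst x)) \<in> borel_measurable ?M"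
      by (rule measurable_compose[OF _ \<phi>(1)]) simp
    ultimately show ?thesis unfolding case_prod_beta by (intro borel_measurable_times)
  qed
  have kernel_prod_snd: "(\<lambda>x. kernel_prod \<rho> I (snd x)) \<in> borel_measurable ?M"
    by (rule measurable_compose[OF _ kernel_prod_measurable]) simp
  have H [measurable]: "?H \<in> borel_measurable ?M"
  proof -
    have "(\<lambda>x. G (fst x)) \<in> borel_measurable ?M"
      by (rule measurable_compose[OF _ G(2)]) simp
    moreover have "(\<lambda>x. fst x - zext I (snd x)) \<in> borel_measurable ?M"
      by (intro borel_measurable_diff measurable_compose[OF measurable_snd zext_measurable]) simp
    then have "(\<lambda>x. \<phi> (fst x - zext I (snd x))) \<in> borel_measurable ?M"
      by (rule measurable_compose[OF _ \<phi>(1)])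
    ultimately show ?thesis using kernel_prod_snd unfolding case_prod_beta
        by (intro borel_measurable_times)
  qed
  have FT: "?F (?T x) = ?H x" for x
  proof (cases x)
    case (Pair y w)
    have "glue I (restrict (($) y) I) (($) (y - zext I w)) = y" by (auto simp: vec_eq_iff)
    moreover have "kernel_prod \<rho> I (\<lambda>i. restrict (($) y) I i - (y - zext I w) $ i)
        = kernel_prod \<rho> I w"
      unfolding kernel_prod_def by (intro prod.cong) auto
    ultimately show ?thesis using Pair by simp
  qed
  have "integrable ?M ?H"
  proof (rule Fubini_integrable[OF H])
    have bd: "norm (LINT w|PL I. norm (?H (y, w))) \<le> norm (norm (G y) * (B * (LINT w|PL I. norm
        (kernel_prod \<rho> I w))))" for y
    proof -
      have "(LINT w|PL I. norm (?H (y, w))) \<le> (LINT w|PL I. norm (G y) * (B * norm (kernel_prod \<rho>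
          I w)))"
      proof (rule integral_mono_AE')
        show "integrable (PL I) (\<lambda>w. norm (G y) * (B * norm (kernel_prod \<rho> I w)))"
          by (intro integrable_mult_right integrable_norm integrable_kernel_prod)
        show "AE w in PL I. norm (?H (y, w)) \<le> norm (G y) * (B * norm (kernel_prod \<rho> I w))"
          using \<phi>(2) by (intro AE_I2) (auto simp: norm_mult mult.commute[of B] intro!:
              mult_left_mono)
      qed (use Bpos in auto)
      then show ?thesis using Bpos by (simp add: abs_mult)
    qed
    show "integrable lborel (\<lambda>y. LINT w|PL I. norm (?H (y, w)))"
    proof (rule Bochner_Integration.integrable_bound)
      show "integrable lborel (\<lambda>y. norm (G y) * (B * (LINT w|PL I. norm (kernel_prod \<rho> I w))))"
        by (intro integrable_mult_left integrable_norm G)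
      have "(\<lambda>x. norm (?H x)) \<in> borel_measurable ?M" by (rule measurable_compose[OF H
          borel_measurable_norm])
      then show "(\<lambda>y. LINT w|PL I. norm (?H (y, w))) \<in> borel_measurable lborel"
        by (intro sigma_finite_measure.borel_measurable_lebesgue_integral[OF sigma_finite_PL])
          (simp only: case_prod_beta' prod.collapse)
      show "AE y in lborel. norm (LINT w|PL I. norm (?H (y, w)))
          \<le> norm (norm (G y) * (B * (LINT w|PL I. norm (kernel_prod \<rho> I w))))"
        using bd by (intro AE_I2)
    qed
    show "AE y in lborel. integrable (PL I) (\<lambda>w. ?H (y, w))"
    proof (rule AE_I2)
      fix y
      have "integrable (PL I) (\<lambda>w. kernel_prod \<rho> I w * \<phi> (y - zext I w))"
      proof (rule Bochner_Integration.integrable_bound)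
        show "integrable (PL I) (\<lambda>w. B * norm (kernel_prod \<rho> I w))"
          by (intro integrable_mult_right integrable_norm integrable_kernel_prod)
        have "(\<lambda>w. y - zext I w) \<in> borel_measurable (PL I)"
          by (intro borel_measurable_diff borel_measurable_const zext_measurable)
        from measurable_compose[OF this \<phi>(1)]
        show "(\<lambda>w. kernel_prod \<rho> I w * \<phi> (y - zext I w)) \<in> borel_measurable (PL I)"
          by (intro borel_measurable_times kernel_prod_measurable)
        show "AE w in PL I. norm (kernel_prod \<rho> I w * \<phi> (y - zext I w))
            \<le> norm (B * norm (kernel_prod \<rho> I w))"
        proof (rule AE_I2)
          fix w
          have "norm (\<phi> (y - zext I w)) * norm (kernel_prod \<rho> I w) \<le> B * norm (kernel_prod \<rho> I w)"
            using \<phi>(2) by (rule mult_right_mono) simp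
          then show "norm (kernel_prod \<rho> I w * \<phi> (y - zext I w))
              \<le> norm (B * norm (kernel_prod \<rho> I w))"
            using Bpos by (simp add: norm_mult mult.commute)
        qed
      qed
      then show "integrable (PL I) (\<lambda>w. ?H (y, w))" by simp
    qed
  qed
  then have intF: "integrable ?M ?F"
    using integrable_distr_eq[OF T, of ?F] F by (simp add: distr_shear FT)
  have "(LINT x|?M. ?F x) = (LINT x|distr ?M ?M ?T. ?F x)" by (simp only: distr_shear)
  also have "\<dots> = (LINT x|?M. ?F (?T x))" by (rule integral_distr[OF T F])
  finally have eq: "(LINT x|?M. ?F x) = (LINT x|?M. ?H x)" by (simp only: FT)
  show "AE z in lborel. integrable (PL I) (\<lambda>\<zeta>. G (glue I \<zeta> (($) z)) * kernel_prod \<rho> I (\<lambda>i. \<zeta> i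
      - z $ i) * \<phi> z)"
    using AE_integrable_fst'[OF intF] by simp
  have CGF: "(LINT \<zeta>|PL I. ?F (z, \<zeta>)) = cauchy_transform \<rho> I G z * \<phi> z" for z
    unfolding cauchy_transform_def by simp
  show "integrable lborel (\<lambda>z. cauchy_transform \<rho> I G z * \<phi> z)"
    using integrable_fst'[OF intF] unfolding CGF .
  have "(LINT z|lborel. cauchy_transform \<rho> I G z * \<phi> z) = (LINT x|?M. ?F x)"
    using integral_fst'[OF intF] unfolding CGF .
  also have "\<dots> = (LINT y|lborel. LINT w|PL I. ?H (y, w))"
    unfolding eq using integral_fst'[OF \<open>integrable ?M ?H\<close>] by simp
  also have "\<dots> = (LINT y|lborel. G y * cauchy_adjoint \<rho> I \<phi> y)"
    unfolding conv_def by simp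
  finally show "(LINT z|lborel. cauchy_transform \<rho> I G z * \<phi> z)
      = (LINT y|lborel. G y * cauchy_adjoint \<rho> I \<phi> y)" .
qed

section \<open>The adjoint operator and derivatives in the variables of \<open>I\<close>\<close>

lemma cauchy_adjoint_empty:
  fixes \<phi> :: "complex ^ 'n::finite \<Rightarrow> complex"
  shows "cauchy_adjoint \<rho> {} \<phi> y = \<phi> y"
proof -
  have "zext {} w = (0 :: complex ^ 'n)" for w :: "'n \<Rightarrow> complex" by (auto simp: vec_eq_iff)
  then show ?thesis
    by (simp add: conv_def kernel_prod_def PiM_empty lebesgue_integral_count_space_finite)
qed

lemma bounded_linear_axis: "bounded_linear (\<lambda>v::complex. axis k v :: complex ^ 'n::finite)"
proof (rule bounded_linear_intro[where K = 1])
  show "norm (axis k v :: complex ^ 'n) \<le> norm v * 1" for v :: complex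
  proof -
    have "norm (axis k v :: complex ^ 'n) \<le> (\<Sum>i\<in>UNIV. norm ((axis k v :: complex ^ 'n) $ i))"
      unfolding norm_vec_def by (rule L2_set_le_sum) simp
    also have "\<dots> = norm v" by (simp add: axis_def if_distrib[of norm] cong: if_cong)
    finally show ?thesis by simp
  qed
qed (auto simp: vec_eq_iff axis_def)

text \<open>This is \<open>cauchy_pompeiu\<close> for
  \<open>v \<mapsto> \<phi> (x - axis k v)\<close>; the reflection in \<open>v\<close> flips the
  sign of the derivative. The radius \<open>2 * R\<close> is large enough: if |x_k| < R and |v|
  \<ge> 2R, then |x_k - v| > R, where \<open>\<phi>\<close> vanishes.\<close>

lemma integral_cauchy_kernel_dbar:
  fixes \<phi> :: "complex ^ 'n::finite \<Rightarrow> complex"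
  assumes \<phi>: "test_function UNIV \<phi>" and supp: "\<And>z. R < norm (z $ k) \<Longrightarrow> \<phi> z = 0"
    and x: "norm (x $ k) < R"
  shows "(LINT v|lborel. cauchy_kernel (2 * R) v * dbar k \<phi> (x - axis k v)) = \<phi> x"
proof -
  define g where "g v = \<phi> (x - axis k v)" for v
  have bl: "bounded_linear (\<lambda>v. - axis k v :: complex ^ 'n)"
    by (intro bounded_linear_minus bounded_linear_axis)
  have sm: "\<forall>m. Ck m g" unfolding g_def[abs_def]
    using Ck_affine_compose[OF bl, of _ \<phi> x] test_functionD(1)[OF \<phi>] by simp
  have gz: "g v = 0" if "2 * R \<le> norm v" for v
  proof -
    have "R < norm ((x - axis k v) $ k)"
      using x that norm_triangle_ineq2[of v "x $ k"] by (simp add: axis_def norm_minus_commute)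
    then show ?thesis unfolding g_def by (rule supp)
  qed
  have g: "test_function UNIV g"
    by (rule test_functionI[OF sm compact_cball[of 0 "2 * R"]]) (use gz in \<open>force simp: not_le\<close>)+
  have fd: "frechet_derivative g (at v) h = - frechet_derivative \<phi> (at (x - axis k v)) (axis k h)"
      for v h
  proof -
    have "(\<phi> has_derivative frechet_derivative \<phi> (at (x - axis k v))) (at (x - axis k v))"
      using smooth_has_derivative[OF test_functionD(1)[OF \<phi>]] .
    moreover have "((\<lambda>v. x - axis k v) has_derivative (\<lambda>h. - axis k h)) (at v)"
      by (auto intro!: derivative_eq_intros bounded_linear_imp_has_derivative bounded_linear_axis)
    ultimately have "(g has_derivative (\<lambda>h. frechet_derivative \<phi> (at (x
        - axis k v)) (- axis k h))) (at v)"
      unfolding g_def[abs_def] using has_derivative_compose by blast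
    from fun_cong[OF frechet_derivative_at[OF this], of h] show ?thesis
      using linear_frechet_derivative[OF test_functionD(3)[OF \<phi>]] by (simp add: linear_neg)
  qed
  have cg: "cbar g v = - dbar k \<phi> (x - axis k v)" for v
    unfolding wirtinger_def dbar_def fd by (simp add: field_simps)
  have "cbar g v = 0" if "2 * R \<le> norm v" for v
  proof -
    have "R < norm ((x - axis k v) $ k)"
      using x that norm_triangle_ineq2[of v "x $ k"] by (simp add: axis_def norm_minus_commute)
    moreover have "open {z :: complex ^ 'n. R < norm (z $ k)}"
      by (intro open_Collect_less continuous_intros)
    ultimately have "frechet_derivative \<phi> (at (x - axis k v)) h = 0" for h
      using supp by (intro frechet_derivative_eq_0[of "{z. R < norm (z $ k)}"]) auto
    then show ?thesis unfolding cg dbar_def by simp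
  qed
  from cauchy_pompeiu[OF g this] show ?thesis
    by (simp add: cg g_def axis_def[of k 0] zero_vec_def[symmetric] if_distrib cong: if_cong)
qed

text \<open>Fubini isolates the \<open>k\<close>-th variable of the kernel, in which the
  one-variable formula undoes \<open>dbar k\<close>.\<close>

lemma cauchy_adjoint_dbar_in:
  fixes \<phi> :: "complex ^ 'n::finite \<Rightarrow> complex"
  assumes \<phi>: "test_function UNIV \<phi>" and supp: "\<And>z. R < norm (z $ k) \<Longrightarrow> \<phi> z = 0"
    and y: "norm (y $ k) < R" and k: "k \<in> I"
  shows "cauchy_adjoint (2 * R) I (dbar k \<phi>) y = cauchy_adjoint (2 * R) (I - {k}) \<phi> y"
proof -
  let ?J = "I - {k}"
  have I: "I = insert k ?J" using k by auto
  have "cauchy_adjoint (2 * R) I (dbar k \<phi>) y = (LINT w|PL (insert k ?J). kernel_prod (2 * R)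
      (insert k ?J) w * dbar k \<phi> (y - zext (insert k ?J) w))"
    unfolding conv_def using I by simp
  also have "\<dots> = (LINT w|PL ?J. LINT v|lborel. kernel_prod (2 * R) (insert k ?J) (w(k := v)) *
      dbar k \<phi> (y - zext (insert k ?J) (w(k := v))))"
    by (rule PL.product_integral_insert)
      (auto intro!: conv_integrable[OF integrable_kernel_prod zext_measurable
          test_function_dbar[OF \<phi>]])
  also have "\<dots> = (LINT w|PL ?J. kernel_prod (2 * R) ?J w * \<phi> (y - zext ?J w))"
  proof (rule Bochner_Integration.integral_cong[OF refl])
    fix w :: "'n \<Rightarrow> complex"
    have 1: "kernel_prod (2 * R) (insert k ?J) (w(k := v))
        = kernel_prod (2 * R) ?J w * cauchy_kernel (2 * R) v" for v
    proof -
      have "(\<Prod>i\<in>?J. cauchy_kernel (2 * R) ((w(k := v)) i)) = (\<Prod>i\<in>?J. cauchy_kernel (2 * R) (w i))"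
        by (rule prod.cong) auto
      then show ?thesis unfolding kernel_prod_def by (subst prod.insert) (auto simp: mult.commute)
    qed
    have 2: "y - zext (insert k ?J) (w(k := v)) = y - zext ?J w - axis k v" for v
      by (auto simp: vec_eq_iff axis_def)
    have "(LINT v|lborel. kernel_prod (2 * R) (insert k ?J) (w(k := v)) * dbar k \<phi> (y
        - zext (insert k ?J) (w(k := v))))
      = kernel_prod (2 * R) ?J w * (LINT v|lborel. cauchy_kernel (2 * R) v * dbar k \<phi> (y
          - zext ?J w - axis k v))"
      unfolding 1 2 mult.assoc by (rule integral_mult_right_zero)
    \<comment> \<open>The shift by \<open>zext ?J w\<close> leaves the \<open>k\<close>-th
      coordinate alone, so the bound on \<open>y $ k\<close> persists.\<close>
    also have "(LINT v|lborel. cauchy_kernel (2 * R) v * dbar k \<phi> (y - zext ?J w - axis k v))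
        = \<phi> (y - zext ?J w)"
      by (rule integral_cauchy_kernel_dbar[OF \<phi> supp]) (use y in auto)
    finally show "(LINT v|lborel. kernel_prod (2 * R) (insert k ?J) (w(k := v)) * dbar k \<phi> (y
        - zext (insert k ?J) (w(k := v))))
      = kernel_prod (2 * R) ?J w * \<phi> (y - zext ?J w)" .
  qed
  finally show ?thesis unfolding conv_def .
qed

text \<open>For dominated convergence it is enough that the cut-offs are bounded by 1 and tend to 1
  pointwise. They are built from bumps on countably many balls covering \<open>V\<close>, each with
  its closed ball inside \<open>V\<close>, as 1 minus a product of powers of complements.\<close>

lemma ex_cutoff:
  assumes V: "open V" "V \<noteq> {}"
  shows "\<exists>\<theta> :: nat \<Rightarrow> complex \<Rightarrow> complex. (\<forall>m. test_function V (\<theta> m)) \<and> (\<forall>m z. norm (\<theta> m z) \<le> 1) \<and>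
    (\<forall>z\<in>V. (\<lambda>m. \<theta> m z) \<longlonglongrightarrow> 1)"
proof -
  let ?F = "(\<lambda>(a, r). ball a r) ` {(a, r). r > 0 \<and> cball a r \<subseteq> V}"
  have opn: "open X" if "X \<in> ?F" for X using that by auto
  obtain F' where F': "F' \<subseteq> ?F" "countable F'" "\<Union> F' = \<Union> ?F"
    by (rule Lindelof[of ?F, OF opn]) (assumption, rule that)
  have UF: "\<Union> ?F = V"
  proof
    show "V \<subseteq> \<Union> ?F"
    proof
      fix z assume "z \<in> V"
      then obtain r where "r > 0" "cball z r \<subseteq> V" using V open_contains_cball by blast
      then show "z \<in> \<Union> ?F" by (intro UnionI[of "ball z r"]) auto
    qed
  qed (use ball_subset_cball in blast)
  then have "F' \<noteq> {}" using F'(3) V by auto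
  define B where "B = from_nat_into F'"
  have B: "range B = F'" unfolding B_def by (rule range_from_nat_into) (use F' \<open>F' \<noteq> {}\<close> in auto)
  have "\<forall>j. \<exists>a r. r > 0 \<and> cball a r \<subseteq> V \<and> B j = ball a r"
  proof
    fix j
    have "B j \<in> ?F" using F'(1) rangeI[of B j] unfolding B by (rule subsetD)
    then show "\<exists>a r. r > 0 \<and> cball a r \<subseteq> V \<and> B j = ball a r" by (elim imageE) auto
  qed
  then obtain a r where ar: "\<And>j. r j > 0" "\<And>j. cball (a j) (r j) \<subseteq> V" "\<And>j. B j
      = ball (a j) (r j)" by metis
  \<comment> \<open>The argument of \<open>flat 0\<close> is r^2 - |z - a|^2, a polynomial in the
    real coordinates that is positive exactly on the ball. Values of \<open>flat 0\<close> are below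
    1.\<close>
  define b where "b j z = flat 0 ((r j)\<^sup>2 - (Re z - Re (a j))\<^sup>2 - (Im z - Im (a j))\<^sup>2)" for j z
  have pos: "(r j)\<^sup>2 - (Re z - Re (a j))\<^sup>2 - (Im z - Im (a j))\<^sup>2 > 0 \<longleftrightarrow> z \<in> ball (a j) (r j)" for j z
  proof -
    have "(dist (a j) z)\<^sup>2 = (Re z - Re (a j))\<^sup>2 + (Im z - Im (a j))\<^sup>2"
      by (simp add: dist_norm cmod_power2 power2_commute)
    moreover have "(dist (a j) z)\<^sup>2 < (r j)\<^sup>2 \<longleftrightarrow> dist (a j) z < r j"
      using ar(1)[of j] by (simp add: power_mono_iff flip: not_le)
    ultimately show ?thesis by (simp add: algebra_simps) 
  qed
  have b01: "0 \<le> b j z" "b j z < 1" for j z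
    by (auto simp: b_def flat_def)
  have bpos: "b j z > 0 \<longleftrightarrow> z \<in> ball (a j) (r j)" for j z
    using pos[of j z] by (auto simp: b_def flat_def)
  have bs: "Ck m (b j)" for m j
    unfolding b_def[abs_def]
    by (intro Ck_flat_compose Ck_diff Ck_power Ck_const Ck_bounded_linear bounded_linear_Re
        bounded_linear_Im)
  \<comment> \<open>Both the number of factors and the exponent grow with \<open>m\<close>. The
    first eventually includes a ball containing \<open>z\<close>; the second drives that factor to
    0, however small the bump is at \<open>z\<close>.\<close>
  define X where "X m z = 1 - (\<Prod>j\<le>m. (1 - b j z) ^ m)" for m z
  define \<theta> where "\<theta> m z = complex_of_real (X m z)" for m :: nat and z
  have q: "0 \<le> (1 - b j z) ^ m" "(1 - b j z) ^ m \<le> 1" for j m z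
    using b01[of j z] by (auto intro!: power_le_one)
  have P01: "0 \<le> (\<Prod>j\<le>m. (1 - b j z) ^ m)" "(\<Prod>j\<le>m. (1 - b j z) ^ m) \<le> 1" for m z
    using q by (auto intro!: prod_nonneg prod_le_1)
  have "test_function V (\<theta> m)" for m
  proof (rule test_functionI)
    have "Ck k (X m)" for k unfolding X_def[abs_def]
      by (intro Ck_diff Ck_const Ck_prod Ck_power bs)
    then show "\<forall>k. Ck k (\<theta> m)" unfolding \<theta>_def[abs_def]
      using Ck_bounded_linear_compose[OF bounded_linear_of_real] by blast
    show "compact (\<Union>j\<le>m. cball (a j) (r j))" "(\<Union>j\<le>m. cball (a j) (r j)) \<subseteq> V"
      using ar(2) by auto
    show "z \<in> (\<Union>j\<le>m. cball (a j) (r j))" if "\<theta> m z \<noteq> 0" for z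
    proof (rule ccontr)
      assume z: "z \<notin> (\<Union>j\<le>m. cball (a j) (r j))"
      have "b j z = 0" if "j \<le> m" for j
      proof -
        have "z \<notin> ball (a j) (r j)" using z that ball_subset_cball[of "a j" "r j"] by blast
        then show ?thesis using bpos[of j z] b01(1)[of j z] by linarith
      qed
      then have "X m z = 0" by (simp add: X_def)
      with that show False by (simp add: \<theta>_def)
    qed
  qed
  moreover have "norm (\<theta> m z) \<le> 1" for m z
    unfolding \<theta>_def norm_of_real X_def using P01[where m = m and z = z] by (auto simp: abs_if)
  moreover have "(\<lambda>m. \<theta> m z) \<longlonglongrightarrow> 1" if "z \<in> V" for z
  proof -
    have "z \<in> \<Union> (range B)" unfolding B F'(3) UF by (rule that)
    then obtain j where "z \<in> B j" by blast
    then have bj: "b j z > 0" using bpos ar(3) by auto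
    have "(\<lambda>m. \<Prod>j\<le>m. (1 - b j z) ^ m) \<longlonglongrightarrow> 0"
    proof (rule tendsto_sandwich[OF _ _ tendsto_const])
      show "(\<lambda>m. (1 - b j z) ^ m) \<longlonglongrightarrow> 0"
        using bj b01[of j z] by (intro LIMSEQ_power_zero) auto
      show "\<forall>\<^sub>F m in sequentially. (\<Prod>j\<le>m. (1 - b j z) ^ m) \<le> (1 - b j z) ^ m"
        using eventually_ge_at_top[of j]
      proof eventually_elim
        case (elim m)
        have "(\<Prod>j\<le>m. (1 - b j z) ^ m) = (1 - b j z) ^ m * (\<Prod>i\<in>{..m} - {j}. (1 - b i z) ^ m)"
          using elim by (subst prod.remove[of _ j]) auto
        also have "\<dots> \<le> (1 - b j z) ^ m * 1"
          using q by (intro mult_left_mono prod_le_1) auto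
        finally show ?case by simp
      qed
    qed (use P01 in auto)
    then have "(\<lambda>m. complex_of_real (1 - (\<Prod>j\<le>m. (1 - b j z) ^ m))) \<longlonglongrightarrow> complex_of_real (1 - 0)"
      by (intro tendsto_intros)
    then show ?thesis by (simp add: \<theta>_def[abs_def] X_def)
  qed
  ultimately show ?thesis by blast
qed

section \<open>Cut-offs and derivatives in the variables outside \<open>I\<close>\<close>

lemma compact_vec:
  fixes C :: "'n::finite \<Rightarrow> complex set"
  assumes "\<And>i. compact (C i)"
  shows "compact {z :: complex ^ 'n. \<forall>i. z $ i \<in> C i}"
proof -
  have "\<forall>i. \<exists>B. \<forall>x\<in>C i. norm x \<le> B"
    using compact_imp_bounded[OF assms] unfolding bounded_iff by (intro allI)
  then obtain B where B: "\<And>i x. x \<in> C i \<Longrightarrow> norm x \<le> B i" by metis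
  have "norm z \<le> sum B UNIV" if "\<forall>i. z $ i \<in> C i" for z :: "complex ^ 'n"
  proof -
    have "norm z \<le> (\<Sum>i\<in>UNIV. norm (z $ i))"
      unfolding norm_vec_def by (rule L2_set_le_sum) simp
    also have "\<dots> \<le> sum B UNIV" using that B by (intro sum_mono) auto
    finally show ?thesis .
  qed
  then have "bounded {z :: complex ^ 'n. \<forall>i. z $ i \<in> C i}"
    unfolding bounded_iff by blast
  moreover have "closed {z :: complex ^ 'n. \<forall>i. z $ i \<in> C i}"
  proof -
    have "closed ((\<lambda>z :: complex ^ 'n. z $ i) -` C i)" for i
      using assms compact_imp_closed by (intro closed_vimage continuous_intros) auto
    then have "closed (\<Inter>i. (\<lambda>z :: complex ^ 'n. z $ i) -` C i)" by blast
    moreover have "(\<Inter>i. (\<lambda>z :: complex ^ 'n. z $ i) -` C i) = {z. \<forall>i. z $ i \<in> C i}" by auto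
    ultimately show ?thesis by simp
  qed
  ultimately show ?thesis by (simp add: compact_eq_bounded_closed)
qed

lemma frechet_derivative_constant_direction:
  fixes f :: "'a::euclidean_space \<Rightarrow> 'b::real_normed_vector"
  assumes "f differentiable (at z)" and c: "\<And>t. f (z + t *\<^sub>R v) = f z"
  shows "frechet_derivative f (at z) v = 0"
proof -
  have "((\<lambda>t::real. z + t *\<^sub>R v) has_derivative (\<lambda>t. t *\<^sub>R v)) (at 0)"
    by (auto intro!: derivative_eq_intros)
  moreover have "(f has_derivative frechet_derivative f (at z)) (at (z + 0 *\<^sub>R v))"
    using assms(1) by (simp flip: frechet_derivative_works)
  ultimately have "((\<lambda>t::real. f (z + t *\<^sub>R v)) has_derivative (\<lambda>t. frechet_derivative f (at z) (t
      *\<^sub>R v))) (at 0)"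
    by (rule has_derivative_compose)
  then have "((\<lambda>t::real. f z) has_derivative (\<lambda>t. frechet_derivative f (at z) (t *\<^sub>R v))) (at 0)"
    by (simp only: c)
  from has_derivative_unique[OF this has_derivative_const]
  have "frechet_derivative f (at z) (1 *\<^sub>R v) = 0" by meson
  then show ?thesis by simp
qed

lemma cauchy_adjoint_bounded:
  assumes \<phi>: "test_function U \<phi>"
  shows "\<exists>B. \<forall>y. norm (cauchy_adjoint \<rho> I \<phi> y) \<le> B"
proof -
  obtain B where B: "\<And>x. norm (\<phi> x) \<le> B" "B \<ge> 0" using test_function_bounded[OF \<phi>] by blast
  have "norm (cauchy_adjoint \<rho> I \<phi> y) \<le> (LINT w|PL I. norm (kernel_prod \<rho> I w) * B)" for y
    unfolding conv_def
    by (rule order_trans[OF integral_norm_bound integral_mono])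
      (use conv_integrable[OF integrable_kernel_prod[of I \<rho>] zext_measurable \<phi>,
          THEN integrable_norm] B(1)
          integrable_norm[OF integrable_kernel_prod[of I \<rho>]]
        in \<open>auto simp: norm_mult intro!: mult_left_mono\<close>)
  then show ?thesis by blast
qed

lemma cauchy_adjoint_smooth: "test_function U \<phi> \<Longrightarrow> \<forall>m. Ck m (cauchy_adjoint \<rho> I \<phi>)"
  using conv_smooth[OF integrable_kernel_prod zext_measurable] by blast

lemma cauchy_adjoint_measurable: "test_function U \<phi> \<Longrightarrow> cauchy_adjoint \<rho> I \<phi> \<in> borel_measurable borel"
  by (intro borel_measurable_continuous_onI smooth_continuous cauchy_adjoint_smooth)

lemma dbar_cauchy_adjoint: "test_function U \<phi> \<Longrightarrow> dbar k (cauchy_adjoint \<rho> I \<phi>)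
    = cauchy_adjoint \<rho> I (dbar k \<phi>)"
  by (rule dbar_conv[OF integrable_kernel_prod zext_measurable])

text \<open>\<open>cauchy_adjoint \<rho> I \<phi>\<close> need not vanish near the boundary in the variables of \<open>I\<close>; it is cut off by
  functions of these variables only, which commute with \<open>dbar k\<close>.\<close>

lemma cauchy_adjoint_dbar_notin:
  fixes \<phi> G G' :: "complex ^ 'n::finite \<Rightarrow> complex"
  assumes D: "\<And>i. open (D i)" "\<And>i. D i \<noteq> {}" and k: "k \<notin> I"
    and \<phi>: "test_function (product_domain D) \<phi>"
    and G: "integrable lborel G" "\<And>z. z \<notin> product_domain D \<Longrightarrow> G z = 0"
    and G': "integrable lborel G'" "\<And>z. z \<notin> product_domain D \<Longrightarrow> G' z = 0"
    and weak: "\<And>\<psi>. test_function (product_domain D) \<psi> \<Longrightarrow> (LINT z|lborel. G' z * \<psi> z)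
        = - (LINT z|lborel. G z * dbar k \<psi> z)"
  shows "(LINT z|lborel. G z * cauchy_adjoint \<rho> I (dbar k \<phi>) z)
      = - (LINT z|lborel. G' z * cauchy_adjoint \<rho> I \<phi> z)"
proof -
  let ?U = "product_domain D"
  have "\<forall>i. \<exists>\<theta> :: nat \<Rightarrow> complex \<Rightarrow> complex. (\<forall>m. test_function (D i) (\<theta> m))
      \<and> (\<forall>m z. norm (\<theta> m z) \<le> 1) \<and>
    (\<forall>z\<in>D i. (\<lambda>m. \<theta> m z) \<longlonglongrightarrow> 1)"
    by (intro allI ex_cutoff D)
  then obtain \<theta> :: "'n \<Rightarrow> nat \<Rightarrow> complex \<Rightarrow> complex" where
    \<theta>: "\<And>i m. test_function (D i) (\<theta> i m)" "\<And>i m z. norm (\<theta> i m z) \<le> 1" "\<And>i z. z \<in> D i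
        \<Longrightarrow> (\<lambda>m. \<theta> i m z) \<longlonglongrightarrow> 1"
    by metis
  define X where "X m z = (\<Prod>i\<in>I. \<theta> i m (z $ i))" for m and z :: "complex ^ 'n"
  have Xs: "\<forall>j. Ck j (X m)" for m
  proof
    fix j
    have "Ck j (\<lambda>z :: complex ^ 'n. \<theta> i m (0 + z $ i))" for i
      by (rule Ck_affine_compose[OF bounded_linear_vec_nth]) (use test_functionD(1)[OF \<theta>(1)] in
          blast)
    then show "Ck j (X m)" unfolding X_def[abs_def] by (intro Ck_prod) simp
  qed
  have X1: "norm (X m z) \<le> 1" for m z
    unfolding X_def by (simp add: prod_norm[symmetric] prod_le_1 \<theta>(2))
  have Xlim: "(\<lambda>m. X m z) \<longlonglongrightarrow> 1" if "z \<in> ?U" for z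
  proof -
    have "(\<lambda>m. X m z) \<longlonglongrightarrow> (\<Prod>i\<in>I. 1)"
      unfolding X_def by (intro tendsto_prod \<theta>(3)) (use that in \<open>auto simp: product_domain_def\<close>)
    then show ?thesis by simp
  qed
  have Xd: "dbar k (X m) z = 0" for m z
  proof -
    have "frechet_derivative (X m) (at z) (axis k v) = 0" for v
      by (rule frechet_derivative_constant_direction[OF smooth_differentiable[OF Xs]])
        (use k in \<open>auto simp: X_def axis_def intro!: prod.cong\<close>)
    then show ?thesis by (simp add: dbar_def)
  qed
  have Xm: "X m \<in> borel_measurable borel" for m
    by (intro borel_measurable_continuous_onI smooth_continuous Xs)
  let ?\<psi> = "cauchy_adjoint \<rho> I \<phi>"
  have X\<psi>: "test_function ?U (\<lambda>z. X m z * ?\<psi> z)" for m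
  proof (rule test_functionI)
    let ?Ks = "closure {z. \<phi> z \<noteq> 0}"
    have Ks: "compact ?Ks" "?Ks \<subseteq> ?U" using \<phi> by (auto simp: test_function_def)
    \<comment> \<open>A compact box containing the support of the product. In the slots of
      \<open>I\<close> the cut-offs confine \<open>z\<close>; in the others \<open>zext I w\<close>
      is 0, so the projections of the support of \<open>\<phi>\<close> do.\<close>
    define C where "C i = (if i \<in> I then closure {w. \<theta> i m w \<noteq> 0} else (\<lambda>z. z $ i) ` ?Ks)" for i
    show "\<forall>j. Ck j (\<lambda>z. X m z * ?\<psi> z)" using Xs cauchy_adjoint_smooth[OF \<phi>]
        by (blast intro: Ck_mult)
    have C: "compact (C i)" "C i \<subseteq> D i" for i
      using \<theta>(1)[of i m] Ks by (auto simp: C_def test_function_def product_domain_def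
          intro!: compact_continuous_image continuous_intros)
    show "compact {z. \<forall>i. z $ i \<in> C i}" by (intro compact_vec C)
    show "{z. \<forall>i. z $ i \<in> C i} \<subseteq> ?U" using C(2) by (auto simp: product_domain_def)
    fix z assume nz: "X m z * ?\<psi> z \<noteq> 0"
    have "z $ i \<in> C i" for i
    proof (cases "i \<in> I")
      case True
      then have "\<theta> i m (z $ i) \<noteq> 0" using nz by (auto simp: X_def)
      then show ?thesis using True closure_subset by (fastforce simp: C_def)
    next
      case False
      have "\<exists>w. \<phi> (z - zext I w) \<noteq> 0"
      proof (rule ccontr)
        assume "\<nexists>w. \<phi> (z - zext I w) \<noteq> 0"
        then have "?\<psi> z = 0" by (simp add: conv_def)
        with nz show False by simp
      qed
      then obtain w where "\<phi> (z - zext I w) \<noteq> 0" by blast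
      then have "z - zext I w \<in> ?Ks" using closure_subset[of "{z. \<phi> z \<noteq> 0}"] by blast
      then show ?thesis using False by (force simp: C_def intro!: image_eqI[of _ _ "z - zext I w"])
    qed
    then show "z \<in> {z. \<forall>i. z $ i \<in> C i}" by simp
  qed
  \<comment> \<open>The cut-offs tend to 1 only on the domain; elsewhere the factor \<open>H\<close>
    is 0.\<close>
  have lim: "(\<lambda>m. LINT z|lborel. H z * (X m z * h z)) \<longlonglongrightarrow> (LINT z|lborel. H z * h z)"
    if H: "integrable lborel H" "\<And>z. z \<notin> ?U \<Longrightarrow> H z = 0" and h: "h
        \<in> borel_measurable borel" "\<And>z. norm (h z) \<le> B"
    for H h :: "complex ^ 'n \<Rightarrow> complex" and B
  proof (rule integral_dominated_convergence[where w = "\<lambda>z. norm (H z) * B"])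
    have Hm: "H \<in> borel_measurable lborel" using H(1) by (rule borel_measurable_integrable)
    have hm: "h \<in> borel_measurable lborel" "X m \<in> borel_measurable lborel" for m
      using h(1) Xm[of m] unfolding measurable_cong_sets[OF sets_lborel refl] by blast+
    show "(\<lambda>z. H z * h z) \<in> borel_measurable lborel"
      by (intro borel_measurable_times Hm hm)
    show "(\<lambda>z. H z * (X m z * h z)) \<in> borel_measurable lborel" for m
      by (intro borel_measurable_times Hm hm)
    show "integrable lborel (\<lambda>z. norm (H z) * B)" using H(1) by simp
    show "AE z in lborel. (\<lambda>m. H z * (X m z * h z)) \<longlonglongrightarrow> H z * h z"
    proof (rule AE_I2)
      fix z show "(\<lambda>m. H z * (X m z * h z)) \<longlonglongrightarrow> H z * h z"
      proof (cases "z \<in> ?U")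
        case True
        have "(\<lambda>m. H z * (X m z * h z)) \<longlonglongrightarrow> H z * (1 * h z)"
          by (intro tendsto_intros Xlim True)
        then show ?thesis by simp
      qed (simp add: H(2))
    qed
    show "AE z in lborel. norm (H z * (X m z * h z)) \<le> norm (H z) * B" for m
    proof (rule AE_I2)
      fix z
      have "norm (X m z) * norm (h z) \<le> 1 * B" by (intro mult_mono X1 h(2)) auto
      then show "norm (H z * (X m z * h z)) \<le> norm (H z) * B"
        by (simp add: norm_mult mult_left_mono)
    qed
  qed
  note t = test_function_dbar[OF \<phi>, of k]
  obtain B where B: "\<And>y. norm (cauchy_adjoint \<rho> I \<phi> y) \<le> B"
      using cauchy_adjoint_bounded[OF \<phi>] by blast
  obtain B' where B': "\<And>y. norm (cauchy_adjoint \<rho> I (dbar k \<phi>) y)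
      \<le> B'" using cauchy_adjoint_bounded[OF t] by blast
  have eq: "(LINT z|lborel. G' z * (X m z * ?\<psi> z)) = - (LINT z|lborel. G z * (X m z *
      cauchy_adjoint \<rho> I (dbar k \<phi>) z))" for m
    using weak[OF X\<psi>[of m]] by (simp add: wirtinger_mult[OF Xs cauchy_adjoint_smooth[OF \<phi>],
        of "axis k 1" "axis k \<i>", folded dbar_wirtinger] Xd dbar_cauchy_adjoint[OF \<phi>])
  have "(\<lambda>m. LINT z|lborel. G' z * (X m z * ?\<psi> z)) \<longlonglongrightarrow> (LINT z|lborel. G' z * ?\<psi> z)"
    by (rule lim[OF G' cauchy_adjoint_measurable[OF \<phi>] B])
  moreover have "(\<lambda>m. - (LINT z|lborel. G z * (X m z * cauchy_adjoint \<rho> I (dbar k \<phi>) z)))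
      \<longlonglongrightarrow> - (LINT z|lborel. G z * cauchy_adjoint \<rho> I (dbar k \<phi>) z)"
    by (intro tendsto_minus lim[OF G cauchy_adjoint_measurable[OF t] B'])
  ultimately have "(LINT z|lborel. G' z * ?\<psi> z) = - (LINT z|lborel. G z * cauchy_adjoint \<rho> I (dbar
      k \<phi>) z)"
    unfolding eq by (rule LIMSEQ_unique)
  then show ?thesis by simp
qed

text \<open>For nonempty J not containing \<open>k\<close>, the term from J cancels the one from
  \<open>insert k J\<close>. Only the index {k} keeps its term, because its partner would be the
  empty set, over which the sum does not run.\<close>

lemma weak_solution:
  fixes D :: "'n::finite \<Rightarrow> complex set" and G :: "'n set \<Rightarrow> complex ^ 'n \<Rightarrow> complex"
  assumes D: "\<And>i. open (D i)" "\<And>i. D i \<noteq> {}" "\<And>i z. z \<in> D i \<Longrightarrow> norm z < R"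
    and G: "\<And>I. I \<noteq> {} \<Longrightarrow> integrable lborel (G I)" "\<And>I. I \<noteq> {} \<Longrightarrow> G I \<in> borel_measurable borel"
      "\<And>I z. I \<noteq> {} \<Longrightarrow> z \<notin> product_domain D \<Longrightarrow> G I z = 0"
    and weak: "\<And>I k \<psi>. I \<noteq> {} \<Longrightarrow> k \<notin> I \<Longrightarrow> test_function (product_domain D) \<psi> \<Longrightarrow>
      (LINT z|lborel. G (insert k I) z * \<psi> z) = - (LINT z|lborel. G I z * dbar k \<psi> z)"
    and \<phi>: "test_function (product_domain D) \<phi>"
  shows "(LINT z|lborel. (\<Sum>I\<in>{I. I \<noteq> {}}. cauchy_transform (2 * R) I (G I) z) * dbar k \<phi> z)
      = (LINT z|lborel. G {k} z * \<phi> z)"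
proof -
  let ?U = "product_domain D" and ?S = "cauchy_adjoint (2 * R)"
  have \<phi>': "test_function UNIV \<phi>" using \<phi> by (simp add: test_function_def)
  have supp: "\<phi> z = 0" if "R < norm (z $ k)" for z
  proof (rule ccontr)
    assume "\<phi> z \<noteq> 0"
    then have "z \<in> ?U" using \<phi> closure_subset[of "{z. \<phi> z \<noteq> 0}"] by (auto simp: test_function_def)
    then have "norm (z $ k) < R" by (intro D(3)) (auto simp: product_domain_def)
    with that show False by simp
  qed
  note t = test_function_dbar[OF \<phi>, of k]
  obtain B where B: "\<And>x. norm (dbar k \<phi> x) \<le> B" using test_function_bounded[OF t] by blast
  note dual = C_duality[OF G(1,2) test_functionD(4)[OF t] B]
  \<comment> \<open>Up to sign this is the contribution of \<open>insert k I\<close> as well as that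
    of \<open>I\<close>, for \<open>k\<close> outside a nonempty \<open>I\<close>.\<close>
  define A where "A I = (LINT z|lborel. G (insert k I) z * ?S I \<phi> z)" for I
  have inside: "(LINT z|lborel. G I z * ?S I (dbar k \<phi>) z) = A (I - {k})" if "k \<in> I" for I
  proof -
    have "G I z * ?S I (dbar k \<phi>) z = G I z * ?S (I - {k}) \<phi> z" for z
    proof (cases "z \<in> ?U")
      case True
      then have "norm (z $ k) < R" by (intro D(3)) (auto simp: product_domain_def)
      then show ?thesis using cauchy_adjoint_dbar_in[OF \<phi>' supp _ that, of R z] by simp
    qed (use G(3)[of I z] that in auto)
    then have "(LINT z|lborel. G I z * ?S I (dbar k \<phi>) z)
        = (LINT z|lborel. G I z * ?S (I - {k}) \<phi> z)"
      by (simp only:)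
    moreover have "insert k (I - {k}) = I" using that by auto
    ultimately show ?thesis by (simp only: A_def)
  qed
  have outside: "(LINT z|lborel. G I z * ?S I (dbar k \<phi>) z) = - A I" if "k \<notin> I" "I \<noteq> {}" for I
    unfolding A_def using that
    by (intro cauchy_adjoint_dbar_notin[OF D(1,2) _ \<phi> G(1) G(3) G(1) G(3)] weak) auto
  have "(LINT z|lborel. (\<Sum>I\<in>{I. I \<noteq> {}}. cauchy_transform (2 * R) I (G I) z) * dbar k \<phi> z)
     = (LINT z|lborel. (\<Sum>I\<in>{I. I \<noteq> {}}. cauchy_transform (2 * R) I (G I) z * dbar k \<phi> z))"
    by (simp only: sum_distrib_right)
  also have "\<dots> = (\<Sum>I\<in>{I. I \<noteq> {}}. LINT z|lborel. cauchy_transform (2 * R) I (G I) z * dbar k \<phi> z)"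
    by (rule Bochner_Integration.integral_sum) (use dual(2) in auto)
  also have "\<dots> = (\<Sum>I\<in>{I. I \<noteq> {}}. LINT z|lborel. G I z * ?S I (dbar k \<phi>) z)"
    by (intro sum.cong refl dual(3)) auto
  \<comment> \<open>Sets containing \<open>k\<close> are written as \<open>insert k J\<close> with
    \<open>k\<close> not in J. Here J may be empty, in contrast to the second family.\<close>
  also have "(\<Sum>I\<in>{I. I \<noteq> {}}. LINT z|lborel. G I z * ?S I (dbar k \<phi>) z)
     = (\<Sum>I\<in>insert k ` {J. k \<notin> J} \<union> {J. k \<notin> J \<and> J \<noteq> {}}. LINT z|lborel. G I z * ?S I (dbar k \<phi>) z)"
  proof (rule sum.cong[OF _ refl])
    have "I \<in> insert k ` {J. k \<notin> J}" if "k \<in> I" for I :: "'n set"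
      using that by (intro image_eqI[of _ _ "I - {k}"]) auto
    then show "{I. I \<noteq> {}} = insert k ` {J. k \<notin> J} \<union> {J. k \<notin> J \<and> J \<noteq> {}}" by auto
  qed
  also have "(\<Sum>I\<in>insert k ` {J. k \<notin> J} \<union> {J. k \<notin> J \<and> J \<noteq> {}}. LINT z|lborel. G I z * ?S I (dbar k
      \<phi>) z)
     = (\<Sum>I\<in>insert k ` {J. k \<notin> J}. LINT z|lborel. G I z * ?S I (dbar k \<phi>) z)
     + (\<Sum>I\<in>{J. k \<notin> J \<and> J \<noteq> {}}. LINT z|lborel. G I z * ?S I (dbar k \<phi>) z)"
    by (rule sum.union_disjoint) auto
  also have "(\<Sum>I\<in>insert k ` {J. k \<notin> J}. LINT z|lborel. G I z * ?S I (dbar k \<phi>) z)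
     = (\<Sum>J\<in>{J. k \<notin> J}. A J)"
    by (subst sum.reindex) (auto simp: inj_on_def inside intro!: sum.cong arg_cong[where f = A])
  also have "(\<Sum>I\<in>{J. k \<notin> J \<and> J \<noteq> {}}. LINT z|lborel. G I z * ?S I (dbar k \<phi>) z)
     = (\<Sum>J\<in>{J. k \<notin> J \<and> J \<noteq> {}}. - A J)"
    by (intro sum.cong refl outside) auto
  also have "(\<Sum>J\<in>{J. k \<notin> J}. A J) = A {} + (\<Sum>J\<in>{J. k \<notin> J \<and> J \<noteq> {}}. A J)"
  proof -
    have "{J. k \<notin> J} = insert {} {J. k \<notin> J \<and> J \<noteq> {}}" by auto
    then show ?thesis by simp
  qed
  finally show ?thesis by (simp add: A_def cauchy_adjoint_empty sum_negf)
qed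

section \<open>The functions \<open>f\<^sub>I\<close> and their Borel representatives\<close>

text \<open>Preimages under \<open>f\<close> and \<open>h\<close> differ by part of a null set, and
  the completion measures all subsets of null sets.\<close>

lemma measurable_completion_cong_AE:
  assumes h: "h \<in> M \<rightarrow>\<^sub>M N" and f: "f \<in> space M \<rightarrow> space N" and ae: "AE x in M. f x = h x"
  shows "f \<in> completion M \<rightarrow>\<^sub>M N"
proof (rule measurableI)
  fix A assume A: "A \<in> sets N"
  obtain Z where Z: "Z \<in> null_sets M" "{x \<in> space M. f x \<noteq> h x} \<subseteq> Z"
    using ae by (auto simp: eventually_ae_filter)
  have "f -` A \<inter> space M = (h -` A \<inter> space M - Z) \<union> (f -` A \<inter> space M \<inter> Z)"
    using Z(2) by auto
  moreover have "h -` A \<inter> space M - Z \<in> sets (completion M)"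
    using measurable_sets[OF h A] Z(1) by (intro sets_completionI_sets) auto
  moreover have "f -` A \<inter> space M \<inter> Z \<in> sets (completion M)"
    using null_sets_completion_subset[of "f -` A \<inter> space M \<inter> Z" Z M] null_sets_completionI[OF
        Z(1)] by auto
  ultimately show "f -` A \<inter> space (completion M) \<in> sets (completion M)"
    by (metis sets.Un space_completion)
qed (use f in auto)

text \<open>Bridge from \<open>lebesgue\<close> and \<open>vol\<close>, which are built from
  completions, to Borel functions under \<open>lborel\<close> and \<open>PL I\<close>.\<close>

lemma completion_cong_AE:
  fixes f h :: "'a \<Rightarrow> 'b::{banach, second_countable_topology}"
  assumes h: "h \<in> borel_measurable M" and ae: "AE x in M. f x = h x"
  shows "f \<in> borel_measurable (completion M)"
    and "integral\<^sup>L (completion M) f = integral\<^sup>L M h"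
    and "integrable (completion M) f \<longleftrightarrow> integrable M h"
proof -
  show f: "f \<in> borel_measurable (completion M)"
    by (rule measurable_completion_cong_AE[OF h _ ae]) simp
  have ae': "AE x in completion M. f x = h x" by (rule AE_completion[OF ae])
  note h' = measurable_completion[OF h]
  show "integral\<^sup>L (completion M) f = integral\<^sup>L M h"
    using integral_cong_AE[OF f h' ae'] integral_completion[OF h] by simp
  show "integrable (completion M) f \<longleftrightarrow> integrable M h"
    using integrable_cong_AE[OF f h' ae'] integrable_completion[OF h] by simp
qed

section \<open>Independence of the order of differentiation\<close>

lemma foldr_dbar_test: "test_function U \<phi> \<Longrightarrow> test_function U (foldr dbar ks \<phi>)"
  by (induction ks) (auto intro: test_function_dbar)

lemma foldr_dbar_move:
  "test_function U \<phi> \<Longrightarrow> foldr dbar (a @ k # b) \<phi> = dbar k (foldr dbar (a @ b) \<phi>)"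
proof (induction a)
  case (Cons x a)
  have "\<forall>m. Ck m (foldr dbar (a @ b) \<phi>)"
    using foldr_dbar_test[OF Cons.prems] by (rule test_functionD)
  with Cons show ?case using dbar_commute by simp
qed simp

lemma foldr_dbar_mset:
  assumes "test_function U \<phi>"
  shows "mset ks = mset ks' \<Longrightarrow> foldr dbar ks \<phi> = foldr dbar ks' \<phi>"
proof (induction ks arbitrary: ks')
  case (Cons k ks)
  have "k \<in> set ks'" using Cons.prems by (metis list.set_intros(1) set_mset_mset)
  then obtain a b where ks': "ks' = a @ k # b" by (meson split_list)
  then have "mset ks = mset (a @ b)" using Cons.prems by simp
  from Cons.IH[OF this] show ?case unfolding ks' foldr_dbar_move[OF assms] by simp
qed simp

lemma foldr_dbar_remove1:
  assumes "test_function U \<phi>" "k \<in> set ks"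
  shows "foldr dbar ks \<phi> = dbar k (foldr dbar (remove1 k ks) \<phi>)"
proof -
  have "mset ks = mset (k # remove1 k ks)" using assms(2) by simp
  from foldr_dbar_mset[OF assms(1) this] show ?thesis by simp
qed

text \<open>The two representatives may come from enumerations with different heads \<open>i\<close>
  and \<open>j\<close>. The remaining derivatives can then be arranged as \<open>dbar i\<close> on
  one side and \<open>dbar j\<close> on the other, applied to a common test function, and closedness
  exchanges \<open>f j\<close> with \<open>f i\<close>.\<close>

lemma represents_insert:
  fixes f :: "'n::finite \<Rightarrow> complex ^ 'n \<Rightarrow> complex"
  assumes closed: "weakly_dbar_closed U f"
    and g: "represents_f_I U f I g" and g': "represents_f_I U f (insert k I) g'" and k: "k \<notin> I"
    and \<psi>: "test_function U \<psi>"
  shows "(LINT z:U|lebesgue. g' z * \<psi> z) = - (LINT z:U|lebesgue. g z * dbar k \<psi> z)"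
proof -
  obtain i "is" where i: "distinct (i # is)" "set (i # is) = I" "weak_dbar U is (f i) g"
    using g unfolding represents_f_I_def by blast
  obtain j js where j: "distinct (j # js)" "set (j # js) = insert k I" "weak_dbar U js (f j) g'"
    using g' unfolding represents_f_I_def by blast
  have t: "test_function U (dbar k \<psi>)" by (rule test_function_dbar[OF \<psi>])
  have 1: "(LINT z:U|lebesgue. g z * dbar k \<psi> z) = (- 1) ^ length is * (LINT z:U|lebesgue. f i z *
      foldr dbar (is @ [k]) \<psi> z)"
    using i(3) t unfolding weak_dbar_def by simp
  have 2: "(LINT z:U|lebesgue. g' z * \<psi> z) = (- 1) ^ length js * (LINT z:U|lebesgue. f j z * foldr
      dbar js \<psi> z)"
    using j(3) \<psi> unfolding weak_dbar_def by simp
  have dk: "distinct (i # is @ [k])" "set (i # is @ [k]) = insert k I" using i k by auto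
  \<comment> \<open>The enumeration for \<open>insert k I\<close> carries one derivative more than
    that for \<open>I\<close>, whence the minus sign.\<close>
  have "length (j # js) = card (insert k I)" using distinct_card[OF j(1)] j(2) by simp
  moreover have "length (i # is @ [k]) = card (insert k I)"
      using distinct_card[OF dk(1)] dk(2) by simp
  ultimately have len: "length js = Suc (length is)" by simp
  have 3: "(LINT z:U|lebesgue. f j z * foldr dbar js \<psi> z)
      = (LINT z:U|lebesgue. f i z * foldr dbar (is @ [k]) \<psi> z)"
  proof (cases "i = j")
    case True
    have "set js = set (is @ [k])" using j(1,2) dk True by auto
    then have "mset js = mset (is @ [k])"
      using j(1) dk(1) by (subst set_eq_iff_mset_eq_distinct[symmetric]) auto
    from foldr_dbar_mset[OF \<psi> this] True show ?thesis by simp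
  next
    case False
    have ij: "i \<in> set js" "j \<in> set (is @ [k])" using j(2) dk(2) False by auto
    have "set (remove1 i js) = set (remove1 j (is @ [k]))"
      using j(1,2) dk False by (subst (1 2) set_remove1_eq) auto
    then have "mset (remove1 i js) = mset (remove1 j (is @ [k]))"
      using j(1) dk(1) by (subst set_eq_iff_mset_eq_distinct[symmetric]) auto
    from foldr_dbar_mset[OF \<psi> this]
    have "foldr dbar js \<psi> = dbar i (foldr dbar (remove1 j (is @ [k])) \<psi>)"
      using foldr_dbar_remove1[OF \<psi> ij(1)] by simp
    moreover have "foldr dbar (is @ [k]) \<psi> = dbar j (foldr dbar (remove1 j (is @ [k])) \<psi>)"
      by (rule foldr_dbar_remove1[OF \<psi> ij(2)])
    ultimately show ?thesis
      using closed foldr_dbar_test[OF \<psi>, of "remove1 j (is @ [k])"]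
          unfolding weakly_dbar_closed_def by simp
  qed
  show ?thesis unfolding 1 2 3 len by simp
qed

text \<open>On singletons \<open>f_I\<close> is the given coefficient and not a chosen function; the
  empty list of derivatives and local integrability of \<open>f\<close> settle that case.\<close>

lemma represents_f_I_f_I:
  assumes "\<And>j. f j locally_integrable_on U" "\<exists>g. represents_f_I U f I g"
  shows "represents_f_I U f I (f_I U f I)"
proof (cases "is_singleton I")
  case True
  then obtain i where I: "I = {i}" by (auto simp: is_singleton_def)
  have "weak_dbar U [] (f i) (f i)" using assms(1) by (simp add: weak_dbar_def)
  then have "represents_f_I U f {i} (f i)"
    unfolding represents_f_I_def by (intro exI[of _ i] exI[of _ "[]"]) simp
  then show ?thesis by (simp add: f_I_def I)
next
  case False
  then show ?thesis using someI_ex[OF assms(2)] by (simp add: f_I_def)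
qed

lemma represents_locally_integrable:
  "represents_f_I U f I g \<Longrightarrow> g locally_integrable_on U"
  unfolding represents_f_I_def weak_dbar_def by blast

section \<open>Borel representatives\<close>

lemma locally_integrable_measurable:
  fixes g :: "'a::euclidean_space \<Rightarrow> complex"
  assumes g: "g locally_integrable_on U" and U: "open U"
  shows "(\<lambda>z. indicator U z *\<^sub>R g z) \<in> borel_measurable lebesgue"
proof -
  \<comment> \<open>Local integrability yields measurability on compact subsets; an increasing
    exhaustion transfers it to all of \<open>U\<close>.\<close>
  obtain C where C: "\<And>n. compact (C n)" "\<And>n. C n \<subseteq> U" "\<And>n. C n \<subseteq> interior (C (Suc n))" "\<Union> (range
      C) = U"
    using open_Union_compact_subsets[OF U] by metis
  have inc: "C m \<subseteq> C n" if "m \<le> n" for m n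
    using that by (induction rule: dec_induct) (use C(3) interior_subset in blast)+
  show ?thesis
  proof (rule borel_measurable_LIMSEQ_metric)
    show "(\<lambda>z. indicator (C n) z *\<^sub>R g z) \<in> borel_measurable lebesgue" for n
      using g C(1,2) unfolding locally_integrable_on_def set_integrable_def
      by (meson borel_measurable_integrable)
    show "(\<lambda>n. indicator (C n) z *\<^sub>R g z) \<longlonglongrightarrow> indicator U z *\<^sub>R g z" for z
    proof (cases "z \<in> U")
      case True
      then obtain N where "z \<in> C N" using C(4) by auto
      then have "\<forall>\<^sub>F n in sequentially. indicator (C n) z *\<^sub>R g z = indicator U z *\<^sub>R g z"
        using True inc unfolding eventually_sequentially
            by (intro exI[of _ N]) (auto simp: indicator_def)
      then show ?thesis by (rule tendsto_eventually)
    next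
      case False
      then have "indicator (C n) z = (0::real)" for n using C(2) by (auto simp: indicator_def)
      with False show ?thesis by simp
    qed
  qed
qed

text \<open>Slicing and Fubini are carried out for Borel functions, and extension by 0 lets
  integrals over the domain run over the whole space.\<close>

lemma ex_borel_representative:
  fixes g :: "'a::euclidean_space \<Rightarrow> complex"
  assumes g: "g locally_integrable_on U" and U: "open U"
  shows "\<exists>G \<in> borel_measurable borel. (\<forall>z. z \<notin> U \<longrightarrow> G z = 0) \<and> (AE z in lborel. z \<in> U \<longrightarrow> G z = g z)"
proof -
  let ?g = "\<lambda>z. indicator U z *\<^sub>R g z"
  have m: "?g \<in> borel_measurable (completion lborel)" by (rule locally_integrable_measurable[OF g
      U])
  have "(\<lambda>z. Re (?g z)) \<in> borel_measurable (completion lborel)" "(\<lambda>z. Im (?g z))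
      \<in> borel_measurable (completion lborel)"
    by (rule measurable_compose[OF m]; simp)+
  note this[THEN completion_ex_borel_measurable_real]
  then obtain a b where ab: "a \<in> borel_measurable lborel" "AE z in lborel. Re (?g z) = a z"
      "b \<in> borel_measurable lborel" "AE z in lborel. Im (?g z) = b z"
    by (elim bexE)
  define G where "G z = indicator U z *\<^sub>R Complex (a z) (b z)" for z
  have c: "(\<lambda>z. Complex (a z) (b z)) \<in> borel_measurable borel"
    using ab(1,3) unfolding Complex_eq by (auto intro!: borel_measurable_add borel_measurable_times)
  have "(indicator U :: 'a \<Rightarrow> real) \<in> borel_measurable borel"
    using U by (intro borel_measurable_indicator borel_open)
  from borel_measurable_scaleR[OF this c] have "G \<in> borel_measurable borel"
    unfolding G_def[abs_def] .
  moreover have "AE z in lborel. z \<in> U \<longrightarrow> G z = g z"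
    using ab(2,4) by eventually_elim (auto simp: G_def complex_eq_iff)
  moreover have "\<forall>z. z \<notin> U \<longrightarrow> G z = 0" by (simp add: G_def)
  ultimately show ?thesis by blast
qed

section \<open>Slices\<close>

lemma open_product_domain: "(\<And>i. open (D i)) \<Longrightarrow> open (product_domain D)"
  for D :: "'n::finite \<Rightarrow> complex set"
proof -
  assume D: "\<And>i. open (D i)"
  have "product_domain D = (\<Inter>i. (\<lambda>z. z $ i) -` D i)" by (auto simp: product_domain_def)
  moreover have "open ((\<lambda>z :: complex ^ 'n. z $ i) -` D i)" for i
    by (intro open_vimage D continuous_intros)
  ultimately show ?thesis by auto
qed

lemma glue_in_product_domain:
  assumes "\<And>j. j \<notin> I \<Longrightarrow> z'' j \<in> D j"
  shows "glue I z' z'' \<in> product_domain D \<longleftrightarrow> (\<forall>i\<in>I. z' i \<in> D i)"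
  using assms by (auto simp: product_domain_def)

lemma PiE_in_sets_PL: "(\<And>i. open (D i)) \<Longrightarrow> Pi\<^sub>E I D \<in> sets (PL I)"
  by (intro sets_PiM_I_finite) auto

lemma PiE_in_sets_completion:
  "(\<And>i. open (D i)) \<Longrightarrow> Pi\<^sub>E I D \<inter> space (completion (PL I)) \<in> sets (completion (PL I))"
  using PiE_in_sets_PL[of D I] by (intro sets.Int sets.top) auto

lemma nn_integral_vol:
  assumes "\<And>i. open (D i)"
  shows "(\<integral>\<^sup>+x. h x \<partial>vol D I) = (\<integral>\<^sup>+x. h x * indicator (Pi\<^sub>E I D) x \<partial>PL I)"
  unfolding vol_def by (simp add: nn_integral_restrict_space[OF PiE_in_sets_completion[OF assms]]
      nn_integral_completion)

lemma AE_vol: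
  assumes "\<And>i. open (D i)"
  shows "(AE x in vol D I. P x) \<longleftrightarrow> (AE x in PL I. x \<in> Pi\<^sub>E I D \<longrightarrow> P x)"
  unfolding vol_def AE_restrict_space_iff[OF PiE_in_sets_completion[OF assms]] AE_completion_iff ..

lemma vol_cong_AE:
  fixes h H :: "('n::finite \<Rightarrow> complex) \<Rightarrow> complex"
  assumes D: "\<And>i. open (D i)" and H: "H \<in> borel_measurable (PL I)"
    and ae: "AE x in PL I. indicator (Pi\<^sub>E I D) x *\<^sub>R h x = H x"
  shows "integral\<^sup>L (vol D I) h = integral\<^sup>L (PL I) H"
    and "integrable (vol D I) h \<longleftrightarrow> integrable (PL I) H"
  unfolding vol_def integral_restrict_space[OF PiE_in_sets_completion[OF D]]
    integrable_restrict_space[OF PiE_in_sets_completion[OF D]]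
  by (rule completion_cong_AE[OF H ae])+

section \<open>Comparison of \<open>C_op\<close> with \<open>cauchy_transform\<close>\<close>

lemma cauchy_transform_integrand_measurable:
  assumes G: "G \<in> borel_measurable borel"
  shows "(\<lambda>\<zeta>. G (glue I \<zeta> z'')) \<in> borel_measurable (PL I)"
    and "(\<lambda>\<zeta>. kernel_prod \<rho> I (\<lambda>i. \<zeta> i - z' i)) \<in> borel_measurable (PL I)"
proof -
  show "(\<lambda>\<zeta>. G (glue I \<zeta> z'')) \<in> borel_measurable (PL I)"
    by (rule measurable_compose[OF glue_measurable G]) (auto intro: PL_component)
  show "(\<lambda>\<zeta>. kernel_prod \<rho> I (\<lambda>i. \<zeta> i - z' i)) \<in> borel_measurable (PL I)"
    unfolding kernel_prod_def
    by (intro borel_measurable_prod measurable_compose[OF _ cauchy_kernel_measurable]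
        borel_measurable_diff
        PL_component borel_measurable_const)
qed

text \<open>Since \<open>G\<close> and \<open>g\<close> agree only almost everywhere on the domain,
  they agree along the slice through \<open>z\<close> only for almost every \<open>z\<close>. Two
  points of some \<open>D i\<close> have distance below \<open>2 * R\<close>, so the cut-off of the
  kernel is invisible there. Integrability is stated as an implication since its premise comes from
  \<open>C_duality\<close>.\<close>

lemma C_op_eq_cauchy_transform:
  fixes D :: "'n::finite \<Rightarrow> complex set"
  assumes D: "\<And>i. open (D i)" "\<And>i z. z \<in> D i \<Longrightarrow> norm z < R"
    and G: "G \<in> borel_measurable borel" "\<And>z. z \<notin> product_domain D \<Longrightarrow> G z = 0"
      "AE z in lborel. z \<in> product_domain D \<longrightarrow> G z = g z"
  shows "AE z in lborel. z \<in> product_domain D \<longrightarrow> C_op D I g z = cauchy_transform (2 * R) I G z \<and>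
    (integrable (PL I) (\<lambda>\<zeta>. G (glue I \<zeta> (($) z)) * kernel_prod (2 * R) I (\<lambda>i. \<zeta> i - z $ i)) \<longrightarrow>
      integrable (vol D I) (C_integrand I g z))"
  using AE_AE_glue[OF G(3), of I]
proof (rule eventually_mono, intro impI)
  fix z
  assume ae: "AE \<zeta> in PL I. glue I \<zeta> (($) z) \<in> product_domain D
      \<longrightarrow> G (glue I \<zeta> (($) z)) = g (glue I \<zeta> (($) z))"
    and z: "z \<in> product_domain D"
  \<comment> \<open>The constant by which the two integrands differ: \<open>C_integrand\<close>
    carries (2 i)^l and \<open>kernel_prod\<close> carries pi^(-l).\<close>
  define c where "c = (2 * complex_of_real pi * \<i>) ^ card I"
  have c: "c \<noteq> 0" by (simp add: c_def)
  let ?F = "\<lambda>\<zeta>. G (glue I \<zeta> (($) z)) * kernel_prod (2 * R) I (\<lambda>i. \<zeta> i - z $ i)"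
  have F: "(\<lambda>\<zeta>. c * ?F \<zeta>) \<in> borel_measurable (PL I)"
    by (intro borel_measurable_times borel_measurable_const
        cauchy_transform_integrand_measurable[OF G(1)])
  have "AE \<zeta> in PL I. indicator (Pi\<^sub>E I D) \<zeta> *\<^sub>R C_integrand I g z \<zeta> = c * ?F \<zeta>"
    using ae AE_space
  proof eventually_elim
    case (elim \<zeta>)
    have ext: "\<zeta> \<in> extensional I" using elim(2) by (auto simp: space_PiM PiE_def)
    have zj: "z $ j \<in> D j" for j using z by (simp add: product_domain_def)
    have mem: "glue I \<zeta> (($) z) \<in> product_domain D \<longleftrightarrow> \<zeta> \<in> Pi\<^sub>E I D"
      using ext by (subst glue_in_product_domain) (auto simp: zj PiE_def)
    show ?case
    proof (cases "\<zeta> \<in> Pi\<^sub>E I D")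
      case True
      have "kernel_prod (2 * R) I (\<lambda>i. \<zeta> i - z $ i) = (\<Prod>i\<in>I. 1 / (of_real pi * (\<zeta> i - z $ i)))"
        unfolding kernel_prod_def
      proof (rule prod.cong[OF refl])
        fix i assume "i \<in> I"
        then have "norm (\<zeta> i) < R" "norm (z $ i) < R" using True zj D(2) by auto
        then have "norm (\<zeta> i - z $ i) < 2 * R" using norm_triangle_ineq4[of "\<zeta> i" "z $ i"]
            by linarith
        then show "cauchy_kernel (2 * R) (\<zeta> i - z $ i) = 1 / (of_real pi * (\<zeta> i - z $ i))"
          by (simp add: cauchy_kernel_def)
      qed
      also have "\<dots> = 1 / (of_real pi ^ card I * (\<Prod>i\<in>I. \<zeta> i - z $ i))"
        by (simp add: prod_dividef prod.distrib)
      finally have K: "kernel_prod (2 * R) I (\<lambda>i. \<zeta> i - z $ i)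
          = 1 / (of_real pi ^ card I * (\<Prod>i\<in>I. \<zeta> i - z $ i))" .
      have "c = of_real pi ^ card I * (2 * \<i>) ^ card I"
        by (simp only: c_def power_mult_distrib mult_ac)
      then show ?thesis using True elim(1) mem
        by (simp add: C_integrand_def K)
    next
      case False
      then show ?thesis using mem G(2) by simp
    qed
  qed
  note vc = vol_cong_AE[OF D(1) F this]
  have "C_op D I g z = 1 / c * (LINT \<zeta>|PL I. c * ?F \<zeta>)"
    unfolding C_op_def vc(1) c_def ..
  also have "\<dots> = cauchy_transform (2 * R) I G z"
    unfolding cauchy_transform_def integral_mult_right_zero using c by simp
  finally show "C_op D I g z = cauchy_transform (2 * R) I G z \<and> (integrable (PL I) ?F
      \<longrightarrow> integrable (vol D I) (C_integrand I g z))"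
    unfolding vc(2) by simp
qed

text \<open>Counterpart of \<open>slice_integral\<close> for a Borel representative, taken over the
  whole space instead of the domain.\<close>

definition slice_power :: "real \<Rightarrow> 'n::finite set \<Rightarrow> (complex ^ 'n \<Rightarrow> complex) \<Rightarrow> ('n \<Rightarrow> complex) \<Rightarrow>
    ennreal" where
  "slice_power r I G z'' = (\<integral>\<^sup>+z'. ennreal (norm (G (glue I z' z'')) powr r) \<partial>PL I)"

lemma slice_power_measurable:
  assumes G: "G \<in> borel_measurable borel" and J: "- I \<subseteq> J"
  shows "slice_power r I G \<in> borel_measurable (PL J)"
  unfolding slice_power_def[abs_def]
proof (rule sigma_finite_measure.borel_measurable_nn_integral[OF sigma_finite_PL])
  have "(\<lambda>x. glue I (snd x) (fst x)) \<in> borel_measurable (PL J \<Otimes>\<^sub>M PL I)"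
  proof (rule glue_measurable)
    show "(\<lambda>x. snd x i) \<in> borel_measurable (PL J \<Otimes>\<^sub>M PL I)" if "i \<in> I" for i
      by (rule measurable_compose[OF measurable_snd PL_component[OF that]])
    show "(\<lambda>x. fst x i) \<in> borel_measurable (PL J \<Otimes>\<^sub>M PL I)" if "i \<notin> I" for i
      by (rule measurable_compose[OF measurable_fst PL_component]) (use that J in auto)
  qed
  from measurable_compose[OF this G] have "(\<lambda>x. G (glue I (snd x) (fst x)))
      \<in> borel_measurable (PL J \<Otimes>\<^sub>M PL I)" .
  then have "(\<lambda>x. ennreal (norm (G (glue I (snd x) (fst x))) powr r))
      \<in> borel_measurable (PL J \<Otimes>\<^sub>M PL I)"
    by measurable
  then show "(\<lambda>(z'', z'). ennreal (norm (G (glue I z' z'')) powr r))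
      \<in> borel_measurable (PL J \<Otimes>\<^sub>M PL I)"
    unfolding case_prod_beta .
qed

lemma slice_power_eq_0:
  assumes "\<And>z. z \<notin> product_domain D \<Longrightarrow> G z = 0" "z'' \<in> space (PL (- I))" "z'' \<notin> Pi\<^sub>E (- I) D"
  shows "G (glue I z' z'') = 0" "slice_power r I G z'' = 0"
proof -
  obtain j where "j \<notin> I" "z'' j \<notin> D j" using assms(2,3) by (auto simp: space_PiM PiE_def Pi_def)
  then have "glue I z' z'' \<notin> product_domain D" for z' by (auto
      simp: product_domain_def intro!: exI[of _ j])
  then have "G (glue I z' z'') = 0" for z' by (rule assms(1))
  then show "G (glue I z' z'') = 0" "slice_power r I G z'' = 0" by (simp_all add: slice_power_def)
qed

lemma slice_integral_eq_slice_power: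
  fixes D :: "'n::finite \<Rightarrow> complex set"
  assumes D: "\<And>i. open (D i)"
    and G: "\<And>z. z \<notin> product_domain D \<Longrightarrow> G z = 0" "AE z in lborel. z \<in> product_domain D \<longrightarrow> G z = g z"
  shows "AE z'' in PL (- I). z'' \<in> Pi\<^sub>E (- I) D \<longrightarrow> slice_integral r D I g z''
      = slice_power r I G z''"
  using AE_glue[OF G(2), of I]
proof (rule eventually_mono, intro impI)
  fix z''
  assume ae: "AE z' in PL I. glue I z' z'' \<in> product_domain D
      \<longrightarrow> G (glue I z' z'') = g (glue I z' z'')"
    and z'': "z'' \<in> Pi\<^sub>E (- I) D"
  show "slice_integral r D I g z'' = slice_power r I G z''"
    unfolding slice_integral_def nn_integral_vol[OF D] slice_power_def
  proof (rule nn_integral_cong_AE)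
    show "AE z' in PL I. ennreal (norm (g (glue I z' z'')) powr r) * indicator (Pi\<^sub>E I D) z'
        = ennreal (norm (G (glue I z' z'')) powr r)"
      using ae AE_space
    proof eventually_elim
      case (elim z')
      have ext: "z' \<in> extensional I" using elim(2) by (auto simp: space_PiM PiE_def)
      have mem: "glue I z' z'' \<in> product_domain D \<longleftrightarrow> z' \<in> Pi\<^sub>E I D"
        using ext z'' by (subst glue_in_product_domain) (auto simp: PiE_def)
      then show ?case using elim(1) G(1)[of "glue I z' z''"] by (cases "z' \<in> Pi\<^sub>E I D") auto
    qed
  qed
qed

lemma nn_integral_slice_eq_slice_power:
  fixes D :: "'n::finite \<Rightarrow> complex set"
  assumes D: "\<And>i. open (D i)"
    and G: "\<And>z. z \<notin> product_domain D \<Longrightarrow> G z = 0" "AE z in lborel. z \<in> product_domain D \<longrightarrow> G z = g z"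
  shows "(\<integral>\<^sup>+z''. epow (slice_integral r D I g z'') a \<partial>vol D (- I))
      = (\<integral>\<^sup>+z''. epow (slice_power r I G z'') a \<partial>PL (- I))"
  unfolding nn_integral_vol[OF D]
proof (rule nn_integral_cong_AE)
  have ae: "AE z'' in PL (- I). z'' \<in> Pi\<^sub>E (- I) D \<longrightarrow> slice_integral r D I g z''
      = slice_power r I G z''"
    by (rule slice_integral_eq_slice_power[OF D]) (erule G(1), rule G(2))
  show "AE z'' in PL (- I). epow (slice_integral r D I g z'') a * indicator (Pi\<^sub>E (- I) D) z''
      = epow (slice_power r I G z'') a"
    using ae AE_space
  proof eventually_elim
    case (elim z'')
    then show ?case using slice_power_eq_0(2)[of D G z'' I r] G(1)
        by (cases "z'' \<in> Pi\<^sub>E (- I) D") auto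
  qed
qed

section \<open>Norm estimates for the Cauchy transform\<close>

definition abs_kernel :: "real \<Rightarrow> 'n::finite set \<Rightarrow> ('n \<Rightarrow> complex) \<Rightarrow> ('n \<Rightarrow> complex) \<Rightarrow> real" where
  "abs_kernel \<rho> I x y = (\<Prod>i\<in>I. norm (cauchy_kernel \<rho> (y i - x i)))"

lemma nn_integral_lborel_translate:
  fixes h :: "'a::euclidean_space \<Rightarrow> ennreal"
  assumes h: "h \<in> borel_measurable borel"
  shows "(\<integral>\<^sup>+y. h (y - a) \<partial>lborel) = (\<integral>\<^sup>+y. h y \<partial>lborel)"
    and "(\<integral>\<^sup>+y. h (a - y) \<partial>lborel) = (\<integral>\<^sup>+y. h y \<partial>lborel)"
proof -
  have "(\<integral>\<^sup>+y. h y \<partial>lborel) = (\<integral>\<^sup>+y. h y \<partial>distr lborel borel ((+) (- a)))"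
    by (simp add: lborel_distr_plus)
  also have "\<dots> = (\<integral>\<^sup>+y. h (- a + y) \<partial>lborel)" by (rule nn_integral_distr) (auto simp: h)
  finally show "(\<integral>\<^sup>+y. h (y - a) \<partial>lborel) = (\<integral>\<^sup>+y. h y \<partial>lborel)" by simp
  have "(\<integral>\<^sup>+y. h y \<partial>lborel) = (\<integral>\<^sup>+y. h y \<partial>distr lborel borel (\<lambda>y. a + (- 1) *\<^sub>R y))"
    using lborel_affine[of "-1" a] by (simp add: density_1)
  also have "\<dots> = (\<integral>\<^sup>+y. h (a + (- 1) *\<^sub>R y) \<partial>lborel)" by (rule nn_integral_distr) (auto simp: h)
  finally show "(\<integral>\<^sup>+y. h (a - y) \<partial>lborel) = (\<integral>\<^sup>+y. h y \<partial>lborel)" by simp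
qed

lemma nn_integral_cauchy_kernel_powr:
  assumes s: "0 < s" "s < 2"
  shows "(\<integral>\<^sup>+w. ennreal (norm (cauchy_kernel \<rho> w) powr s) \<partial>lborel) < \<infinity>"
proof -
  have "(\<integral>\<^sup>+w. ennreal (norm (cauchy_kernel \<rho> w) powr s) \<partial>lborel)
      = (\<integral>\<^sup>+(w::complex). ennreal (pi powr - s) * (if norm w < \<rho> then ennreal (norm w powr
          - s) else 0) \<partial>lborel)"
  proof (rule nn_integral_cong)
    fix w :: complex
    have "(1 / (pi * norm w)) powr s = pi powr - s * norm w powr - s"
      by (simp add: powr_divide powr_mult powr_minus_divide)
    then show "ennreal (norm (cauchy_kernel \<rho> w) powr s)
        = ennreal (pi powr - s) * (if norm w < \<rho> then ennreal (norm w powr - s) else 0)"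
      by (simp add: cauchy_kernel_def norm_divide norm_mult ennreal_mult)
  qed
  also have "\<dots> = ennreal (pi powr - s) * (\<integral>\<^sup>+(w::complex). (if norm w < \<rho> then ennreal (norm w
      powr - s) else 0) \<partial>lborel)"
    by (rule nn_integral_cmult, unfold measurable_lborel2) measurable
  also have "\<dots> < \<infinity>"
    using nn_integral_norm_powr_finite[OF s, of \<rho>] by (simp add: ennreal_mult_less_top)
  finally show ?thesis .
qed

text \<open>The \<open>s\<close>-th power of the kernel factors over the coordinates, and
  translation invariance makes each factor the same constant \<open>a\<close>, finite because s < 2.
  Hence \<open>A\<close> is its \<open>card I\<close>-th power.\<close>

lemma kernel_abs_kernel:
  assumes s: "0 < s" "s < 2"
  shows "\<exists>A. young_kernel (PL I) (abs_kernel \<rho> I) s A"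
proof -
  define a where "a = (\<integral>\<^sup>+w. ennreal (norm (cauchy_kernel \<rho> w) powr s) \<partial>lborel)"
  have "a < \<infinity>" unfolding a_def by (rule nn_integral_cauchy_kernel_powr[OF s])
  then have "a ^ card I < top" by (simp add: power_less_top_ennreal less_top)
  then obtain A where A: "A \<ge> 0" "a ^ card I = ennreal A" by (cases "a ^ card I") auto
  have h: "(\<lambda>w. ennreal (norm (cauchy_kernel \<rho> w) powr s)) \<in> borel_measurable borel" by measurable
  have pw: "ennreal (abs_kernel \<rho> I x y powr s) = (\<Prod>i\<in>I. ennreal (norm (cauchy_kernel \<rho> (y i
      - x i)) powr s))" for x y
    unfolding abs_kernel_def by (simp add: prod_powr_distrib prod_ennreal)
  interpret sigma_finite_measure "PL I" by (rule sigma_finite_PL)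
  have "young_kernel (PL I) (abs_kernel \<rho> I) s A"
  proof
    have c: "(\<lambda>z. snd z i - fst z i) \<in> borel_measurable (PL I \<Otimes>\<^sub>M PL I)" if "i \<in> I" for i
      using that by (intro borel_measurable_diff measurable_compose[OF measurable_snd
          PL_component] measurable_compose[OF measurable_fst PL_component])
    have "(\<lambda>z. \<Prod>i\<in>I. norm (cauchy_kernel \<rho> (snd z i - fst z i))) \<in> borel_measurable (PL I \<Otimes>\<^sub>M PL I)"
      by (intro borel_measurable_prod measurable_compose[OF measurable_compose[OF c
          cauchy_kernel_measurable] borel_measurable_norm])
    then show "case_prod (abs_kernel \<rho> I) \<in> borel_measurable (PL I \<Otimes>\<^sub>M PL I)"
      unfolding abs_kernel_def case_prod_beta' .
    show "abs_kernel \<rho> I x y \<ge> 0" for x y unfolding abs_kernel_def by (intro prod_nonneg) simp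
    show "s > 0" "A \<ge> 0" by (rule s A)+
    have t: "(\<lambda>y. ennreal (norm (cauchy_kernel \<rho> (y - b)) powr s)) \<in> borel_measurable lborel"
        "(\<lambda>y. ennreal (norm (cauchy_kernel \<rho> (b - y)) powr s)) \<in> borel_measurable lborel" for b
      by (intro measurable_compose[OF _ h] borel_measurable_diff borel_measurable_const
          measurable_ident_sets sets_lborel)+
    show "(\<integral>\<^sup>+y. ennreal (abs_kernel \<rho> I x y powr s) \<partial>PL I) \<le> ennreal A" for x
    proof -
      have "(\<integral>\<^sup>+y. ennreal (abs_kernel \<rho> I x y powr s) \<partial>PL I)
          = (\<Prod>i\<in>I. \<integral>\<^sup>+y. ennreal (norm (cauchy_kernel \<rho> (y - x i)) powr s) \<partial>lborel)"
        unfolding pw by (rule PL.product_nn_integral_prod) (simp_all only: t finite)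
      also have "\<dots> = a ^ card I"
        unfolding nn_integral_lborel_translate(1)[OF h] a_def by simp
      finally show ?thesis using A by simp
    qed
    show "(\<integral>\<^sup>+x. ennreal (abs_kernel \<rho> I x y powr s) \<partial>PL I) \<le> ennreal A" for y
    proof -
      have "(\<integral>\<^sup>+x. ennreal (abs_kernel \<rho> I x y powr s) \<partial>PL I)
          = (\<Prod>i\<in>I. \<integral>\<^sup>+x. ennreal (norm (cauchy_kernel \<rho> (y i - x)) powr s) \<partial>lborel)"
        unfolding pw by (rule PL.product_nn_integral_prod) (simp_all only: t finite)
      also have "\<dots> = a ^ card I"
        unfolding nn_integral_lborel_translate(2)[OF h] a_def by simp
      finally show ?thesis using A by simp
    qed
  qed
  then show ?thesis ..
qed

text \<open>If the integrand is not integrable, the Bochner integral is 0 by convention and the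
  bound holds trivially.\<close>

lemma norm_cauchy_transform_le:
  assumes G: "G \<in> borel_measurable borel"
  shows "ennreal (norm (cauchy_transform \<rho> I G z)) \<le> (\<integral>\<^sup>+\<zeta>. ennreal (norm (G (glue I \<zeta> (($) z))) *
      abs_kernel \<rho> I (($) z) \<zeta>) \<partial>PL I)"
proof -
  let ?F = "\<lambda>\<zeta>. G (glue I \<zeta> (($) z)) * kernel_prod \<rho> I (\<lambda>i. \<zeta> i - z $ i)"
  have "ennreal (norm (cauchy_transform \<rho> I G z)) \<le> (\<integral>\<^sup>+\<zeta>. ennreal (norm (?F \<zeta>)) \<partial>PL I)"
    unfolding cauchy_transform_def
    by (cases "integrable (PL I) ?F") (auto intro: integral_norm_bound_ennreal
        simp: not_integrable_integral_eq)
  moreover have "norm (?F \<zeta>) = norm (G (glue I \<zeta> (($) z))) * abs_kernel \<rho> I (($) z) \<zeta>" for \<zeta>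
    by (simp add: norm_mult kernel_prod_def abs_kernel_def prod_norm)
  ultimately show ?thesis by (simp only:)
qed

lemma emeasure_PiE_finite:
  fixes D :: "'n::finite \<Rightarrow> complex set"
  assumes D: "\<And>i. open (D i)" "\<And>i z. z \<in> D i \<Longrightarrow> norm z < R"
  shows "emeasure (PL I) (Pi\<^sub>E I D) < \<infinity>"
proof -
  have "emeasure lborel (D i) < \<infinity>" for i
    by (rule emeasure_bounded_finite) (use D(2) in \<open>auto
        simp: bounded_iff intro!: exI[of _ R] less_imp_le\<close>)
  moreover have "emeasure (PL I) (Pi\<^sub>E I D) = (\<Prod>i\<in>I. emeasure lborel (D i))"
    by (rule PL.emeasure_PiM) (use D(1) in auto)
  moreover have "(\<Prod>i\<in>I. emeasure lborel (D i)) < \<infinity>"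
    using finite[of I] by induction (simp_all add: ennreal_mult_less_top calculation(1)[simplified])
  ultimately show ?thesis by simp
qed

lemma slice_measurable:
  assumes G: "G \<in> borel_measurable borel"
  shows "(\<lambda>\<zeta>. norm (G (glue I \<zeta> z''))) \<in> borel_measurable (PL I)"
  by (rule measurable_compose[OF cauchy_transform_integrand_measurable(1)[OF G]
      borel_measurable_norm])

lemma cauchy_transform_measurable:
  assumes "G \<in> borel_measurable borel" "integrable lborel G"
  shows "integrable lborel (cauchy_transform \<rho> I G)" "cauchy_transform \<rho> I G
      \<in> borel_measurable borel"
proof -
  show i: "integrable lborel (cauchy_transform \<rho> I G)"
    using C_duality(2)[OF assms(2,1), of "\<lambda>_. 1" 1] by simp
  show "cauchy_transform \<rho> I G \<in> borel_measurable borel"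
      using borel_measurable_integrable[OF i] unfolding measurable_lborel2 .
qed

text \<open>Young's inequality acts in the variables of \<open>I\<close> with z'' frozen. Its
  constant depends neither on z'' nor on \<open>G\<close>, so the slice estimates can be integrated
  over z''.\<close>

lemma cauchy_transform_Lp_bound:
  fixes D :: "'n::finite \<Rightarrow> complex set"
  assumes D: "\<And>i. open (D i)" "\<And>i z. z \<in> D i \<Longrightarrow> norm z < R"
    and pr: "1 \<le> p" "1 \<le> r" "1 / min r p + 1 / s = 1 + 1 / p" and s: "0 < s" "s < 2"
  shows "\<exists>C\<ge>0. \<forall>G. G \<in> borel_measurable borel \<and> integrable lborel G \<and> (\<forall>z. z \<notin> product_domain D
      \<longrightarrow> G z = 0) \<longrightarrow>
    (\<integral>\<^sup>+z. epow (ennreal (norm (cauchy_transform \<rho> I G z))) p \<partial>lborel)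
        \<le> ennreal C * (\<integral>\<^sup>+z''. epow (slice_power r I G z'') (p / r) \<partial>PL (- I))"
proof -
  obtain A where "young_kernel (PL I) (abs_kernel \<rho> I) s A" using kernel_abs_kernel[OF s] by blast
  then interpret young_kernel "PL I" "abs_kernel \<rho> I" s A .
  obtain C where C: "C \<ge> 0" "\<And>g. g \<in> borel_measurable (PL I) \<Longrightarrow> (\<And>x. g x \<ge> 0)
      \<Longrightarrow> (\<And>x. x \<in> space (PL I) - Pi\<^sub>E I D \<Longrightarrow> g x = 0) \<Longrightarrow>
     (\<integral>\<^sup>+x. epow (transform g x) p \<partial>PL I) \<le> ennreal C * epow (\<integral>\<^sup>+y. ennreal (g y powr r) \<partial>PL I) (p
         / r)"
    using young[OF pr PiE_in_sets_PL[of D I] emeasure_PiE_finite[of D R I]] D by blast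
  show ?thesis
  proof (intro exI[of _ C] conjI allI impI C(1), elim conjE)
    fix G :: "complex ^ 'n \<Rightarrow> complex"
    assume G: "G \<in> borel_measurable borel" "integrable lborel G" "\<forall>z. z \<notin> product_domain D
        \<longrightarrow> G z = 0"
    let ?h = "\<lambda>z. epow (ennreal (norm (cauchy_transform \<rho> I G z))) p"
    have h: "?h \<in> borel_measurable borel"
      using cauchy_transform_measurable(2)[OF G(1,2), of \<rho> I] by measurable
    have "(\<integral>\<^sup>+z. ?h z \<partial>lborel) = (\<integral>\<^sup>+z''. (\<integral>\<^sup>+z'. ?h (glue I z' z'') \<partial>PL I) \<partial>PL (- I))"
      by (rule nn_integral_glue[OF h])
    also have "\<dots> \<le> (\<integral>\<^sup>+z''. ennreal C * epow (slice_power r I G z'') (p / r) \<partial>PL (- I))"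
    proof (rule nn_integral_mono)
      fix z'' :: "'n \<Rightarrow> complex"
      let ?g = "\<lambda>\<zeta>. norm (G (glue I \<zeta> z''))"
      have "?h (glue I z' z'') \<le> epow (transform ?g z') p" for z'
      proof (rule epow_mono)
        have "glue I \<zeta> (($) (glue I z' z'')) = glue I \<zeta> z''" for \<zeta> by (auto simp: vec_eq_iff)
        moreover have "abs_kernel \<rho> I (($) (glue I z' z'')) \<zeta> = abs_kernel \<rho> I z' \<zeta>" for \<zeta>
          unfolding abs_kernel_def by (rule prod.cong) auto
        ultimately show "ennreal (norm (cauchy_transform \<rho> I G (glue I z' z''))) \<le> transform ?g z'"
          using norm_cauchy_transform_le[OF G(1), of \<rho> I "glue I z' z''"]
              by (simp add: transform_def)
      qed (use pr in simp)
      then have "(\<integral>\<^sup>+z'. ?h (glue I z' z'') \<partial>PL I) \<le> (\<integral>\<^sup>+z'. epow (transform ?g z') p \<partial>PL I)"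
        by (intro nn_integral_mono)
      also have "\<dots> \<le> ennreal C * epow (\<integral>\<^sup>+y. ennreal (?g y powr r) \<partial>PL I) (p / r)"
      proof (rule C(2)[OF slice_measurable[OF G(1)]])
        fix x assume "x \<in> space (PL I) - Pi\<^sub>E I D"
        then obtain i where "i \<in> I" "x i \<notin> D i" by (auto simp: space_PiM PiE_def Pi_def)
        then have "glue I x z'' \<notin> product_domain D" by (auto
            simp: product_domain_def intro!: exI[of _ i])
        then show "?g x = 0" using G(3) by simp
      qed simp
      finally show "(\<integral>\<^sup>+z'. ?h (glue I z' z'') \<partial>PL I) \<le> ennreal C * epow (slice_power r I G z'')
          (p / r)"
        by (simp add: slice_power_def)
    qed
    also have "\<dots> = ennreal C * (\<integral>\<^sup>+z''. epow (slice_power r I G z'') (p / r) \<partial>PL (- I))"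
      by (rule nn_integral_cmult, rule measurable_compose[OF slice_power_measurable[OF G(1)]
          epow_measurable]) simp
    finally show "(\<integral>\<^sup>+z. ?h z \<partial>lborel) \<le> ennreal C * (\<integral>\<^sup>+z''. epow (slice_power r I G z'') (p / r)
        \<partial>PL (- I))" .
  qed
qed

lemma slice_power_nth: "slice_power r I G (($) z) = slice_power r I G (restrict (($) z) (- I))"
  unfolding slice_power_def glue_restrict ..

text \<open>For conjugate exponents the estimate holds at every single \<open>z\<close>, along the
  slice through \<open>z\<close>.\<close>

lemma cauchy_transform_Linf_bound:
  assumes r: "0 < r" "1 / r + 1 / s = 1" and s: "0 < s" "s < 2"
  shows "\<exists>C\<ge>0. \<forall>G z. G \<in> borel_measurable borel \<longrightarrow>
    ennreal (norm (cauchy_transform \<rho> I G z)) \<le> ennreal C * epow (slice_power r I G (restrict (($)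
        z) (- I))) (1 / r)"
proof -
  obtain A where "young_kernel (PL I) (abs_kernel \<rho> I) s A" using kernel_abs_kernel[OF s] by blast
  then interpret young_kernel "PL I" "abs_kernel \<rho> I" s A .
  show ?thesis
  proof (intro exI[of _ "1 + A"] conjI allI impI)
    show "0 \<le> 1 + A" using A_nonneg by simp
    fix G :: "complex ^ 'a \<Rightarrow> complex" and z assume G: "G \<in> borel_measurable borel"
    let ?g = "\<lambda>\<zeta>. norm (G (glue I \<zeta> (($) z)))"
    have "abs_kernel \<rho> I (($) z) \<zeta> = abs_kernel \<rho> I (restrict (($) z) I) \<zeta>" for \<zeta>
      unfolding abs_kernel_def by (rule prod.cong) auto
    then have "ennreal (norm (cauchy_transform \<rho> I G z)) \<le> transform ?g (restrict (($) z) I)"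
      using norm_cauchy_transform_le[OF G, of \<rho> I z] by (simp add: transform_def)
    also have "\<dots> \<le> ennreal (1 + A) * epow (\<integral>\<^sup>+y. ennreal (?g y powr r) \<partial>PL I) (1 / r)"
      by (rule young_infinity[OF slice_measurable[OF G] _ r]) (auto simp: space_PiM)
    finally show "ennreal (norm (cauchy_transform \<rho> I G z))
        \<le> ennreal (1 + A) * epow (slice_power r I G (restrict (($) z) (- I))) (1 / r)"
      by (simp only: slice_power_nth[symmetric]) (simp only: slice_power_def)
  qed
qed

text \<open>A slice over the set \<open>Pi\<^sub>E I D\<close> of finite volume \<open>V\<close> has
  L^1 norm at most (V + 1) times one plus its L^r norm; the complementary product has finite volume
  as well, so this bound can be integrated.\<close>

lemma integrable_of_slices:
  fixes D :: "'n::finite \<Rightarrow> complex set"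
  assumes D: "\<And>i. open (D i)" "\<And>i z. z \<in> D i \<Longrightarrow> norm z < R" and r: "1 \<le> r"
    and G: "G \<in> borel_measurable borel" "\<And>z. z \<notin> product_domain D \<Longrightarrow> G z = 0"
    and fin: "(\<integral>\<^sup>+z''. epow (slice_power r I G z'') (1 / r) * indicator (Pi\<^sub>E (- I) D) z'' \<partial>PL (-
        I)) < \<infinity>"
  shows "integrable lborel G"
proof (rule integrableI_bounded)
  show "G \<in> borel_measurable lborel" using G(1) unfolding measurable_lborel2 .
  have n: "(\<lambda>z. ennreal (norm (G z))) \<in> borel_measurable borel" using G(1) by measurable
  define V where "V = emeasure (PL I) (Pi\<^sub>E I D)"
  have V: "V < \<infinity>" unfolding V_def by (rule emeasure_PiE_finite[OF D])
  let ?P = "Pi\<^sub>E (- I) D"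
  have slice: "(\<integral>\<^sup>+z'. ennreal (norm (G (glue I z' z''))) \<partial>PL I)
      \<le> (V + 1) * ((1 + epow (slice_power r I G z'') (1 / r)) * indicator ?P z'')"
    if z'': "z'' \<in> space (PL (- I))" for z''
  proof (cases "z'' \<in> ?P")
    case True
    show ?thesis
    proof (cases "slice_power r I G z''")
      case (real c)
      \<comment> \<open>One plus the L^r norm of the slice, hence positive even if that norm is 0.
        Values above \<open>l\<close> are at most l^(1-r) times their \<open>r\<close>-th power, and
        the integral of that is again at most \<open>l\<close>.\<close>
      define l where "l = 1 + c powr (1 / r)"
      have l: "l > 0" by (simp add: l_def add_pos_nonneg)
      let ?g = "\<lambda>z'. norm (G (glue I z' z''))"
      have pw: "ennreal (?g z') \<le> ennreal l * indicator (Pi\<^sub>E I D) z'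
          + ennreal (l powr (1 - r)) * ennreal (?g z' powr r)"
        if z': "z' \<in> space (PL I)" for z'
      proof (cases "z' \<in> Pi\<^sub>E I D")
        case T: True
        have "?g z' \<le> l + l powr (1 - r) * ?g z' powr r"
        proof (cases "?g z' \<le> l")
          case False
          then have "?g z' powr (1 - r) \<le> l powr (1 - r)" using l r by (intro powr_mono2') auto
          then have "?g z' powr (1 - r) * ?g z' powr r \<le> l powr (1 - r) * ?g z' powr r"
            by (rule mult_right_mono) simp
          moreover have "?g z' powr (1 - r) * ?g z' powr r
              = ?g z'" using False l by (simp flip: powr_add)
          ultimately show ?thesis using l by simp
        qed (simp add: add_increasing2)
        then show ?thesis using T l by (simp flip: ennreal_plus ennreal_mult)
      next
        case False
        then obtain i where "i \<in> I" "z' i \<notin> D i" using z' by (auto simp: space_PiM PiE_def Pi_def)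
        then have "glue I z' z'' \<notin> product_domain D" by (auto
            simp: product_domain_def intro!: exI[of _ i])
        then show ?thesis using G(2) by simp
      qed
      have m: "(\<lambda>z'. ennreal (?g z' powr r)) \<in> borel_measurable (PL I)"
        using slice_measurable[OF G(1), of I z''] by measurable
      have PI: "Pi\<^sub>E I D \<in> sets (PL I)" by (rule PiE_in_sets_PL[OF D(1)])
      have "(\<integral>\<^sup>+z'. ennreal (?g z') \<partial>PL I) \<le> (\<integral>\<^sup>+z'. ennreal l * indicator (Pi\<^sub>E I D) z'
          + ennreal (l powr (1 - r)) * ennreal (?g z' powr r) \<partial>PL I)"
        by (intro nn_integral_mono pw)
      also have "\<dots> = (\<integral>\<^sup>+z'. ennreal l * indicator (Pi\<^sub>E I D) z' \<partial>PL I)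
          + (\<integral>\<^sup>+z'. ennreal (l powr (1 - r)) * ennreal (?g z' powr r) \<partial>PL I)"
        by (intro nn_integral_add borel_measurable_times_ennreal borel_measurable_const
            borel_measurable_indicator PI m)
      also have "\<dots> = ennreal l * V + ennreal (l powr (1 - r)) * ennreal c"
        unfolding V_def nn_integral_cmult_indicator[OF PI] nn_integral_cmult[OF m]
            real(2)[symmetric] slice_power_def ..
      also have "\<dots> \<le> ennreal l * V + ennreal l * 1"
      proof (rule add_left_mono)
        have "c = (c powr (1 / r)) powr r" using real(1) r by (simp add: powr_powr)
        also have "\<dots> \<le> l powr r" using r by (intro powr_mono2) (auto simp: l_def)
        finally have "l powr (1 - r) * c \<le> l powr (1 - r) * l powr r" by (intro mult_left_mono) auto
        also have "\<dots> = l" using l by (simp flip: powr_add)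
        finally show "ennreal (l powr (1 - r)) * ennreal c \<le> ennreal l * 1"
          using real(1) by (simp add: ennreal_leI flip: ennreal_mult)
      qed
      also have "\<dots> = (V + 1) * ennreal l" by (simp add: distrib_left mult.commute)
      also have "ennreal l = 1 + epow (slice_power r I G z'') (1 / r)"
        using real by (simp add: l_def ennreal_plus)
      finally show ?thesis using True by simp
    qed (use True in \<open>simp add: ennreal_mult_top\<close>)
  next
    case False
    have "G (glue I z' z'') = 0" for z'
      by (rule slice_power_eq_0(1)[OF _ z'' False]) (erule G(2))
    then show ?thesis by simp
  qed
  have PJ: "?P \<in> sets (PL (- I))" by (rule PiE_in_sets_PL[OF D(1)])
  have ind: "(indicator ?P :: ('n \<Rightarrow> complex) \<Rightarrow> ennreal) \<in> borel_measurable (PL (- I))"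
    by (rule borel_measurable_indicator[OF PJ])
  have m: "(\<lambda>z''. epow (slice_power r I G z'') (1 / r)) \<in> borel_measurable (PL (- I))"
    by (rule measurable_compose[OF slice_power_measurable[OF G(1)] epow_measurable]) simp
  have "(\<integral>\<^sup>+z. ennreal (norm (G z)) \<partial>lborel) = (\<integral>\<^sup>+z''. (\<integral>\<^sup>+z'. ennreal (norm (G (glue I z' z'')))
      \<partial>PL I) \<partial>PL (- I))"
    by (rule nn_integral_glue[OF n])
  also have "\<dots> \<le> (\<integral>\<^sup>+z''. (V + 1) * ((1 + epow (slice_power r I G z'') (1 / r)) * indicator ?P
      z'') \<partial>PL (- I))"
    by (intro nn_integral_mono slice)
  also have "\<dots> = (V + 1) * (\<integral>\<^sup>+z''. (1 + epow (slice_power r I G z'') (1 / r)) * indicator ?P z''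
      \<partial>PL (- I))"
    by (intro nn_integral_cmult borel_measurable_times_ennreal borel_measurable_add
        borel_measurable_const ind m)
  also have "(\<integral>\<^sup>+z''. (1 + epow (slice_power r I G z'') (1 / r)) * indicator ?P z'' \<partial>PL (- I))
     = emeasure (PL (- I)) ?P + (\<integral>\<^sup>+z''. epow (slice_power r I G z'') (1 / r) * indicator ?P z''
         \<partial>PL (- I))"
    by (simp only: distrib_right mult_1 nn_integral_add[OF ind borel_measurable_times_ennreal[OF m
        ind]]
        nn_integral_indicator[OF PJ])
  also have "(V + 1) * \<dots> < \<infinity>"
    using V fin emeasure_PiE_finite[of D R "- I"] D by (simp add: ennreal_mult_less_top)
  finally show "(\<integral>\<^sup>+z. ennreal (norm (G z)) \<partial>lborel) < \<infinity>" .
qed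

text \<open>Each summand is at most the l^p norm of the whole family, so the sum is at most
  \<open>card A\<close> times that norm.\<close>

lemma epow_sum_le:
  assumes A: "finite A" "A \<noteq> {}" and p: "p \<ge> 1"
  shows "epow (\<Sum>i\<in>A. a i) p \<le> ennreal (real (card A) powr p) * (\<Sum>i\<in>A. epow (a i) p)"
proof -
  let ?e = "epow (\<Sum>i\<in>A. epow (a i) p) (1 / p)"
  have "a i \<le> ?e" if "i \<in> A" for i
  proof -
    have "a i = epow (epow (a i) p) (1 / p)" using p by (simp add: epow_epow)
    also have "\<dots> \<le> ?e" using A that p by (intro epow_mono member_le_sum) auto
    finally show ?thesis .
  qed
  then have "(\<Sum>i\<in>A. a i) \<le> of_nat (card A) * ?e" by (rule sum_bounded_above)
  then have "epow (\<Sum>i\<in>A. a i) p \<le> epow (ennreal (real (card A)) * ?e) p"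
    using p by (intro epow_mono) (auto simp: ennreal_of_nat_eq_real_of_nat)
  also have "\<dots> = ennreal (real (card A) powr p) * epow ?e p"
    using A by (intro epow_cmult) (simp add: card_gt_0_iff)
  also have "epow ?e p = (\<Sum>i\<in>A. epow (a i) p)" using p by (simp add: epow_epow)
  finally show ?thesis .
qed

text \<open>With t = 1/s the claim s < 2 means t > 1/2. For r \<le> p this reads 1/r < 1/2 + 1/p,
  which is r > 2p/(p+2); for r > p one has t = 1.\<close>

lemma young_exponent:
  assumes p: "1 \<le> p" and r: "1 \<le> r" "r > 2 * p / (p + 2)"
  shows "\<exists>s::real. 0 < s \<and> s < 2 \<and> 1 / min r p + 1 / s = 1 + 1 / p"
proof -
  define t where "t = 1 + 1 / p - 1 / min r p"
  have "t > 1 / 2"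
  proof (cases "r \<le> p")
    case True
    have "1 / r < (p + 2) / (2 * p)" using r p by (simp add: field_simps)
    also have "\<dots> = 1 / 2 + 1 / p" using p by (simp add: field_simps)
    finally show ?thesis using True by (simp add: t_def)
  next
    case False
    then show ?thesis by (simp add: t_def)
  qed
  then show ?thesis
    by (intro exI[of _ "1 / t"]) (auto simp: t_def field_simps)
qed

section \<open>The theorem\<close>

text \<open>The product \<open>G z * \<phi> z\<close> is required to vanish off \<open>U\<close>,
  not one fixed factor: representatives of \<open>f_I\<close> vanish there themselves, whereas for
  the sum of Cauchy transforms it is the derivative of the test function that does.\<close>

lemma set_integral_eq_representative:
  fixes g G \<phi> :: "'a::euclidean_space \<Rightarrow> complex"
  assumes G: "G \<in> borel_measurable borel" "\<And>z. z \<notin> U \<Longrightarrow> G z * \<phi> z = 0"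
    and ae: "AE z in lborel. z \<in> U \<longrightarrow> G z = g z" and \<phi>: "\<phi> \<in> borel_measurable borel"
  shows "(LINT z:U|lebesgue. g z * \<phi> z) = (LINT z|lborel. G z * \<phi> z)"
  unfolding set_lebesgue_integral_def
proof (rule completion_cong_AE(2))
  show "(\<lambda>z. G z * \<phi> z) \<in> borel_measurable lborel"
    unfolding measurable_lborel2 by (intro borel_measurable_times G(1) \<phi>)
  show "AE z in lborel. indicat_real U z *\<^sub>R (g z * \<phi> z) = G z * \<phi> z"
    using ae
  proof eventually_elim
    case (elim z)
    then show ?case using G(2)[of z] by (cases "z \<in> U") auto
  qed
qed

lemma test_function_outside: "test_function U \<phi> \<Longrightarrow> z \<notin> U \<Longrightarrow> \<phi> z = 0"
  using closure_subset[of "{z. \<phi> z \<noteq> 0}"] unfolding test_function_def by blast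

lemma epow_le_1_plus: "p \<ge> 1 \<Longrightarrow> x \<le> 1 + epow x p"
proof (cases x)
  case (real c)
  assume p: "p \<ge> 1"
  have "c \<le> 1 + c powr p"
  proof (cases "c \<le> 1")
    case False
    then have "c powr 1 \<le> c powr p" using p by (intro powr_mono) auto
    then show ?thesis using False by simp
  qed (simp add: add_increasing2)
  then have "ennreal c \<le> ennreal (1 + c powr p)" by (rule ennreal_leI)
  then show ?thesis using real by (simp add: ennreal_plus)
qed simp

text \<open>A Bochner integral is 0 when the integrand is not integrable. Almost everywhere
  integrability of \<open>C_integrand\<close> is therefore part of the conclusion: it certifies that
  the values of \<open>T_op\<close> are genuine integrals.\<close>

theorem theorem2p11:
  fixes D :: "'n::finite \<Rightarrow> complex set" and p :: ennreal and r :: real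
  assumes domain: "\<And>k. open (D k) \<and> connected (D k) \<and> D k \<noteq> {}"
    and bdd: "bounded (product_domain D)"
    and bdry: "\<And>k. piecewise_C1_boundary (D k)"
    and p: "1 \<le> p"
    and r: "r > max (if p = \<infinity> then 2 else 2 * enn2real p / (enn2real p + 2)) 1"
  shows "\<exists>C::real. C > 0 \<and>
    (\<forall>f :: 'n \<Rightarrow> complex ^ 'n \<Rightarrow> complex.
       (\<forall>j. f j locally_integrable_on product_domain D) \<and>
       weakly_dbar_closed (product_domain D) f \<and>
       (\<forall>I. I \<noteq> {} \<longrightarrow>
          (\<exists>g. represents_f_I (product_domain D) f I g) \<and>
          in_Lp p (vol D (- I))
            (\<lambda>z''. epow (slice_integral r D I (f_I (product_domain D) f I) z'') (1 / r)))
       \<longrightarrow>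
       (AE z in lebesgue_on (product_domain D). \<forall>I. I \<noteq> {} \<longrightarrow>
          integrable (vol D I) (C_integrand I (f_I (product_domain D) f I) z)) \<and>
       weakly_solves_dbar (product_domain D) (T_op D f) f \<and>
       (p < \<infinity> \<longrightarrow>
          epow (Lp_norm p (lebesgue_on (product_domain D)) (\<lambda>z. ennreal (norm (T_op D f z))))
               (enn2real p)
          \<le> ennreal C * (\<Sum>I\<in>{I. I \<noteq> {}}.
               \<integral>\<^sup>+ z''. epow (slice_integral r D I (f_I (product_domain D) f I) z'')
                        (enn2real p / r) \<partial>vol D (- I))) \<and>
       (p = \<infinity> \<longrightarrow>
          Lp_norm p (lebesgue_on (product_domain D)) (\<lambda>z. ennreal (norm (T_op D f z)))
          \<le> ennreal C * (\<Sum>I\<in>{I. I \<noteq> {}}.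
               esssup (vol D (- I))
                 (\<lambda>z''. epow (slice_integral r D I (f_I (product_domain D) f I) z'') (1 / r)))))"
proof -
  let ?U = "product_domain D" and ?\<I> = "{I :: 'n set. I \<noteq> {}}"
  have oD: "open (D i)" and neD: "D i \<noteq> {}" for i using domain by auto
  obtain R where R: "\<And>z. z \<in> ?U \<Longrightarrow> norm z < R"
    using bdd unfolding bounded_iff by (metis gt_ex le_less_trans)
  have DR: "norm w < R" if w: "w \<in> D i" for i w
  proof -
    \<comment> \<open>A point of one factor is completed to a point of the product by arbitrary
      points of the other nonempty factors, so the bound for the product passes to each
      factor.\<close>
    define z :: "complex ^ 'n" where "z = (\<chi> j. if j = i then w else (SOME x. x \<in> D j))"
    have "z \<in> ?U" using neD w by (auto simp: z_def product_domain_def some_in_eq)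
    moreover have "norm (z $ i) \<le> norm z" by (rule Finite_Cartesian_Product.norm_nth_le)
    ultimately show ?thesis using R[of z] by (simp add: z_def)
  qed
  have oU: "open ?U" by (rule open_product_domain[OF oD])
  have U_meas: "?U \<inter> space lebesgue \<in> sets lebesgue" using oU
      by (simp add: lmeasurable_open sets_completionI_sets)
  have r1: "1 \<le> r" "0 < r" using r by auto
  define q where "q = enn2real p"
  have q: "1 \<le> q" "p = ennreal q" if "p < \<infinity>"
    using that p by (cases p; simp add: q_def)+
  define P where "P I c \<longleftrightarrow> (\<forall>G. G \<in> borel_measurable borel \<and> integrable lborel G \<and> (\<forall>z. z \<notin> ?U
      \<longrightarrow> G z = 0) \<longrightarrow>
      (\<integral>\<^sup>+z. epow (ennreal (norm (cauchy_transform (2 * R) I G z))) q \<partial>lborel)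
          \<le> ennreal c * (\<integral>\<^sup>+z''. epow (slice_power r I G z'') (q / r) \<partial>PL (- I)))"
          for I :: "'n set" and c
  define Q where "Q I c \<longleftrightarrow> (\<forall>G z. G \<in> borel_measurable borel \<longrightarrow>
      ennreal (norm (cauchy_transform (2 * R) I G z)) \<le> ennreal c * epow (slice_power r I G
          (restrict (($) z) (- I))) (1 / r))" for I :: "'n set" and c
  have "\<exists>c\<ge>0. (p < \<infinity> \<longrightarrow> P I c) \<and> (p = \<infinity> \<longrightarrow> Q I c)" for I
  proof (cases "p = \<infinity>")
    case True
    then have "r > 2" using r by simp
    \<comment> \<open>The conjugate exponent of \<open>r\<close>; it is below 2 because r >
      2.\<close>
    then have "0 < r / (r - 1)" "r / (r - 1) < 2" "1 / r + 1 / (r / (r - 1)) = 1"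
      by (auto simp: field_simps)
    then have "\<exists>c\<ge>0. Q I c"
      unfolding Q_def by (intro cauchy_transform_Linf_bound[where s = "r / (r - 1)"] r1)
    with True show ?thesis by auto
  next
    case False
    then have pf: "p < \<infinity>" by (simp add: less_top)
    have "r > 2 * q / (q + 2)" using r False by (simp add: q_def)
    from young_exponent[OF q(1)[OF pf] r1(1) this] obtain s where
      s: "0 < s" "s < 2" "1 / min r q + 1 / s = 1 + 1 / q" by blast
    have "\<exists>c\<ge>0. P I c"
      unfolding P_def by (rule cauchy_transform_Lp_bound[OF oD DR q(1)[OF pf] r1(1) s(3,1,2)])
    with False show ?thesis by auto
  qed
  then obtain C where Cnn: "\<And>I. C I \<ge> 0" and CP: "\<And>I. p < \<infinity> \<Longrightarrow> P I (C I)" and CQ: "\<And>I. p = \<infinity>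
      \<Longrightarrow> Q I (C I)"
    by metis
  note C = Cnn CP[unfolded P_def, rule_format] CQ[unfolded Q_def, rule_format]
  \<comment> \<open>One constant for all \<open>I\<close>, fixed before \<open>f\<close>; the
    summand 1 keeps it positive.\<close>
  define C0 where "C0 = 1 + (\<Sum>I\<in>?\<I>. C I)"
  have C0: "C0 \<ge> 1" "C I \<le> C0" if "I \<noteq> {}" for I
  proof -
    show "C0 \<ge> 1" unfolding C0_def using C(1) by (simp add: sum_nonneg)
    have "C I \<le> (\<Sum>I\<in>?\<I>. C I)" using C(1) that by (intro member_le_sum) auto
    then show "C I \<le> C0" by (simp add: C0_def)
  qed
  have C0pos: "C0 > 0" using C0(1)[of UNIV] by simp
  have I_ne: "?\<I> \<noteq> {}" by auto
  have N: "real (card ?\<I>) > 0" using I_ne by (simp add: card_gt_0_iff)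
  \<comment> \<open>For finite \<open>p\<close> the power of a sum over all \<open>I\<close> costs
    the factor from \<open>epow_sum_le\<close>; for \<open>p = \<infinity>\<close> the triangle
    inequality costs nothing.\<close>
  define K where "K = (if p = \<infinity> then C0 else real (card ?\<I>) powr q * C0)"
  have "real (card ?\<I>) powr q > 0" unfolding powr_gt_zero using N by linarith
  then have "real (card ?\<I>) powr q * C0 > 0" using C0pos by (rule mult_pos_pos)
  then have K: "K > 0" using C0pos unfolding K_def by (simp only: if_split simp_thms)
  show ?thesis
  proof (intro exI[of _ K] conjI K allI impI)
    fix f :: "'n \<Rightarrow> complex ^ 'n \<Rightarrow> complex"
    assume "(\<forall>j. f j locally_integrable_on ?U) \<and> weakly_dbar_closed ?U f \<and>
       (\<forall>I. I \<noteq> {} \<longrightarrow> (\<exists>g. represents_f_I ?U f I g) \<and>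
          in_Lp p (vol D (- I)) (\<lambda>z''. epow (slice_integral r D I (f_I ?U f I) z'') (1 / r)))"
    then have fl: "\<And>j. f j locally_integrable_on ?U" and closed: "weakly_dbar_closed ?U f"
      and ex: "\<And>I. I \<noteq> {} \<Longrightarrow> \<exists>g. represents_f_I ?U f I g"
      and Lp: "\<And>I. I \<noteq> {} \<Longrightarrow> in_Lp p (vol D (- I)) (\<lambda>z''. epow (slice_integral r D I (f_I ?U f I)
          z'') (1 / r))"
      by blast+
    have rep: "represents_f_I ?U f I (f_I ?U f I)" if "I \<noteq> {}" for I
      by (rule represents_f_I_f_I[OF fl ex[OF that]])
    have "\<forall>I. \<exists>G. I \<noteq> {} \<longrightarrow> G \<in> borel_measurable borel \<and> (\<forall>z. z \<notin> ?U \<longrightarrow> G z = 0) \<and>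
       (AE z in lborel. z \<in> ?U \<longrightarrow> G z = f_I ?U f I z)"
      using ex_borel_representative[OF represents_locally_integrable[OF rep] oU] by blast
    then obtain G where G: "\<And>I. I \<noteq> {} \<Longrightarrow> G I \<in> borel_measurable borel"
      "\<And>I z. I \<noteq> {} \<Longrightarrow> z \<notin> ?U \<Longrightarrow> G I z = 0"
      "\<And>I. I \<noteq> {} \<Longrightarrow> AE z in lborel. z \<in> ?U \<longrightarrow> G I z = f_I ?U f I z"
      unfolding choice_iff by blast
    let ?sl = "\<lambda>I z''. slice_integral r D I (f_I ?U f I) z''"
    have slice: "AE z'' in PL (- I). z'' \<in> Pi\<^sub>E (- I) D \<longrightarrow> ?sl I z''
        = slice_power r I (G I) z''" if "I \<noteq> {}" for I
      by (rule slice_integral_eq_slice_power[OF oD]) (erule G(2)[OF that], rule G(3)[OF that])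
    have slice_int: "(\<integral>\<^sup>+z''. epow (?sl I z'') a \<partial>vol D (- I))
        = (\<integral>\<^sup>+z''. epow (slice_power r I (G I) z'') a \<partial>PL (- I))" if "I \<noteq> {}" for I a
      by (rule nn_integral_slice_eq_slice_power[OF oD]) (erule G(2)[OF that], rule G(3)[OF that])
    define E where "E I = esssup (vol D (- I)) (\<lambda>z''. epow (?sl I z'') (1 / r))" for I
    have slice_power_le_E: "AE z'' in PL (- I). z'' \<in> Pi\<^sub>E (- I) D
        \<longrightarrow> epow (slice_power r I (G I) z'') (1 / r) \<le> E I" if "I \<noteq> {}" for I
    proof -
      have "AE z'' in PL (- I). z'' \<in> Pi\<^sub>E (- I) D \<longrightarrow> epow (?sl I z'') (1 / r) \<le> E I"
        using esssup_AE[where M = "vol D (- I)" and f = "\<lambda>z''. epow (?sl I z'') (1 / r)"]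
        unfolding AE_vol[OF oD] E_def .
      with slice[OF that] show ?thesis by eventually_elim auto
    qed
    have Gint: "integrable lborel (G I)" if I: "I \<noteq> {}" for I
    proof (rule integrable_of_slices[OF oD DR r1(1) G(1)[OF I]])
      show "G I z = 0" if "z \<notin> ?U" for z by (rule G(2)[OF I that])
      let ?P = "Pi\<^sub>E (- I) D"
      have P: "?P \<in> sets (PL (- I))" by (rule PiE_in_sets_PL[OF oD])
      have Pfin: "emeasure (PL (- I)) ?P < \<infinity>" by (rule emeasure_PiE_finite[OF oD DR])
      have ind: "(indicator ?P :: ('n \<Rightarrow> complex) \<Rightarrow> ennreal) \<in> borel_measurable (PL (- I))"
        by (rule borel_measurable_indicator[OF P])
      show "(\<integral>\<^sup>+z''. epow (slice_power r I (G I) z'') (1 / r) * indicator ?P z'' \<partial>PL (- I)) < \<infinity>"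
      proof (cases "p = \<infinity>")
        case True
        have Efin: "E I < \<infinity>" using Lp[OF I] True by (simp add: in_Lp_def Lp_norm_def E_def)
        have "(\<integral>\<^sup>+z''. epow (slice_power r I (G I) z'') (1 / r) * indicator ?P z'' \<partial>PL (- I))
            \<le> (\<integral>\<^sup>+z''. E I * indicator ?P z'' \<partial>PL (- I))"
        proof (rule nn_integral_mono_AE)
          show "AE z'' in PL (- I). epow (slice_power r I (G I) z'') (1 / r) * indicator ?P z''
              \<le> E I * indicator ?P z''"
            using slice_power_le_E[OF I] by eventually_elim (auto simp: indicator_def)
        qed
        also have "\<dots> = E I * emeasure (PL (- I)) ?P" by (rule nn_integral_cmult_indicator[OF P])
        also have "\<dots> < \<infinity>" using Efin Pfin by (simp add: ennreal_mult_less_top)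
        finally show ?thesis .
      next
        case False
        then have pf: "p < \<infinity>" by (simp add: less_top)
        have "(\<integral>\<^sup>+z''. epow (?sl I z'') (q / r) \<partial>vol D (- I)) < \<infinity>"
          using Lp[OF I] False by (simp add: in_Lp_def Lp_norm_def epow_epow q_def)
        then have fin: "(\<integral>\<^sup>+z''. epow (slice_power r I (G I) z'') (q / r) \<partial>PL (- I)) < \<infinity>"
            using slice_int[OF I] by simp
        have m: "(\<lambda>z''. epow (slice_power r I (G I) z'') (q / r)) \<in> borel_measurable (PL (- I))"
          by (rule measurable_compose[OF slice_power_measurable[OF G(1)[OF I]] epow_measurable])
              simp
        \<comment> \<open>Here p \<ge> 1 enters: the slice norm is at most 1 plus its
          \<open>q\<close>-th power, and the 1 is integrable because \<open>?P\<close> has finite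
          volume.\<close>
        have "(\<integral>\<^sup>+z''. epow (slice_power r I (G I) z'') (1 / r) * indicator ?P z'' \<partial>PL (- I)) \<le>
            (\<integral>\<^sup>+z''. indicator ?P z'' + epow (slice_power r I (G I) z'') (q / r) \<partial>PL (- I))"
        proof (rule nn_integral_mono)
          fix z''
          have "epow (slice_power r I (G I) z'') (1 / r)
              \<le> 1 + epow (slice_power r I (G I) z'') (q / r)"
            using epow_le_1_plus[OF q(1)[OF pf], of "epow (slice_power r I (G I) z'') (1 / r)"]
                by (simp add: epow_epow)
          then show "epow (slice_power r I (G I) z'') (1 / r) * indicator ?P z''
              \<le> indicator ?P z'' + epow (slice_power r I (G I) z'') (q / r)"
            by (auto simp: indicator_def)
        qed
        also have "\<dots> = emeasure (PL (- I)) ?P + (\<integral>\<^sup>+z''. epow (slice_power r I (G I) z'') (q / r)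
            \<partial>PL (- I))"
          by (simp only: nn_integral_add[OF ind m] nn_integral_indicator[OF P])
        also have "\<dots> < \<infinity>" using Pfin fin by simp
        finally show ?thesis .
      qed
    qed
    \<comment> \<open>A Borel, integrable function on the whole space that equals minus
      \<open>T_op D f\<close> almost everywhere on the domain.\<close>
    define u where "u z = (\<Sum>I\<in>?\<I>. cauchy_transform (2 * R) I (G I) z)" for z
    note CGi = cauchy_transform_measurable[OF G(1) Gint]
    have u: "integrable lborel u" unfolding u_def[abs_def]
        by (intro Bochner_Integration.integrable_sum CGi) auto
    have um: "u \<in> borel_measurable borel"
      using borel_measurable_integrable[OF u] unfolding measurable_lborel2 .
    have one: "AE z in lborel. z \<in> ?U \<longrightarrow> C_op D I (f_I ?U f I) z
        = cauchy_transform (2 * R) I (G I) z \<and>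
       integrable (vol D I) (C_integrand I (f_I ?U f I) z)" if I: "I \<noteq> {}" for I
    proof -
      have "AE z in lborel. z \<in> ?U \<longrightarrow> C_op D I (f_I ?U f I) z = cauchy_transform (2 * R) I (G I) z \<and>
        (integrable (PL I) (\<lambda>\<zeta>. G I (glue I \<zeta> (($) z)) * kernel_prod (2 * R) I (\<lambda>i. \<zeta> i - z $ i)) \<longrightarrow>
          integrable (vol D I) (C_integrand I (f_I ?U f I) z))"
        by (rule C_op_eq_cauchy_transform[OF oD DR G(1)[OF I]]) (assumption, erule G(2)[OF I],
            rule G(3)[OF I])
      \<comment> \<open>Duality with the constant function 1: Fubini makes the slices integrable for
        almost every \<open>z\<close>.\<close>
      moreover have "AE z in lborel. integrable (PL I) (\<lambda>\<zeta>. G I (glue I \<zeta> (($) z)) * kernel_prod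
          (2 * R) I (\<lambda>i. \<zeta> i - z $ i))"
        using C_duality(1)[OF Gint[OF I] G(1)[OF I], of "\<lambda>_. 1" 1 I "2 * R"] by simp
      ultimately show ?thesis by eventually_elim blast
    qed
    have all: "AE z in lborel. \<forall>I\<in>?\<I>. z \<in> ?U \<longrightarrow> C_op D I (f_I ?U f I) z
        = cauchy_transform (2 * R) I (G I) z \<and>
       integrable (vol D I) (C_integrand I (f_I ?U f I) z)"
      using one by (intro eventually_ball_finite) auto
    have Tu: "AE z in lborel. z \<in> ?U \<longrightarrow> - u z = T_op D f z"
      using all
    proof eventually_elim
      case (elim z)
      show ?case
      proof
        assume "z \<in> ?U"
        with elim have "(\<Sum>I\<in>?\<I>. C_op D I (f_I ?U f I) z) = u z"
          unfolding u_def by (intro sum.cong refl) blast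
        then show "- u z = T_op D f z" by (simp add: T_op_def)
      qed
    qed
    show "AE z in lebesgue_on ?U. \<forall>I. I \<noteq> {} \<longrightarrow> integrable (vol D I) (C_integrand I (f_I ?U f I) z)"
      unfolding AE_restrict_space_iff[OF U_meas] AE_completion_iff
      using all by eventually_elim blast
    have ind: "(indicator A :: complex ^ 'n \<Rightarrow> real) \<in> borel_measurable borel" if "A \<in> sets borel"
        for A
      using that by (rule borel_measurable_indicator)
    have T_cut: "(\<lambda>z. indicator A z *\<^sub>R (- u z)) \<in> borel_measurable lborel"
       "AE z in lborel. indicator A z *\<^sub>R T_op D f z = indicator A z *\<^sub>R (- u z)"
           if A: "A \<in> sets borel" "A \<subseteq> ?U" for A
    proof -
      show "(\<lambda>z. indicator A z *\<^sub>R (- u z)) \<in> borel_measurable lborel"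
        unfolding measurable_lborel2 by (intro borel_measurable_scaleR ind A(1)
            borel_measurable_uminus um)
      show "AE z in lborel. indicator A z *\<^sub>R T_op D f z = indicator A z *\<^sub>R (- u z)"
        using Tu by eventually_elim (use A(2) in \<open>auto simp: indicator_def\<close>)
    qed
    show "weakly_solves_dbar ?U (T_op D f) f"
      unfolding weakly_solves_dbar_def weak_dbar_def
    proof (intro allI conjI impI fl)
      fix k
      show "T_op D f locally_integrable_on ?U"
        unfolding locally_integrable_on_def set_integrable_def
      proof (intro allI impI, elim conjE)
        fix A assume A: "compact A" "A \<subseteq> ?U"
        have Ab: "A \<in> sets borel" using A(1) by (intro borel_closed compact_imp_closed)
        have "integrable lborel (\<lambda>z. indicat_real A z *\<^sub>R - u z)"
          using u Ab by (intro integrable_mult_indicator) auto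
        then show "integrable lebesgue (\<lambda>z. indicat_real A z *\<^sub>R T_op D f z)"
          using completion_cong_AE(3)[OF T_cut[OF Ab A(2)]] by simp
      qed
      fix \<phi> assume \<phi>: "test_function ?U \<phi>"
      note t = test_function_dbar[OF \<phi>, of k]
      have weak: "(LINT z|lborel. G (insert k I) z * \<psi> z) = - (LINT z|lborel. G I z * dbar k \<psi> z)"
        if I: "I \<noteq> {}" "k \<notin> I" and \<psi>: "test_function ?U \<psi>" for I k \<psi>
      proof -
        have "(LINT z:?U|lebesgue. f_I ?U f (insert k I) z * \<psi> z)
            = (LINT z|lborel. G (insert k I) z * \<psi> z)"
          by (rule set_integral_eq_representative[OF G(1) _ G(3) test_functionD(4)[OF \<psi>]])
              (simp_all add: G(2))
        moreover have "(LINT z:?U|lebesgue. f_I ?U f I z * dbar k \<psi> z)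
            = (LINT z|lborel. G I z * dbar k \<psi> z)"
          by (rule set_integral_eq_representative[OF G(1)[OF I(1)] _ G(3)[OF I(1)]
              test_functionD(4)[OF test_function_dbar[OF \<psi>]]])
            (simp add: G(2) I)
        moreover have "represents_f_I ?U f (insert k I) (f_I ?U f (insert k I))" by (rule rep) simp
        ultimately show ?thesis using represents_insert[OF closed rep[OF I(1)] _ I(2) \<psi>] by simp
      qed
      have fk: "f_I ?U f {k} = f k" by (simp add: f_I_def)
      have 1: "(LINT z:?U|lebesgue. f k z * \<phi> z) = (LINT z|lborel. G {k} z * \<phi> z)"
        unfolding fk[symmetric]
        by (rule set_integral_eq_representative[OF G(1) _ G(3) test_functionD(4)[OF \<phi>]]) (simp_all
            add: G(2))
      have 2: "(LINT z:?U|lebesgue. T_op D f z * dbar k \<phi> z) = (LINT z|lborel. - u z * dbar k \<phi> z)"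
        by (rule set_integral_eq_representative[OF borel_measurable_uminus[OF um] _ Tu
            test_functionD(4)[OF t]])
          (simp add: test_function_outside[OF t])
      have 3: "(LINT z|lborel. u z * dbar k \<phi> z) = (LINT z|lborel. G {k} z * \<phi> z)"
        unfolding u_def by (rule weak_solution[OF oD neD DR Gint G(1) G(2) weak \<phi>])
      show "(LINT z:?U|lebesgue. f k z * \<phi> z) = (- 1) ^ length [k] * (LINT z:?U|lebesgue. T_op D f
          z * foldr dbar [k] \<phi> z)"
        using 1 2 3 by simp
    qed
    show "epow (Lp_norm p (lebesgue_on ?U) (\<lambda>z. ennreal (norm (T_op D f z)))) (enn2real p)
          \<le> ennreal K * (\<Sum>I\<in>?\<I>. \<integral>\<^sup>+ z''. epow (?sl I z'') (enn2real p / r) \<partial>vol D (- I))"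
              if pf: "p < \<infinity>"
    proof -
      let ?T = "\<lambda>z. epow (ennreal (norm (T_op D f z))) q"
      let ?c = "\<lambda>I z. epow (ennreal (norm (cauchy_transform (2 * R) I (G I) z))) q"
      have cm: "?c I \<in> borel_measurable lborel" if "I \<in> ?\<I>" for I
      proof -
        have "I \<noteq> {}" using that by simp
        then have "cauchy_transform (2 * R) I (G I) \<in> borel_measurable borel" by (intro CGi(2))
        from measurable_compose[OF measurable_compose[OF measurable_compose[OF this
            borel_measurable_norm]
          measurable_ennreal] epow_measurable]
        show ?thesis unfolding measurable_lborel2 .
      qed
      have "epow (Lp_norm p (lebesgue_on ?U) (\<lambda>z. ennreal (norm (T_op D f z)))) (enn2real p)
         = (\<integral>\<^sup>+z. ?T z \<partial>lebesgue_on ?U)"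
        using pf q[OF pf] by (simp add: Lp_norm_def epow_epow q_def[symmetric])
      also have "\<dots> = (\<integral>\<^sup>+z. ?T z * indicator ?U z \<partial>lborel)"
        by (simp only: nn_integral_restrict_space[OF U_meas] nn_integral_completion)
      also have "\<dots> \<le> (\<integral>\<^sup>+z. ennreal (real (card ?\<I>) powr q) * (\<Sum>I\<in>?\<I>. ?c I z) \<partial>lborel)"
      proof (rule nn_integral_mono_AE)
        show "AE z in lborel. ?T z * indicator ?U z \<le> ennreal (real (card ?\<I>) powr q) * (\<Sum>I\<in>?\<I>. ?c
            I z)"
          using Tu
        proof eventually_elim
          case (elim z)
          show ?case
          proof (cases "z \<in> ?U")
            case True
            have "norm (u z) \<le> (\<Sum>I\<in>?\<I>. norm (cauchy_transform (2 * R) I (G I) z))"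
                unfolding u_def by (rule norm_sum)
            then have "ennreal (norm (u z)) \<le> (\<Sum>I\<in>?\<I>. ennreal (norm (cauchy_transform (2 * R) I (G
                I) z)))"
              by (subst sum_ennreal) (auto intro: ennreal_leI)
            then have "epow (ennreal (norm (u z))) q \<le> epow (\<Sum>I\<in>?\<I>. ennreal (norm
                (cauchy_transform (2 * R) I (G I) z))) q"
              using q(1)[OF pf] by (intro epow_mono) auto
            also have "\<dots> \<le> ennreal (real (card ?\<I>) powr q) * (\<Sum>I\<in>?\<I>. ?c I z)"
              by (rule epow_sum_le[OF _ I_ne q(1)[OF pf]]) simp
            finally have "epow (ennreal (norm (T_op D f z))) q
                \<le> ennreal (real (card ?\<I>) powr q) * (\<Sum>I\<in>?\<I>. ?c I z)"
              unfolding elim[rule_format, OF True, symmetric] norm_minus_cancel .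
            with True show ?thesis by (simp only: indicator_simps mult_1_right)
          qed simp
        qed
      qed
      also have "\<dots> = ennreal (real (card ?\<I>) powr q) * (\<Sum>I\<in>?\<I>. \<integral>\<^sup>+z. ?c I z \<partial>lborel)"
        by (subst nn_integral_cmult, intro borel_measurable_sum cm, assumption,
            subst nn_integral_sum, rule cm, assumption, rule refl)
      also have "\<dots> \<le> ennreal (real (card ?\<I>) powr q) * (\<Sum>I\<in>?\<I>. ennreal C0 * (\<integral>\<^sup>+ z''. epow (?sl I
          z'') (q / r) \<partial>vol D (- I)))"
      proof (intro mult_left_mono sum_mono)
        fix I assume "I \<in> ?\<I>"
        then have I: "I \<noteq> {}" by simp
        have "(\<integral>\<^sup>+z. ?c I z \<partial>lborel) \<le> ennreal (C I) * (\<integral>\<^sup>+z''. epow (slice_power r I (G I) z'')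
            (q / r) \<partial>PL (- I))"
          by (rule C(2)[OF pf]) (use G(1,2)[OF I] Gint[OF I] in blast)
        also have "\<dots> \<le> ennreal C0 * (\<integral>\<^sup>+z''. epow (slice_power r I (G I) z'') (q / r) \<partial>PL (- I))"
          using C0(2)[OF I] by (intro mult_right_mono ennreal_leI) auto
        finally show "(\<integral>\<^sup>+z. ?c I z \<partial>lborel) \<le> ennreal C0 * (\<integral>\<^sup>+ z''. epow (?sl I z'') (q / r)
            \<partial>vol D (- I))"
          unfolding slice_int[OF I] .
      qed simp
      also have "\<dots> = ennreal K * (\<Sum>I\<in>?\<I>. \<integral>\<^sup>+ z''. epow (?sl I z'') (enn2real p / r) \<partial>vol D (- I))"
        using pf C0pos by (simp add: K_def q_def sum_distrib_left ennreal_mult mult.assoc)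
      finally show ?thesis .
    qed
    show "Lp_norm p (lebesgue_on ?U) (\<lambda>z. ennreal (norm (T_op D f z)))
          \<le> ennreal K * (\<Sum>I\<in>?\<I>. esssup (vol D (- I)) (\<lambda>z''. epow (?sl I z'') (1 / r)))" if pi: "p
              = \<infinity>"
    proof -
      \<comment> \<open>\<open>esssup_I\<close> asks for measurability. On the domain
        \<open>T_op D f\<close> agrees almost everywhere with the Borel function \<open>- u\<close>,
        which suffices in the completed measure.\<close>
      have "T_op D f \<in> borel_measurable (lebesgue_on ?U)"
        unfolding borel_measurable_restrict_space_iff[OF U_meas]
        by (rule completion_cong_AE(1)[OF T_cut[OF borel_open[OF oU] subset_refl]])
      then have m: "(\<lambda>z. ennreal (norm (T_op D f z))) \<in> borel_measurable (lebesgue_on ?U)"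
        by (intro measurable_compose[OF _ measurable_ennreal] measurable_compose[OF _
            borel_measurable_norm])
      \<comment> \<open>An exceptional null set of z'' becomes a cylinder of points
        \<open>z\<close>, which is again null.\<close>
      have CE: "AE z in lborel. z \<in> ?U \<longrightarrow> ennreal (norm (cauchy_transform (2 * R) I (G I) z))
          \<le> ennreal C0 * E I" if I: "I \<noteq> {}" for I
        using AE_restrict_nth[OF slice_power_le_E[OF I]]
      proof (rule eventually_mono, intro impI)
        fix z
        assume elim: "restrict (($) z) (- I) \<in> Pi\<^sub>E (- I) D
            \<longrightarrow> epow (slice_power r I (G I) (restrict (($) z) (- I))) (1 / r) \<le> E I"
          "z \<in> ?U"
        then have "restrict (($) z) (- I) \<in> Pi\<^sub>E (- I) D" by (auto simp: product_domain_def)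
        with elim have le: "epow (slice_power r I (G I) (restrict (($) z) (- I))) (1 / r)
            \<le> E I" by blast
        have "ennreal (norm (cauchy_transform (2 * R) I (G I) z))
            \<le> ennreal (C I) * epow (slice_power r I (G I) (restrict (($) z) (- I))) (1 / r)"
          by (rule C(3)[OF pi G(1)[OF I]])
        also have "\<dots> \<le> ennreal C0 * E I"
          using C0(2)[OF I] le by (intro mult_mono ennreal_leI) auto
        finally show "ennreal (norm (cauchy_transform (2 * R) I (G I) z)) \<le> ennreal C0 * E I" .
      qed
      have "AE z in lborel. \<forall>I\<in>?\<I>. z \<in> ?U \<longrightarrow> ennreal (norm (cauchy_transform (2 * R) I (G I) z))
          \<le> ennreal C0 * E I"
        using CE by (intro eventually_ball_finite) auto
      then have "AE z in lborel. z \<in> ?U \<longrightarrow> ennreal (norm (T_op D f z)) \<le> ennreal C0 * (\<Sum>I\<in>?\<I>. E I)"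
        using Tu
      proof eventually_elim
        case (elim z)
        show ?case
        proof
          assume z: "z \<in> ?U"
          have "norm (u z) \<le> (\<Sum>I\<in>?\<I>. norm (cauchy_transform (2 * R) I (G I) z))"
              unfolding u_def by (rule norm_sum)
          then have "ennreal (norm (u z)) \<le> (\<Sum>I\<in>?\<I>. ennreal (norm (cauchy_transform (2 * R) I (G
              I) z)))"
            by (subst sum_ennreal) (auto intro: ennreal_leI)
          also have "\<dots> \<le> (\<Sum>I\<in>?\<I>. ennreal C0 * E I)" using elim(1) z by (intro sum_mono) blast
          also have "\<dots> = ennreal C0 * (\<Sum>I\<in>?\<I>. E I)" by (simp only: sum_distrib_left)
          finally show "ennreal (norm (T_op D f z)) \<le> ennreal C0 * (\<Sum>I\<in>?\<I>. E I)"
            unfolding elim(2)[rule_format, OF z, symmetric] norm_minus_cancel .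
        qed
      qed
      then have "AE z in lebesgue_on ?U. ennreal (norm (T_op D f z)) \<le> ennreal C0 * (\<Sum>I\<in>?\<I>. E I)"
        unfolding AE_restrict_space_iff[OF U_meas] AE_completion_iff .
      from esssup_I[OF m this] show ?thesis
        using pi by (simp add: Lp_norm_def K_def E_def)
    qed
  qed
qed

end
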